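(* Let $n\ge 1$ and $\bm r\in\mathbb R^n$, let $|\psi_{\bm r}\rangle$ be the canonical $n$-mode squeezed probe, and let $\bm F_{\mathrm{passive}}(\bm r)$ be its $n^2\times n^2$ passive Fisher matrix. Then $$\det \bm F_{\mathrm{passive}}(\bm r)=0\quad\Longleftrightarrow\quad \bm r\in\mathcal A_{C_n}=\bigcup_{\bm\alpha\in\Sigma_+}\ker\bm\alpha ,$$ and for $\bm r\in\mathcal A_{C_n}$ the nullity of $\bm F_{\mathrm{passive}}(\bm r)$ equals the number of positive restricted roots $\bm\alpha\in\Sigma_+$ with $\bm\alpha(\bm r)=0$. Moreover each vanishing root identifies its Fisher-null passive generator: if $\bm\alpha(\bm r)=0$, then the basis direction of the passive generator associated with $\bm\alpha$ lies in the kernel of $\bm F_{\mathrm{passive}}(\bm r)$.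
   Context: Bosonic modes: on the Fock space of $n$ bosonic modes let $\hat a_j,\hat a_j^\dagger$ be the annihilation and creation operators, $[\hat a_j,\hat a_k^\dagger]=\delta_{jk}$, and $|0\rangle$ the vacuum. For $\bm r=(r_1,\dots,r_n)\in\mathbb R^n$ the canonical probe is $|\psi_{\bm r}\rangle=\hat S(\bm r)|0\rangle$ with $\hat S(\bm r)=\prod_{j=1}^n \exp\!\big[\tfrac12 r_j(\hat a_j^2-\hat a_j^{\dagger 2})\big]$. Passive generators ($n^2$ in total): $\hat g_j^{\mathrm{rot}}=\hat a_j^\dagger\hat a_j$ for $1\le j\le n$; $\hat g_{jk}^{\mathrm{bsX}}=\hat a_j^\dagger\hat a_k+\hat a_k^\dagger\hat a_j$ and $\hat g_{jk}^{\mathrm{bsY}}=-i(\hat a_j^\dagger\hat a_k-\hat a_k^\dagger\hat a_j)$ for $1\le j<k\le n$. Denote them $\hat g_1,\dots,\hat g_{n^2}$. Passive Fisher matrix: $F_{\mu\nu}=2\langle\{\Delta\hat g_\mu,\Delta\hat g_\nu\}\rangle$, with $\Delta\hat g_\mu=\hat g_\mu-\langle\hat g_\mu\rangle$, $\{\cdot,\cdot\}$ the anticommutator and expectation values in $|\psi_{\bm r}\rangle$. This is the quantum Fisher information matrix at $\bm\theta=\bm 0$ of the family $e^{-i\sum_\mu\theta_\mu\hat g_\mu}|\psi_{\bm r}\rangle$. Positive restricted roots (type $C_n$): with linear forms $\bm e_j(\bm r)=r_j$ on $\mathbb R^n$, $\Sigma_+=\{2\bm e_j\}_{j=1}^n\cup\{\bm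 e_j-\bm e_k,\ \bm e_j+\bm e_k\}_{1\le j<k\le n}$. The generator associated with each root is $2\bm e_j\leftrightarrow\hat g_j^{\mathrm{rot}}$, $\bm e_j-\bm e_k\leftrightarrow\hat g_{jk}^{\mathrm{bsY}}$, $\bm e_j+\bm e_k\leftrightarrow\hat g_{jk}^{\mathrm{bsX}}$. *)

theory Defs
  imports "HOL-Analysis.Analysis"
begin

text \<open>
  A vector of the Fock space of the modes \<open>'n\<close> is given by its amplitudes \<open>\<psi> m\<close> in the number
  basis, where \<open>m j\<close> is the occupation number of mode \<open>j\<close>.  The modes are an arbitrary nonempty
  finite linearly ordered type, so that \<open>j < k\<close> makes sense; the number of modes is \<open>CARD('n)\<close>.
\<close>

type_synonym 'n fock = "('n \<Rightarrow> nat) \<Rightarrow> complex"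

definition fock_space :: "'n fock set" where
  "fock_space = {\<psi>. (\<lambda>m. (cmod (\<psi> m))\<^sup>2) summable_on UNIV}"

definition fock_inner :: "'n fock \<Rightarrow> 'n fock \<Rightarrow> complex" where
  "fock_inner \<phi> \<psi> = (\<Sum>\<^sub>\<infinity>m. cnj (\<phi> m) * \<psi> m)"

definition fock_norm :: "'n fock \<Rightarrow> real" where
  "fock_norm \<psi> = sqrt (\<Sum>\<^sub>\<infinity>m. (cmod (\<psi> m))\<^sup>2)"

definition finite_particle :: "'n fock set" where
  "finite_particle = {\<psi>. finite {m. \<psi> m \<noteq> 0}}"

definition vacuum :: "'n fock" where
  "vacuum = (\<lambda>m. if m = (\<lambda>_. 0) then 1 else 0)"

text \<open>
  The ladder operators act on all amplitude functions; on their usual dense domains this is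
  \<open>a\<^sub>j |m\<rangle> = \<surd>(m\<^sub>j) |m - e\<^sub>j\<rangle>\<close> and \<open>a\<^sub>j\<^sup>\<dagger> |m\<rangle> = \<surd>(m\<^sub>j + 1) |m + e\<^sub>j\<rangle>\<close>.
  In \<open>creat\<close> the factor \<open>sqrt (m j)\<close> vanishes whenever the subtraction is truncated.
\<close>

definition annih :: "'n \<Rightarrow> 'n fock \<Rightarrow> 'n fock" where
  "annih j \<psi> = (\<lambda>m. of_real (sqrt (real (m j + 1))) * \<psi> (m(j := m j + 1)))"

definition creat :: "'n \<Rightarrow> 'n fock \<Rightarrow> 'n fock" where
  "creat j \<psi> = (\<lambda>m. of_real (sqrt (real (m j))) * \<psi> (m(j := m j - 1)))"

definition unitary_op :: "('n fock \<Rightarrow> 'n fock) \<Rightarrow> bool" where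
  "unitary_op U \<longleftrightarrow>
     bij_betw U fock_space fock_space \<and>
     (\<forall>\<phi>\<in>fock_space. \<forall>\<psi>\<in>fock_space. \<forall>c. U (\<lambda>m. c * \<phi> m + \<psi> m) = (\<lambda>m. c * U \<phi> m + U \<psi> m)) \<and>
     (\<forall>\<phi>\<in>fock_space. \<forall>\<psi>\<in>fock_space. fock_inner (U \<phi>) (U \<psi>) = fock_inner \<phi> \<psi>)"

definition unitary_group :: "(real \<Rightarrow> 'n fock \<Rightarrow> 'n fock) \<Rightarrow> bool" where
  "unitary_group U \<longleftrightarrow>
     (\<forall>t. unitary_op (U t)) \<and>
     (\<forall>\<psi>\<in>fock_space. U 0 \<psi> = \<psi>) \<and>
     (\<forall>s t. \<forall>\<psi>\<in>fock_space. U (s + t) \<psi> = U s (U t \<psi>)) \<and>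
     (\<forall>\<psi>\<in>fock_space. ((\<lambda>t. fock_norm (\<lambda>m. U t \<psi> m - \<psi> m)) \<longlongrightarrow> 0) (at 0))"

definition generates :: "('n fock \<Rightarrow> 'n fock) \<Rightarrow> (real \<Rightarrow> 'n fock \<Rightarrow> 'n fock) \<Rightarrow> bool" where
  "generates A U \<longleftrightarrow> unitary_group U \<and>
     (\<forall>\<psi>\<in>finite_particle.
        ((\<lambda>t. fock_norm (\<lambda>m. (U t \<psi> m - \<psi> m) / of_real t - A \<psi> m)) \<longlongrightarrow> 0) (at 0))"

text \<open>
  Exponential in the sense of Stone's theorem: \<open>exp A\<close> is the time-one map of the strongly
  continuous unitary group whose generator extends \<open>A\<close> on the finite-particle vectors.  For the
  quadratic squeezing generators below the finite-particle vectors are analytic vectors, so that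
  \<open>A\<close> is essentially skew-adjoint there and this group exists and is unique.  (The power series of
  \<open>exp A\<close> does not serve as a definition: on the vacuum it diverges for large squeezing.)
\<close>

definition op_exp :: "('n fock \<Rightarrow> 'n fock) \<Rightarrow> 'n fock \<Rightarrow> 'n fock" where
  "op_exp A \<psi> = (THE \<phi>. \<exists>U. generates A U \<and> \<phi> = U 1 \<psi>)"

definition squeeze_generator :: "'n \<Rightarrow> real \<Rightarrow> 'n fock \<Rightarrow> 'n fock" where
  "squeeze_generator j s \<psi> =
     (\<lambda>m. of_real (s / 2) * (annih j (annih j \<psi>) m - creat j (creat j \<psi>) m))"

definition squeezer :: "real ^ 'n::{finite,linorder} \<Rightarrow> 'n fock \<Rightarrow> 'n fock" where
  "squeezer r = foldr (\<lambda>j S. op_exp (squeeze_generator j (r $ j)) \<circ> S) (sorted_list_of_set UNIV) id"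

definition probe :: "real ^ 'n::{finite,linorder} \<Rightarrow> 'n fock" where
  "probe r = squeezer r vacuum"

definition g_rot :: "'n \<Rightarrow> 'n fock \<Rightarrow> 'n fock" where
  "g_rot j \<psi> = creat j (annih j \<psi>)"

definition g_bsX :: "'n \<Rightarrow> 'n \<Rightarrow> 'n fock \<Rightarrow> 'n fock" where
  "g_bsX j k \<psi> = (\<lambda>m. creat j (annih k \<psi>) m + creat k (annih j \<psi>) m)"

definition g_bsY :: "'n \<Rightarrow> 'n \<Rightarrow> 'n fock \<Rightarrow> 'n fock" where
  "g_bsY j k \<psi> = (\<lambda>m. - \<i> * (creat j (annih k \<psi>) m - creat k (annih j \<psi>) m))"

text \<open>
  The \<open>n\<^sup>2\<close> passive generators are labelled by pairs of modes: for \<open>j < k\<close> the label \<open>(j, k)\<close>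
  stands for \<open>g_bsX j k\<close> and the label \<open>(k, j)\<close> for \<open>g_bsY j k\<close>.
\<close>

definition passive_generator :: "'n::linorder \<times> 'n \<Rightarrow> 'n fock \<Rightarrow> 'n fock" where
  "passive_generator \<mu> = (case \<mu> of (j, k) \<Rightarrow>
     if j = k then g_rot j else if j < k then g_bsX j k else g_bsY k j)"

definition expectation :: "'n fock \<Rightarrow> ('n fock \<Rightarrow> 'n fock) \<Rightarrow> complex" where
  "expectation \<psi> A = fock_inner \<psi> (A \<psi>)"

definition centred :: "'n fock \<Rightarrow> ('n fock \<Rightarrow> 'n fock) \<Rightarrow> 'n fock \<Rightarrow> 'n fock" where
  "centred \<psi> A \<phi> = (\<lambda>m. A \<phi> m - expectation \<psi> A * \<phi> m)"

definition anticommutator ::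
  "('n fock \<Rightarrow> 'n fock) \<Rightarrow> ('n fock \<Rightarrow> 'n fock) \<Rightarrow> 'n fock \<Rightarrow> 'n fock" where
  "anticommutator A B \<phi> = (\<lambda>m. A (B \<phi>) m + B (A \<phi>) m)"

text \<open>
  The expectation value of the anticommutator of two Hermitian operators is real; \<open>Re\<close> only
  converts it to type \<open>real\<close>.
\<close>

definition F_passive ::
  "real ^ 'n::{finite,linorder} \<Rightarrow> real ^ ('n \<times> 'n) ^ ('n \<times> 'n)" where
  "F_passive r = (\<chi> \<mu> \<nu>. 2 * Re (expectation (probe r)
     (anticommutator (centred (probe r) (passive_generator \<mu>))
                     (centred (probe r) (passive_generator \<nu>)))))"

definition positive_roots :: "(real ^ 'n::{finite,linorder} \<Rightarrow> real) set" where
  "positive_roots =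
     {\<lambda>r. 2 * r $ j | j. True} \<union>
     ({\<lambda>r. r $ j - r $ k | j k. j < k} \<union> {\<lambda>r. r $ j + r $ k | j k. j < k})"

definition arrangement :: "(real ^ 'n::{finite,linorder}) set" where
  "arrangement = (\<Union>\<alpha>\<in>positive_roots. {r. \<alpha> r = 0})"

text \<open>
  \<open>root_generator \<alpha> \<mu>\<close>: the passive generator with label \<open>\<mu>\<close> is the one associated with \<open>\<alpha>\<close>.
\<close>

inductive root_generator ::
  "(real ^ 'n::{finite,linorder} \<Rightarrow> real) \<Rightarrow> 'n \<times> 'n \<Rightarrow> bool" where
  rot: "root_generator (\<lambda>r. 2 * r $ j) (j, j)"
| bsY: "j < k \<Longrightarrow> root_generator (\<lambda>r. r $ j - r $ k) (k, j)"
| bsX: "j < k \<Longrightarrow> root_generator (\<lambda>r. r $ j + r $ k) (j, k)"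

lemma positive_root_iff_generator:
  "\<alpha> \<in> positive_roots \<longleftrightarrow> (\<exists>\<mu>. root_generator \<alpha> \<mu>)"
  unfolding positive_roots_def by (fastforce intro: root_generator.intros elim: root_generator.cases)

end

theory Submission
  imports Defs
begin

text \<open>
  On the number states the squeezing generator \<open>A\<close> is a real antisymmetric band matrix with
  \<open>\<parallel>A\<^sup>k |m\<rangle>\<parallel>\<close> at most \<open>K\<^sub>m \<rho>\<^sup>k k!\<close>, so for \<open>|t| \<rho> < 1\<close> the exponential series converges entrywise.  Absolute
  convergence gives the group law, antisymmetry then makes the matrices orthogonal, and dyadic
  powers extend them to a unitary group with generator \<open>A\<close>.  Every such group has the same Taylor
  coefficients on number states, so \<open>op_exp A\<close> is well defined.

  From \<open>[a \<plusminus> a\<^sup>\<dagger>, A] = \<mp> s (a \<plusminus> a\<^sup>\<dagger>)\<close> the quadratures are rescaled by the group, and so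
  the probe \<open>\<psi>\<close> satisfies \<open>a\<^sub>k \<psi> = - tanh r\<^sub>k a\<^sub>k\<^sup>\<dagger> \<psi>\<close>.  Hence each passive generator maps \<open>\<psi>\<close> to
  a multiple of \<open>a\<^sub>j\<^sup>\<dagger> a\<^sub>k\<^sup>\<dagger> \<psi>\<close>, the factor being \<open>- tanh r\<^sub>j\<close>, \<open>- (tanh r\<^sub>j + tanh r\<^sub>k)\<close> or
  \<open>\<i> (tanh r\<^sub>j - tanh r\<^sub>k)\<close> up to sign: it vanishes exactly when the associated root does.  The Fisher
  matrix is diagonal, by parity of the occupation numbers, by the phase \<open>\<i>\<close> between the X and Y
  generators of one pair of modes, and by independence of the modes for two rotations.
\<close>

section \<open>Square-summable amplitudes\<close>

text \<open>\<open>op_exp\<close> is a definite description over all groups with the given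
  derivative, so it says nothing before both existence and uniqueness are known. The growth bound
  gives every number state the same radius \<open>1 / rho\<close>, although the constant depends on
  the state; hence one step length suits the whole space, and time one is reached by iterating short
  steps. For bounded operators it is enough to compare number states. Quadratures are unbounded and
  need a domain: amplitudes that decay exponentially. It is stable under ladder operators, and the
  relation between annihilation and creation is itself a recursion with factors \<open>tanh\<close>
  of modulus below 1, so it forces decay anew after each short step. That relation is carried as a
  ratio of the two quadratures, because the ratio is multiplicative under squeezing and
  \<open>tanh\<close> is not. The same recursion bounds all amplitudes by the vacuum amplitude,
  which therefore cannot vanish; this turns a zero of the Fisher matrix into a zero of a
  coefficient.\<close>

lemma L2_set_le_fock_norm:
  assumes "\<phi> \<in> fock_space" "finite P"
  shows "L2_set (\<lambda>m. cmod (\<phi> m)) P \<le> fock_norm \<phi>"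
  unfolding L2_set_def fock_norm_def real_sqrt_le_iff
  using assms by (intro finite_sum_le_infsum) (auto simp: fock_space_def)

lemma fock_norm_nonneg [simp]: "0 \<le> fock_norm \<phi>"
  by (simp add: fock_norm_def infsum_nonneg)

lemma fock_norm_power2: "(fock_norm \<phi>)\<^sup>2 = (\<Sum>\<^sub>\<infinity>m. (cmod (\<phi> m))\<^sup>2)"
  by (simp add: fock_norm_def infsum_nonneg)

text \<open>Membership and norm bound both follow from a uniform bound on finite sections, so
  finite-dimensional inequalities for \<open>L2_set\<close> lift to the Fock space.\<close>

lemma fock_space_leI:
  assumes "\<And>P. finite P \<Longrightarrow> L2_set (\<lambda>m. cmod (\<phi> m)) P \<le> B"
  shows "\<phi> \<in> fock_space" "fock_norm \<phi> \<le> B"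
proof -
  have B: "0 \<le> B"
    using assms[of "{}"] by simp
  have le: "(\<Sum>m\<in>P. (cmod (\<phi> m))\<^sup>2) \<le> B\<^sup>2" if "finite P" for P
    using assms[OF that] unfolding L2_set_def by (rule sqrt_le_D)
  show fs: "\<phi> \<in> fock_space"
    unfolding fock_space_def mem_Collect_eq
    by (rule nonneg_bdd_above_summable_on) (auto intro!: bdd_aboveI2[where M = "B\<^sup>2"] le)
  have "(\<Sum>\<^sub>\<infinity>m. (cmod (\<phi> m))\<^sup>2) \<le> B\<^sup>2"
    by (rule infsum_le_finite_sums) (use fs le in \<open>auto simp: fock_space_def\<close>)
  then show "fock_norm \<phi> \<le> B"
    using B by (simp add: fock_norm_def real_le_lsqrt)
qed

lemma cmod_le_fock_norm:
  assumes "\<phi> \<in> fock_space"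
  shows "cmod (\<phi> m) \<le> fock_norm \<phi>"
  using L2_set_le_fock_norm[OF assms, of "{m}"] by simp

lemma fock_add:
  assumes "\<phi> \<in> fock_space" "\<xi> \<in> fock_space"
  shows "(\<lambda>m. \<phi> m + \<xi> m) \<in> fock_space"
    and "fock_norm (\<lambda>m. \<phi> m + \<xi> m) \<le> fock_norm \<phi> + fock_norm \<xi>"
proof -
  have "L2_set (\<lambda>m. cmod (\<phi> m + \<xi> m)) P \<le> fock_norm \<phi> + fock_norm \<xi>" if "finite P" for P
  proof -
    have "L2_set (\<lambda>m. cmod (\<phi> m + \<xi> m)) P \<le> L2_set (\<lambda>m. cmod (\<phi> m) + cmod (\<xi> m)) P"
      by (intro L2_set_mono norm_triangle_ineq) auto
    also have "\<dots> \<le> L2_set (\<lambda>m. cmod (\<phi> m)) P + L2_set (\<lambda>m. cmod (\<xi> m)) P"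
      by (rule L2_set_triangle_ineq)
    also have "\<dots> \<le> fock_norm \<phi> + fock_norm \<xi>"
      by (intro add_mono L2_set_le_fock_norm assms that)
    finally show ?thesis .
  qed
  then show "(\<lambda>m. \<phi> m + \<xi> m) \<in> fock_space"
    "fock_norm (\<lambda>m. \<phi> m + \<xi> m) \<le> fock_norm \<phi> + fock_norm \<xi>"
    by (fact fock_space_leI)+
qed

lemma fock_scale:
  assumes "\<phi> \<in> fock_space"
  shows "(\<lambda>m. c * \<phi> m) \<in> fock_space"
  using assms by (simp add: fock_space_def norm_mult power_mult_distrib summable_on_cmult_right)

lemma fock_norm_scale: "fock_norm (\<lambda>m. c * \<phi> m) = cmod c * fock_norm \<phi>"
  by (simp add: fock_norm_def norm_mult power_mult_distrib infsum_cmult_right' real_sqrt_mult)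

lemma fock_lin:
  "\<phi> \<in> fock_space \<Longrightarrow> \<xi> \<in> fock_space \<Longrightarrow> (\<lambda>m. c * \<phi> m + \<xi> m) \<in> fock_space"
  by (intro fock_add fock_scale)

lemma fock_diff:
  assumes "\<phi> \<in> fock_space" "\<xi> \<in> fock_space"
  shows "(\<lambda>m. \<phi> m - \<xi> m) \<in> fock_space"
  using fock_lin[of \<xi> \<phi> "-1"] assms by simp

lemma fock_zero [simp]: "(\<lambda>m. 0) \<in> fock_space" "fock_norm (\<lambda>m. 0) = 0"
  by (simp_all add: fock_space_def fock_norm_def)

lemma fock_sum:
  assumes "\<And>q. q \<in> Q \<Longrightarrow> f q \<in> fock_space" 
  shows "(\<lambda>m. \<Sum>q\<in>Q. f q m) \<in> fock_space"
    and "fock_norm (\<lambda>m. \<Sum>q\<in>Q. f q m) \<le> (\<Sum>q\<in>Q. fock_norm (f q))"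
proof -
  have "(\<lambda>m. \<Sum>q\<in>Q. f q m) \<in> fock_space \<and>
    fock_norm (\<lambda>m. \<Sum>q\<in>Q. f q m) \<le> (\<Sum>q\<in>Q. fock_norm (f q))"
    using assms
  proof (induction Q rule: infinite_finite_induct)
    case (insert q Q)
    then show ?case
      using fock_add[of "f q" "\<lambda>m. \<Sum>q\<in>Q. f q m"] by simp
  qed simp_all
  then show "(\<lambda>m. \<Sum>q\<in>Q. f q m) \<in> fock_space"
    "fock_norm (\<lambda>m. \<Sum>q\<in>Q. f q m) \<le> (\<Sum>q\<in>Q. fock_norm (f q))" by auto
qed

lemma l1_imp_fock:
  assumes "(\<lambda>m. cmod (\<phi> m)) summable_on UNIV"
  shows "\<phi> \<in> fock_space" "fock_norm \<phi> \<le> (\<Sum>\<^sub>\<infinity>m. cmod (\<phi> m))"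
proof -
  have "L2_set (\<lambda>m. cmod (\<phi> m)) P \<le> (\<Sum>\<^sub>\<infinity>m. cmod (\<phi> m))" if "finite P" for P
  proof -
    have "L2_set (\<lambda>m. cmod (\<phi> m)) P \<le> (\<Sum>m\<in>P. cmod (\<phi> m))"
      using L2_set_le_sum[of P "\<lambda>m. cmod (\<phi> m)"] by simp
    also have "\<dots> \<le> (\<Sum>\<^sub>\<infinity>m. cmod (\<phi> m))"
      using assms that by (intro finite_sum_le_infsum) auto
    finally show ?thesis .
  qed
  then show "\<phi> \<in> fock_space" "fock_norm \<phi> \<le> (\<Sum>\<^sub>\<infinity>m. cmod (\<phi> m))"
    by (fact fock_space_leI)+
qed

lemma fock_Cauchy_Schwarz:
  assumes "\<phi> \<in> fock_space" "\<xi> \<in> fock_space"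
  shows "(\<lambda>m. norm (\<phi> m * \<xi> m)) summable_on UNIV"
    and "cmod (\<Sum>\<^sub>\<infinity>m. \<phi> m * \<xi> m) \<le> fock_norm \<phi> * fock_norm \<xi>"
proof -
  have le: "(\<Sum>m\<in>P. norm (\<phi> m * \<xi> m)) \<le> fock_norm \<phi> * fock_norm \<xi>" if "finite P" for P
  proof -
    have "(\<Sum>m\<in>P. norm (\<phi> m * \<xi> m)) = (\<Sum>m\<in>P. \<bar>cmod (\<phi> m)\<bar> * \<bar>cmod (\<xi> m)\<bar>)"
      by (simp add: norm_mult)
    also have "\<dots> \<le> L2_set (\<lambda>m. cmod (\<phi> m)) P * L2_set (\<lambda>m. cmod (\<xi> m)) P"
      by (rule L2_set_mult_ineq)
    also have "\<dots> \<le> fock_norm \<phi> * fock_norm \<xi>"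
      by (intro mult_mono L2_set_le_fock_norm assms that) auto
    finally show ?thesis .
  qed
  show sm: "(\<lambda>m. norm (\<phi> m * \<xi> m)) summable_on UNIV"
    by (rule nonneg_bdd_above_summable_on) (auto intro!: bdd_aboveI2 le)
  have "cmod (\<Sum>\<^sub>\<infinity>m. \<phi> m * \<xi> m) \<le> (\<Sum>\<^sub>\<infinity>m. norm (\<phi> m * \<xi> m))"
    by (rule norm_infsum_bound[OF sm])
  also have "\<dots> \<le> fock_norm \<phi> * fock_norm \<xi>"
    by (rule infsum_le_finite_sums[OF sm]) (rule le)
  finally show "cmod (\<Sum>\<^sub>\<infinity>m. \<phi> m * \<xi> m) \<le> fock_norm \<phi> * fock_norm \<xi>" .
qed

lemma fock_cnj:
  "(\<lambda>m. cnj (\<phi> m)) \<in> fock_space \<longleftrightarrow> \<phi> \<in> fock_space" "fock_norm (\<lambda>m. cnj (\<phi> m)) = fock_norm \<phi>"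
  by (simp_all add: fock_space_def fock_norm_def)

lemma fock_inner_summable:
  assumes "\<phi> \<in> fock_space" "\<xi> \<in> fock_space"
  shows "(\<lambda>m. cnj (\<phi> m) * \<xi> m) summable_on UNIV"
  by (rule Infinite_Sum.abs_summable_summable, rule fock_Cauchy_Schwarz) (simp_all add: fock_cnj assms)

lemma fock_inner_self: "\<phi> \<in> fock_space \<Longrightarrow> fock_inner \<phi> \<phi> = of_real ((fock_norm \<phi>)\<^sup>2)"
proof -
  assume "\<phi> \<in> fock_space"
  then have "((\<lambda>m. (cmod (\<phi> m))\<^sup>2) has_sum (fock_norm \<phi>)\<^sup>2) UNIV"
    unfolding fock_norm_power2 fock_space_def by simp
  then have "((\<lambda>m. complex_of_real ((cmod (\<phi> m))\<^sup>2)) has_sum of_real ((fock_norm \<phi>)\<^sup>2)) UNIV"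
    by (rule has_sum_of_real)
  then show ?thesis
    unfolding fock_inner_def
    by (intro infsumI) (simp add: complex_norm_square mult.commute[of "cnj z" for z] del: of_real_power)
qed

lemma fock_norm_lin_power2:
  assumes "\<phi> \<in> fock_space" "\<xi> \<in> fock_space"
  shows "(fock_norm (\<lambda>m. c * \<phi> m + \<xi> m))\<^sup>2 =
    (cmod c)\<^sup>2 * (fock_norm \<phi>)\<^sup>2 + (fock_norm \<xi>)\<^sup>2 + 2 * Re (cnj c * fock_inner \<phi> \<xi>)"
proof -
  have "((\<lambda>m. (cmod c)\<^sup>2 * (cmod (\<phi> m))\<^sup>2 + (cmod (\<xi> m))\<^sup>2 + 2 * Re (cnj c * (cnj (\<phi> m) * \<xi> m)))
     has_sum ((cmod c)\<^sup>2 * (fock_norm \<phi>)\<^sup>2 + (fock_norm \<xi>)\<^sup>2 + 2 * Re (cnj c * fock_inner \<phi> \<xi>))) UNIV"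
    using assms fock_inner_summable[OF assms]
    by (intro has_sum_add has_sum_cmult_right has_sum_Re)
       (auto simp: fock_norm_power2 fock_space_def fock_inner_def)
  moreover have "(cmod (c * \<phi> m + \<xi> m))\<^sup>2 =
      (cmod c)\<^sup>2 * (cmod (\<phi> m))\<^sup>2 + (cmod (\<xi> m))\<^sup>2 + 2 * Re (cnj c * (cnj (\<phi> m) * \<xi> m))" for m
    unfolding cmod_power2 by (simp add: power2_eq_square algebra_simps)
  ultimately show ?thesis
    by (simp add: fock_norm_power2 infsumI)
qed

text \<open>Polarisation: only the cross term in the norm of a linear combination remains to be
  compared; \<open>c = 1\<close> yields its real part and \<open>c = \<i>\<close> its imaginary
  part.\<close>

lemma isometry_imp_inner_preserving:
  assumes \<phi>: "\<phi> \<in> fock_space" and \<xi>: "\<xi> \<in> fock_space"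
    and lin: "\<And>c. U (\<lambda>m. c * \<phi> m + \<xi> m) = (\<lambda>m. c * U \<phi> m + U \<xi> m)"
    and iso: "\<And>\<psi>. \<psi> \<in> fock_space \<Longrightarrow> U \<psi> \<in> fock_space \<and> fock_norm (U \<psi>) = fock_norm \<psi>"
  shows "fock_inner (U \<phi>) (U \<xi>) = fock_inner \<phi> \<xi>"
proof -
  have "Re (cnj c * fock_inner (U \<phi>) (U \<xi>)) = Re (cnj c * fock_inner \<phi> \<xi>)" for c
  proof -
    have "(fock_norm (\<lambda>m. c * U \<phi> m + U \<xi> m))\<^sup>2 = (fock_norm (\<lambda>m. c * \<phi> m + \<xi> m))\<^sup>2"
      using iso[OF fock_lin[OF \<phi> \<xi>], of c] unfolding lin by simp
    then show ?thesis
      using fock_norm_lin_power2[OF \<phi> \<xi>, of c] fock_norm_lin_power2[of "U \<phi>" "U \<xi>" c]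
        iso[OF \<phi>] iso[OF \<xi>] by simp
  qed
  from this[of 1] this[of \<i>] show ?thesis
    by (simp add: complex_eq_iff)
qed

section \<open>Number states and density of finite-particle vectors\<close>

definition basis :: "('n \<Rightarrow> nat) \<Rightarrow> 'n fock" where
  "basis q = (\<lambda>m. if m = q then 1 else 0)"

definition truncate :: "('n \<Rightarrow> nat) set \<Rightarrow> 'n fock \<Rightarrow> 'n fock" where
  "truncate Q \<phi> = (\<lambda>m. if m \<in> Q then \<phi> m else 0)"

lemma finite_particle_imp_fock: "\<phi> \<in> finite_particle \<Longrightarrow> \<phi> \<in> fock_space"
  unfolding finite_particle_def fock_space_def mem_Collect_eq
  by (rule finite_nonzero_values_imp_summable_on) simp

lemma basis_finite_particle: "basis q \<in> finite_particle"
  by (simp add: basis_def finite_particle_def)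

lemma basis_fock [simp]: "basis q \<in> fock_space"
  by (intro finite_particle_imp_fock basis_finite_particle)

lemma truncate_finite_particle: "finite Q \<Longrightarrow> truncate Q \<phi> \<in> finite_particle"
  by (auto simp: truncate_def finite_particle_def elim: finite_subset[rotated])

lemma fock_norm_basis [simp]: "fock_norm (basis q) = 1"
proof -
  have "((\<lambda>m. (cmod (basis q m))\<^sup>2) has_sum 1) UNIV"
    by (rule has_sum_finite_neutralI[of "{q}"]) (auto simp: basis_def)
  then show ?thesis
    by (simp add: fock_norm_def infsumI)
qed

lemma fock_inner_basis_left [simp]: "fock_inner (basis q) \<phi> = \<phi> q"
  unfolding fock_inner_def
  by (rule infsumI, rule has_sum_finite_neutralI[of "{q}"]) (auto simp: basis_def)

lemma fock_inner_basis_right [simp]: "fock_inner \<phi> (basis q) = cnj (\<phi> q)"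
  unfolding fock_inner_def
  by (rule infsumI, rule has_sum_finite_neutralI[of "{q}"]) (auto simp: basis_def)

lemma truncate_approx:
  assumes "\<phi> \<in> fock_space" "0 < e"
  obtains Q where "finite Q" "fock_norm (\<lambda>m. \<phi> m - truncate Q \<phi> m) \<le> e"
proof -
  have sm: "(\<lambda>m. (cmod (\<phi> m))\<^sup>2) summable_on UNIV"
    using assms by (simp add: fock_space_def)
  obtain Q where Q: "finite Q" "dist (\<Sum>m\<in>Q. (cmod (\<phi> m))\<^sup>2) (\<Sum>\<^sub>\<infinity>m. (cmod (\<phi> m))\<^sup>2) \<le> e\<^sup>2"
    using infsum_finite_approximation[OF sm, of "e\<^sup>2"] assms(2) by (metis zero_less_power)
  have "L2_set (\<lambda>m. cmod (\<phi> m - truncate Q \<phi> m)) P \<le> e" if P: "finite P" for P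
  proof -
    have "(\<Sum>m\<in>P. (cmod (\<phi> m - truncate Q \<phi> m))\<^sup>2) = (\<Sum>m\<in>P - Q. (cmod (\<phi> m))\<^sup>2)"
      by (rule sum.mono_neutral_cong_right) (use P in \<open>auto simp: truncate_def\<close>)
    also have "\<dots> = (\<Sum>m\<in>P \<union> Q. (cmod (\<phi> m))\<^sup>2) - (\<Sum>m\<in>Q. (cmod (\<phi> m))\<^sup>2)"
      using P Q(1) sum_diff[of "P \<union> Q" Q "\<lambda>m. (cmod (\<phi> m))\<^sup>2"] by (simp add: Un_Diff)
    also have "\<dots> \<le> (\<Sum>\<^sub>\<infinity>m. (cmod (\<phi> m))\<^sup>2) - (\<Sum>m\<in>Q. (cmod (\<phi> m))\<^sup>2)"
      using P Q(1) sm by (intro diff_right_mono finite_sum_le_infsum) auto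
    also have "\<dots> \<le> e\<^sup>2"
      using Q(2) by (simp add: dist_real_def)
    finally show ?thesis
      unfolding L2_set_def using assms(2) by (intro real_le_lsqrt) auto
  qed
  then have "fock_norm (\<lambda>m. \<phi> m - truncate Q \<phi> m) \<le> e"
    by (rule fock_space_leI)
  then show ?thesis
    using that Q(1) by blast
qed

lemma linear_functional_zero:
  assumes lin: "\<And>c \<phi> \<xi>. \<phi> \<in> fock_space \<Longrightarrow> \<xi> \<in> fock_space \<Longrightarrow>
      f (\<lambda>m. c * \<phi> m + \<xi> m) = c * f \<phi> + (f \<xi> :: complex)"
    and bound: "\<And>\<phi>. \<phi> \<in> fock_space \<Longrightarrow> cmod (f \<phi>) \<le> C * fock_norm \<phi>"
    and zero: "\<And>q. f (basis q) = 0"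
    and \<phi>: "\<phi> \<in> fock_space"
  shows "f \<phi> = 0"
proof -
  have tr: "f (truncate Q \<phi>) = 0" if "finite Q" for Q
    using that
  proof (induction Q)
    case empty
    then show ?case
      using bound[of "\<lambda>_. 0"] by (simp add: truncate_def)
  next
    case (insert q Q)
    have "truncate (insert q Q) \<phi> = (\<lambda>m. \<phi> q * basis q m + truncate Q \<phi> m)"
      using insert.hyps by (auto simp: truncate_def basis_def)
    then show ?case
      using lin[of "basis q" "truncate Q \<phi>" "\<phi> q"] insert zero
      by (simp add: finite_particle_imp_fock truncate_finite_particle)
  qed
  have "cmod (f \<phi>) \<le> \<bar>C\<bar> * e" if e: "0 < e" for e
  proof -
    obtain Q where Q: "finite Q" "fock_norm (\<lambda>m. \<phi> m - truncate Q \<phi> m) \<le> e"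
      using truncate_approx[OF \<phi> e] by blast
    have fp: "truncate Q \<phi> \<in> fock_space"
      by (intro finite_particle_imp_fock truncate_finite_particle Q)
    have "f (\<lambda>m. \<phi> m - truncate Q \<phi> m) = f \<phi>"
      using lin[OF fp \<phi>, of "-1"] tr[OF Q(1)] by simp
    then have "cmod (f \<phi>) \<le> C * fock_norm (\<lambda>m. \<phi> m - truncate Q \<phi> m)"
      using bound[OF fock_diff[OF \<phi> fp]] by simp
    also have "\<dots> \<le> \<bar>C\<bar> * e"
      using Q(2) by (intro mult_mono) auto
    finally show ?thesis .
  qed
  from this[of "x / (\<bar>C\<bar> + 1)" for x] have le: "cmod (f \<phi>) \<le> \<bar>C\<bar> * (x / (\<bar>C\<bar> + 1))" if "0 < x" for x
    using that by simp
  have "cmod (f \<phi>) \<le> 0"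
  proof (rule field_le_epsilon)
    fix x :: real assume x: "0 < x"
    have "\<bar>C\<bar> * (x / (\<bar>C\<bar> + 1)) \<le> x"
      using x by (simp add: field_simps)
    then show "cmod (f \<phi>) \<le> 0 + x"
      using le[OF x] by simp
  qed
  then show ?thesis by simp
qed

section \<open>Exponentials of antisymmetric band matrices\<close>

text \<open>
  \<open>mpow b N k\<close> is the \<open>k\<close>-th power of the matrix \<open>b\<close>; all powers are finite sums because \<open>N p\<close> is
  a finite set containing the support of row \<open>p\<close>.
\<close>

primrec mpow :: "('i \<Rightarrow> 'i \<Rightarrow> real) \<Rightarrow> ('i \<Rightarrow> 'i set) \<Rightarrow> nat \<Rightarrow> 'i \<Rightarrow> 'i \<Rightarrow> real" where
  "mpow b N 0 p q = (if p = q then 1 else 0)"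
| "mpow b N (Suc k) p q = (\<Sum>l\<in>N p. b p l * mpow b N k l q)"

text \<open>Endpoints of walks of length \<open>k\<close>. Row \<open>p\<close> of the
  \<open>k\<close>-th power is supported there, so these finite sets replace sums over the infinite
  index type.\<close>

primrec reach :: "('i \<Rightarrow> 'i set) \<Rightarrow> nat \<Rightarrow> 'i \<Rightarrow> 'i set" where
  "reach N 0 p = {p}"
| "reach N (Suc k) p = (\<Union>l\<in>N p. reach N k l)"

lemma finite_reach: "(\<And>p. finite (N p)) \<Longrightarrow> finite (reach N k p)"
  by (induction k arbitrary: p) auto

lemma mpow_eq_0: "q \<notin> reach N k p \<Longrightarrow> mpow b N k p q = 0"
  by (induction k arbitrary: p) auto

lemma mpow_add:
  assumes fin: "\<And>p. finite (N p)"
  shows "mpow b N (j + k) p q = (\<Sum>l\<in>reach N j p. mpow b N j p l * mpow b N k l q)"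
proof (induction j arbitrary: p)
  case 0
  then show ?case by simp
next
  case (Suc j)
  have "mpow b N (Suc j + k) p q =
      (\<Sum>l\<in>N p. \<Sum>i\<in>reach N j l. b p l * mpow b N j l i * mpow b N k i q)"
    by (simp add: Suc.IH sum_distrib_left mult.assoc)
  also have "\<dots> = (\<Sum>l\<in>N p. \<Sum>i\<in>reach N (Suc j) p. b p l * mpow b N j l i * mpow b N k i q)"
  proof (rule sum.cong[OF refl], rule sum.mono_neutral_left)
    show "finite (reach N (Suc j) p)"
      by (rule finite_reach[OF fin])
  qed (auto simp: mpow_eq_0)
  also have "\<dots> = (\<Sum>i\<in>reach N (Suc j) p. mpow b N (Suc j) p i * mpow b N k i q)"
    by (subst sum.swap) (simp add: sum_distrib_right)
  finally show ?case .
qed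

lemma abs_mpow_le: "\<bar>mpow b N k p q\<bar> \<le> mpow (\<lambda>p q. \<bar>b p q\<bar>) N k p q"
proof (induction k arbitrary: p)
  case (Suc k)
  have "\<bar>mpow b N (Suc k) p q\<bar> \<le> (\<Sum>l\<in>N p. \<bar>b p l\<bar> * \<bar>mpow b N k l q\<bar>)"
    using sum_abs[of "\<lambda>l. b p l * mpow b N k l q" "N p"] by (simp add: abs_mult)
  also have "\<dots> \<le> mpow (\<lambda>p q. \<bar>b p q\<bar>) N (Suc k) p q"
    by (auto intro!: sum_mono mult_left_mono Suc)
  finally show ?case .
qed simp

text \<open>The recursion splits off a left factor, transposition produces a right one.
  \<open>mpow_add\<close> with last exponent one converts between them, and the range of summation
  passes from \<open>N q\<close> to \<open>reach N k p\<close> through their union because the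
  summand vanishes outside either set. The values \<open>c = -1\<close> and \<open>c = 1\<close>
  serve for the matrix and for its absolute values.\<close>

lemma mpow_transpose:
  assumes fin: "\<And>p. finite (N p)" and supp: "\<And>p q. q \<notin> N p \<Longrightarrow> b p q = 0"
    and sym: "\<And>p q. b q p = c * b p q"
  shows "mpow b N k q p = c ^ k * mpow b N k p q"
proof (induction k arbitrary: q p)
  case (Suc k)
  have 1: "mpow b N 1 l q = b l q" for l
    using supp[of q l] fin[of l] by (simp add: if_distrib sum.delta cong: if_cong)
  have "mpow b N (Suc k) q p = (\<Sum>l\<in>N q. c ^ Suc k * (mpow b N k p l * b l q))"
    unfolding mpow.simps
  proof (intro sum.cong refl)
    fix l
    show "b q l * mpow b N k l p = c ^ Suc k * (mpow b N k p l * b l q)"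
      using Suc.IH[of l p] sym[of q l] by simp
  qed
  also have "\<dots> = (\<Sum>l\<in>N q \<union> reach N k p. c ^ Suc k * (mpow b N k p l * b l q))"
  proof (intro sum.mono_neutral_left ballI)
    fix l assume "l \<in> N q \<union> reach N k p - N q"
    then have "b l q = 0"
      using supp[of l q] sym[of l q] by simp
    then show "c ^ Suc k * (mpow b N k p l * b l q) = 0"
      by simp
  qed (auto simp: fin finite_reach)
  also have "\<dots> = (\<Sum>l\<in>reach N k p. c ^ Suc k * (mpow b N k p l * b l q))"
    by (intro sum.mono_neutral_right) (auto simp: fin finite_reach mpow_eq_0)
  also have "\<dots> = c ^ Suc k * mpow b N (k + 1) p q"
    unfolding mpow_add[where N = N, OF fin] 1 by (simp add: sum_distrib_left)
  finally show ?case by simp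
qed simp

lemma abs_summable_on_real_imp:
  fixes f :: "'i \<Rightarrow> real"
  shows "(\<lambda>x. \<bar>f x\<bar>) summable_on A \<Longrightarrow> f summable_on A"
  by (rule Infinite_Sum.abs_summable_summable) simp

text \<open>The Taylor expansion of \<open>\<Sum>n. x\<^sup>n / n! c\<^sub>n\<close> at \<open>t\<close>, evaluated at \<open>s + t\<close>.\<close>

lemma exp_double_series:
  fixes c :: "nat \<Rightarrow> real"
  assumes c: "\<And>n. \<bar>c n\<bar> \<le> K * rho ^ n * fact n" and rho: "0 \<le> rho"
    and small: "(\<bar>s\<bar> + \<bar>t\<bar>) * rho < 1"
  shows "((\<lambda>(j, k). s ^ j / fact j * (t ^ k / fact k) * c (j + k)) has_sum
           (\<Sum>n. (s + t) ^ n / fact n * c n)) UNIV"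
proof -
  define g where "g = (\<lambda>(n, j). s ^ j / fact j * (t ^ (n - j) / fact (n - j)) * c n)"
  have binom: "(\<Sum>j\<le>n. x ^ j / fact j * (y ^ (n - j) / fact (n - j))) = (x + y) ^ n / fact n"
    for x y :: real and n
    using exp_series_add_commuting[of x y n] by (simp add: scaleR_conv_of_real field_simps)
  have outer: "(\<lambda>n. (\<bar>s\<bar> + \<bar>t\<bar>) ^ n / fact n * \<bar>c n\<bar>) summable_on UNIV"
  proof (rule summable_on_comparison_test)
    show "(\<lambda>n. K * ((\<bar>s\<bar> + \<bar>t\<bar>) * rho) ^ n) summable_on UNIV"
      using rho small
      by (intro summable_on_cmult_right norm_summable_imp_summable_on)
         (auto simp: norm_power abs_mult intro!: summable_geometric)
    show "(\<bar>s\<bar> + \<bar>t\<bar>) ^ n / fact n * \<bar>c n\<bar> \<le> K * ((\<bar>s\<bar> + \<bar>t\<bar>) * rho) ^ n" for n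
      using mult_left_mono[OF c[of n], of "(\<bar>s\<bar> + \<bar>t\<bar>) ^ n / fact n"]
      by (simp add: power_mult_distrib mult_ac)
  qed auto
  have inner_abs: "((\<lambda>j. \<bar>g (n, j)\<bar>) has_sum (\<bar>s\<bar> + \<bar>t\<bar>) ^ n / fact n * \<bar>c n\<bar>) {..n}" for n
    unfolding binom[symmetric] sum_distrib_right
    by (rule has_sum_finiteI) (simp_all add: g_def abs_mult power_abs)
  have "(\<lambda>x. \<bar>g x\<bar>) summable_on Sigma UNIV (\<lambda>n. {..n})"
    by (rule summable_on_SigmaI[OF inner_abs outer]) auto
  then have "g summable_on Sigma UNIV (\<lambda>n. {..n})"
    by (rule abs_summable_on_real_imp)
  then obtain S where S: "(g has_sum S) (Sigma UNIV (\<lambda>n. {..n}))"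
    by (auto simp: summable_on_def)
  have "((\<lambda>j. g (n, j)) has_sum (s + t) ^ n / fact n * c n) {..n}" for n
    unfolding binom[symmetric] sum_distrib_right
    by (rule has_sum_finiteI) (simp_all add: g_def)
  then have "((\<lambda>n. (s + t) ^ n / fact n * c n) has_sum S) UNIV"
    by (intro has_sum_SigmaD[OF S]) auto
  then have "S = (\<Sum>n. (s + t) ^ n / fact n * c n)"
    by (simp add: has_sum_imp_sums sums_unique)
  moreover have "((\<lambda>(j, k). s ^ j / fact j * (t ^ k / fact k) * c (j + k)) has_sum S) UNIV"
  proof -
    have "bij_betw (\<lambda>(n, j). (j, n - j)) (Sigma UNIV (\<lambda>n. {..n})) (UNIV :: (nat \<times> nat) set)"
      by (rule bij_betw_byWitness[where f' = "\<lambda>(j, k). (j + k, j)"]) auto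
    from has_sum_reindex_bij_betw[OF this, symmetric, of "\<lambda>(j, k). s ^ j / fact j * (t ^ k / fact k) * c (j + k)" S]
    show ?thesis
      by (rule iffD2) (rule has_sum_cong[THEN iffD1, OF _ S], auto simp: g_def)
  qed
  ultimately show ?thesis by simp
qed

text \<open>
  Since \<open>rho\<close> does not depend on the row, the exponential series converges for
  \<open>\<bar>t\<bar> * rho < 1\<close> on all basis vectors at once.
\<close>

locale skew_matrix =
  fixes a :: "'i \<Rightarrow> 'i \<Rightarrow> real" and N :: "'i \<Rightarrow> 'i set" and K :: "'i \<Rightarrow> real" and rho :: real
  assumes finite_N: "finite (N p)"
    and supp: "q \<notin> N p \<Longrightarrow> a p q = 0"
    and skew: "a q p = - a p q"
    and rho_pos: "0 < rho"
    and growth: "finite Q \<Longrightarrow> (\<Sum>q\<in>Q. mpow (\<lambda>p q. \<bar>a p q\<bar>) N k p q) \<le> K p * rho ^ k * fact k"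
begin

abbreviation apow :: "nat \<Rightarrow> 'i \<Rightarrow> 'i \<Rightarrow> real" where "apow \<equiv> mpow a N"
abbreviation abspow :: "nat \<Rightarrow> 'i \<Rightarrow> 'i \<Rightarrow> real" where "abspow \<equiv> mpow (\<lambda>p q. \<bar>a p q\<bar>) N"

text \<open>Meaningful for \<open>\<bar>t\<bar> * rho < 1\<close>; for larger \<open>t\<close> the
  series need not converge and \<open>suminf\<close> may be a default value.\<close>

definition expm :: "real \<Rightarrow> 'i \<Rightarrow> 'i \<Rightarrow> real" where
  "expm t p q = (\<Sum>k. t ^ k / fact k * apow k p q)"

lemma abspow_nonneg [simp]: "0 \<le> abspow k p q"
  using abs_mpow_le[of a N k p q] by linarith

lemma abspow_le: "abspow k p q \<le> K p * rho ^ k * fact k"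
  using growth[of "{q}"] by simp

lemma apow_le: "\<bar>apow k p q\<bar> \<le> K p * rho ^ k * fact k"
  using abs_mpow_le abspow_le by (rule order_trans)

lemma apow_transpose: "apow k q p = (-1) ^ k * apow k p q"
proof (rule mpow_transpose[OF finite_N])
  show "a q p = - 1 * a p q" for p q
    using skew[of q p] by simp
qed (simp add: supp)

lemma abspow_transpose: "abspow k q p = abspow k p q"
proof -
  have "mpow (\<lambda>p q. \<bar>a p q\<bar>) N k q p = 1 ^ k * abspow k p q"
  proof (rule mpow_transpose[OF finite_N])
    show "\<bar>a q p\<bar> = 1 * \<bar>a p q\<bar>" for p q
      using skew[of q p] by simp
  qed (simp add: supp)
  then show ?thesis by simp
qed

lemma exp_term_le:
  assumes "\<bar>x\<bar> \<le> abspow k p q"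
  shows "\<bar>t ^ k / fact k * x\<bar> \<le> K p * (\<bar>t\<bar> * rho) ^ k"
proof -
  have "\<bar>t ^ k / fact k * x\<bar> \<le> \<bar>t\<bar> ^ k / fact k * (K p * rho ^ k * fact k)"
    unfolding abs_mult abs_divide power_abs abs_of_nonneg[OF fact_ge_zero]
    by (intro mult_left_mono order_trans[OF assms abspow_le]) auto
  then show ?thesis
    by (simp add: power_mult_distrib mult_ac)
qed

lemma geometric_summable: "\<bar>t\<bar> * rho < 1 \<Longrightarrow> summable (\<lambda>k. K p * (\<bar>t\<bar> * rho) ^ k)"
  using rho_pos by (intro summable_mult summable_geometric) (simp add: abs_mult)

lemma exp_series_summable:
  assumes "\<bar>t\<bar> * rho < 1"
  shows "summable (\<lambda>k. \<bar>t ^ k / fact k * apow k p q\<bar>)" "summable (\<lambda>k. \<bar>t\<bar> ^ k / fact k * abspow k p q)"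
    "summable (\<lambda>k. t ^ k / fact k * apow k p q)"
proof -
  show 1: "summable (\<lambda>k. \<bar>t ^ k / fact k * apow k p q\<bar>)"
    by (rule summable_comparison_test'[OF geometric_summable[OF assms, of p]])
       (simp only: real_norm_def abs_idempotent exp_term_le[OF abs_mpow_le])
  show "summable (\<lambda>k. \<bar>t\<bar> ^ k / fact k * abspow k p q)"
  proof (rule summable_comparison_test'[OF geometric_summable[OF assms, of p]])
    show "norm (\<bar>t\<bar> ^ k / fact k * abspow k p q) \<le> K p * (\<bar>t\<bar> * rho) ^ k" for k
      using exp_term_le[of "abspow k p q" k p q "\<bar>t\<bar>"] by simp
  qed
  show "summable (\<lambda>k. t ^ k / fact k * apow k p q)"
    using 1 by (rule summable_rabs_cancel)
qed

lemma expm_has_sum: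
  assumes "\<bar>t\<bar> * rho < 1"
  shows "((\<lambda>k. t ^ k / fact k * apow k p q) has_sum expm t p q) UNIV"
  unfolding expm_def
  by (rule norm_summable_imp_has_sum) (use exp_series_summable[OF assms] in \<open>auto simp: summable_sums\<close>)

lemma expm_transpose: "expm t q p = expm (- t) p q"
  unfolding expm_def apow_transpose[of _ q p] by (rule suminf_cong) (simp add: power_minus[of t])

lemma expm_0: "expm 0 p q = (if p = q then 1 else 0)"
  unfolding expm_def by (subst suminf_finite[of "{0}"]) auto

text \<open>Fubini for the family indexed by two exponents and the intermediate index
  \<open>l\<close>. Summing over \<open>l\<close> first gives powers \<open>j + k\<close> and the
  binomial series; summing over \<open>l\<close> last gives the matrix product. Absolute convergence
  comes from the same computation with absolute values throughout, which is where
  \<open>\<bar>s\<bar> + \<bar>t\<bar>\<close> enters.\<close>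

lemma expm_group:
  assumes small: "(\<bar>s\<bar> + \<bar>t\<bar>) * rho < 1"
  shows "((\<lambda>l. expm s p l * expm t l q) has_sum expm (s + t) p q) UNIV"
proof -
  have st: "\<bar>s\<bar> * rho < 1" "\<bar>t\<bar> * rho < 1"
    using small rho_pos mult_right_mono[of "\<bar>s\<bar>" "\<bar>s\<bar> + \<bar>t\<bar>" rho]
      mult_right_mono[of "\<bar>t\<bar>" "\<bar>s\<bar> + \<bar>t\<bar>" rho] by linarith+
  define f where "f = (\<lambda>((j, k), l). s ^ j / fact j * apow j p l * (t ^ k / fact k * apow k l q))"
  define G where "G = (\<lambda>(j, k). \<Sum>l\<in>reach N j p. \<bar>f ((j, k), l)\<bar>)"
  have sG: "(\<lambda>(j, k). \<bar>s\<bar> ^ j / fact j * (\<bar>t\<bar> ^ k / fact k) * abspow (j + k) p q) summable_on UNIV"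
    using exp_double_series[of "\<lambda>n. abspow n p q" "K p" rho "\<bar>s\<bar>" "\<bar>t\<bar>"] small rho_pos abspow_le
    by (auto simp: summable_on_def)
  have G_le: "G jk \<le> (\<lambda>(j, k). \<bar>s\<bar> ^ j / fact j * (\<bar>t\<bar> ^ k / fact k) * abspow (j + k) p q) jk" for jk
  proof (cases jk)
    case (Pair j k)
    have "G jk \<le> (\<Sum>l\<in>reach N j p. (\<bar>s\<bar> ^ j / fact j * (\<bar>t\<bar> ^ k / fact k)) * (abspow j p l * abspow k l q))"
      unfolding G_def Pair prod.case
    proof (intro sum_mono)
      fix l
      have "\<bar>f ((j, k), l)\<bar> = (\<bar>s\<bar> ^ j / fact j * (\<bar>t\<bar> ^ k / fact k)) * (\<bar>apow j p l\<bar> * \<bar>apow k l q\<bar>)"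
        by (simp add: f_def abs_mult power_abs)
      also have "\<dots> \<le> (\<bar>s\<bar> ^ j / fact j * (\<bar>t\<bar> ^ k / fact k)) * (abspow j p l * abspow k l q)"
        by (intro mult_left_mono mult_mono abs_mpow_le) auto
      finally show "\<bar>f ((j, k), l)\<bar> \<le> \<dots>" .
    qed
    then show ?thesis
      unfolding sum_distrib_left[symmetric] by (simp add: Pair mpow_add[where N = N, OF finite_N])
  qed
  have Gsm: "G summable_on UNIV"
    by (rule summable_on_comparison_test[OF sG G_le]) (auto simp: G_def intro: sum_nonneg)
  have "(\<lambda>x. \<bar>f x\<bar>) summable_on Sigma UNIV (\<lambda>_. UNIV)"
  proof (rule summable_on_SigmaI[OF _ Gsm])
    fix jk
    show "((\<lambda>l. \<bar>f (jk, l)\<bar>) has_sum G jk) UNIV"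
      by (cases jk, rule has_sum_finite_neutralI[of "reach N (fst jk) p"])
         (use finite_N mpow_eq_0[of _ N "fst jk" p a] in \<open>auto simp: G_def f_def finite_reach\<close>)
  qed auto
  then have "f summable_on Sigma UNIV (\<lambda>_. UNIV)"
    by (rule abs_summable_on_real_imp)
  then obtain S where S: "(f has_sum S) (Sigma UNIV (\<lambda>_. UNIV))"
    by (auto simp: summable_on_def)
  have "((\<lambda>(j, k). s ^ j / fact j * (t ^ k / fact k) * apow (j + k) p q) has_sum S) UNIV"
  proof (rule has_sum_SigmaD[OF S])
    fix jk :: "nat \<times> nat"
    obtain j k where jk: "jk = (j, k)" by fastforce
    have "((\<lambda>l. f (jk, l)) has_sum (\<Sum>l\<in>reach N j p. f (jk, l))) UNIV"
      by (rule has_sum_finite_neutralI[of "reach N j p"])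
         (use finite_N mpow_eq_0[of _ N j p a] in \<open>auto simp: jk f_def finite_reach\<close>)
    moreover have "(\<Sum>l\<in>reach N j p. f (jk, l)) = s ^ j / fact j * (t ^ k / fact k) * apow (j + k) p q"
      using finite_N by (simp add: jk f_def mpow_add sum_distrib_left mult_ac)
    ultimately show "((\<lambda>l. f (jk, l)) has_sum
        (case jk of (j, k) \<Rightarrow> s ^ j / fact j * (t ^ k / fact k) * apow (j + k) p q)) UNIV"
      by (simp add: jk)
  qed
  moreover have "((\<lambda>(j, k). s ^ j / fact j * (t ^ k / fact k) * apow (j + k) p q) has_sum expm (s + t) p q) UNIV"
    unfolding expm_def using small rho_pos by (intro exp_double_series[of _ "K p" rho] apow_le) auto
  ultimately have "S = expm (s + t) p q"
    by (rule has_sum_unique)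
  then have S': "((\<lambda>(l, jk). f (jk, l)) has_sum expm (s + t) p q) (UNIV \<times> UNIV)"
    using S has_sum_swap[where f = f and S = S and A = UNIV and B = UNIV] by (simp only:)
  show ?thesis
  proof (rule has_sum_SigmaD[OF S'])
    fix l
    have "(\<lambda>jk. f (jk, l)) summable_on UNIV"
      using summable_on_SigmaD1[of "\<lambda>l jk. f (jk, l)" UNIV "\<lambda>_. UNIV" l] S'
      by (auto simp: summable_on_def)
    then obtain T where T: "((\<lambda>jk. f (jk, l)) has_sum T) (UNIV \<times> UNIV)"
      by (auto simp: summable_on_def)
    have "((\<lambda>j. s ^ j / fact j * apow j p l * expm t l q) has_sum T) UNIV"
    proof (rule has_sum_SigmaD[OF T])
      show "((\<lambda>k. f ((j, k), l)) has_sum s ^ j / fact j * apow j p l * expm t l q) UNIV" for j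
        unfolding f_def prod.case by (intro has_sum_cmult_right expm_has_sum st)
    qed
    moreover have "((\<lambda>j. s ^ j / fact j * apow j p l * expm t l q) has_sum (expm s p l * expm t l q)) UNIV"
      by (intro has_sum_cmult_left expm_has_sum st)
    ultimately have "T = expm s p l * expm t l q"
      by (rule has_sum_unique)
    then show "((\<lambda>jk. case (l, jk) of (l, jk) \<Rightarrow> f (jk, l)) has_sum expm s p l * expm t l q) UNIV"
      using T by simp
  qed
qed

text \<open>Termwise use of \<open>growth\<close> under a weighted power series. The shift
  \<open>d\<close> is 0 for the full exponential and 2 for its second-order remainder.\<close>

lemma abs_suminf_sum_le:
  assumes "\<And>k q. q \<in> Q \<Longrightarrow> \<bar>x k q\<bar> \<le> w k * abspow (k + d) p q" "\<And>k. 0 \<le> w k" "finite Q"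
    and sm: "summable (\<lambda>k. w k * (K p * rho ^ (k + d) * fact (k + d)))"
  shows "(\<Sum>q\<in>Q. \<bar>\<Sum>k. x k q\<bar>) \<le> (\<Sum>k. w k * (K p * rho ^ (k + d) * fact (k + d)))"
proof -
  have 1: "summable (\<lambda>k. w k * abspow (k + d) p q)" for q
    by (rule summable_comparison_test'[OF sm]) (auto simp: assms intro!: mult_left_mono abspow_le)
  have 2: "summable (\<lambda>k. \<bar>x k q\<bar>)" if "q \<in> Q" for q
    by (rule summable_comparison_test'[OF 1]) (use assms that in auto)
  have "(\<Sum>q\<in>Q. \<bar>\<Sum>k. x k q\<bar>) \<le> (\<Sum>q\<in>Q. \<Sum>k. w k * abspow (k + d) p q)"
    by (intro sum_mono order_trans[OF summable_rabs] suminf_le 1 2 assms) auto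
  also have "\<dots> = (\<Sum>k. \<Sum>q\<in>Q. w k * abspow (k + d) p q)"
    by (rule suminf_sum[symmetric]) (rule 1)
  also have "\<dots> \<le> (\<Sum>k. w k * (K p * rho ^ (k + d) * fact (k + d)))"
    by (intro suminf_le summable_sum 1 sm)
       (auto simp flip: sum_distrib_left intro!: mult_left_mono growth assms)
  finally show ?thesis .
qed

lemma expm_row_summable:
  assumes "\<bar>t\<bar> * rho < 1"
  shows "(\<lambda>q. \<bar>expm t p q\<bar>) summable_on UNIV"
proof (rule nonneg_bdd_above_summable_on)
  have sm: "summable (\<lambda>k. \<bar>t\<bar> ^ k / fact k * (K p * rho ^ (k + 0) * fact (k + 0)))"
    using geometric_summable[OF assms, of p] by (simp add: power_mult_distrib mult_ac)
  show "bdd_above (sum (\<lambda>q. \<bar>expm t p q\<bar>) ` {F. F \<subseteq> UNIV \<and> finite F})"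
    unfolding expm_def
    by (rule bdd_aboveI2, rule abs_suminf_sum_le[OF _ _ _ sm])
       (auto simp: abs_mult power_abs intro!: mult_left_mono divide_right_mono abs_mpow_le)
qed auto

text \<open>The transpose of \<open>expm t\<close> is \<open>expm (- t)\<close>, so this is the
  group law for \<open>t\<close> and \<open>- t\<close>; the two times together cause the factor
  2.\<close>

lemma expm_rows_orthonormal:
  assumes "2 * \<bar>t\<bar> * rho < 1"
  shows "((\<lambda>l. expm t p l * expm t q l) has_sum (if p = q then 1 else 0)) UNIV"
  using expm_group[of t "-t" p q] assms by (simp add: expm_0 expm_transpose[of t q])

text \<open>Taylor remainder of one column, that is, of the image of one number state. The majorant
  \<open>B\<close> is independent of \<open>t\<close> and absolutely summable, so the entrywise
  estimate becomes one in norm.\<close>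

lemma expm_first_order:
  fixes q :: 'i
  obtains t0 B where "0 < t0" "t0 * rho < 1" "(\<lambda>p. \<bar>B p\<bar>) summable_on UNIV"
    "\<And>t p. \<bar>t\<bar> \<le> t0 \<Longrightarrow> \<bar>expm t p q - (if p = q then 1 else 0) - t * a p q\<bar> \<le> t\<^sup>2 * B p"
proof
  define t0 where "t0 = 1 / (2 * rho)"
  show t0: "0 < t0" "t0 * rho < 1"
    using rho_pos by (auto simp: t0_def)
  \<comment> \<open>The weight of exponent \<open>k + 2\<close> after \<open>t\<^sup>2\<close> has
    been split off, taken at the largest admissible \<open>t\<close>.\<close>
  define w where "w = (\<lambda>k. t0 ^ k / fact (k + 2))"
  have w: "0 \<le> w k" for k
    using t0 by (simp add: w_def)
  have sm: "summable (\<lambda>k. w k * (K p * rho ^ (k + 2) * fact (k + 2)))" for p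
  proof -
    have "w k * (K p * rho ^ (k + 2) * fact (k + 2)) = rho\<^sup>2 * (K p * (\<bar>t0\<bar> * rho) ^ k)" for k
      using t0 by (simp add: w_def power_mult_distrib power2_eq_square mult_ac del: fact_Suc)
    then show ?thesis
      using summable_mult[OF geometric_summable[of t0 p], of "rho\<^sup>2"] t0 by (simp only:)
  qed
  define B where "B = (\<lambda>p. \<Sum>k. w k * abspow (k + 2) p q)"
  have wsm: "summable (\<lambda>k. w k * abspow (k + 2) p q)" for p
  proof (rule summable_comparison_test'[OF sm[of p]])
    show "norm (w k * abspow (k + 2) p q) \<le> w k * (K p * rho ^ (k + 2) * fact (k + 2))" for k
      using mult_left_mono[OF abspow_le[of "k + 2" p q] w[of k]] w[of k]
      by (simp add: abs_mult del: fact_Suc mpow.simps)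
  qed
  \<comment> \<open>Summation over \<open>p\<close> runs down a column; transposition turns it into
    row \<open>q\<close>, to which the growth bound applies.\<close>
  have bdd: "(\<Sum>p\<in>Q. \<bar>B p\<bar>) \<le> (\<Sum>k. w k * (K q * rho ^ (k + 2) * fact (k + 2)))" if "finite Q" for Q
    unfolding B_def
    by (rule abs_suminf_sum_le[OF _ _ _ sm]) (auto simp: w that abs_mult abspow_transpose[of _ q] simp del: mpow.simps)
  then show "(\<lambda>p. \<bar>B p\<bar>) summable_on UNIV"
    by (intro nonneg_bdd_above_summable_on bdd_aboveI2) auto
  fix t p assume t: "\<bar>t\<bar> \<le> t0"
  have t': "\<bar>t\<bar> * rho < 1"
    using t t0 rho_pos mult_right_mono[of "\<bar>t\<bar>" t0 rho] by linarith
  note sm_expm = exp_series_summable(3)[OF t', of p q]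
  have a1: "(\<Sum>l\<in>N p. a p l * (if l = q then 1 else 0)) = a p q"
    using supp[of q p] finite_N[of p] by (simp add: if_distrib sum.delta cong: if_cong)
  have "expm t p q = (\<Sum>k. t ^ (k + 2) / fact (k + 2) * apow (k + 2) p q) + 
      (\<Sum>k<2. t ^ k / fact k * apow k p q)"
    unfolding expm_def by (rule suminf_split_initial_segment[OF sm_expm])
  then have "expm t p q - (if p = q then 1 else 0) - t * a p q = (\<Sum>k. t ^ (k + 2) / fact (k + 2) * apow (k + 2) p q)"
    by (simp add: lessThan_Suc numeral_2_eq_2 a1 del: fact_Suc)
  also have "\<bar>\<dots>\<bar> \<le> (\<Sum>k. t\<^sup>2 * (w k * abspow (k + 2) p q))"
  proof -
    have le: "\<bar>t ^ (k + 2) / fact (k + 2) * apow (k + 2) p q\<bar> \<le> t\<^sup>2 * (w k * abspow (k + 2) p q)" for k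
    proof -
      have "\<bar>t ^ (k + 2) / fact (k + 2) * apow (k + 2) p q\<bar> =
          t\<^sup>2 * (\<bar>t\<bar> ^ k / fact (k + 2) * \<bar>apow (k + 2) p q\<bar>)"
        by (simp add: abs_mult power_abs power_add power2_eq_square mult_ac del: fact_Suc mpow.simps)
      also have "\<dots> \<le> t\<^sup>2 * (w k * abspow (k + 2) p q)"
        unfolding w_def using t
        by (intro mult_left_mono mult_mono divide_right_mono power_mono abs_mpow_le) auto
      finally show ?thesis .
    qed
    have "summable (\<lambda>k. \<bar>t ^ (k + 2) / fact (k + 2) * apow (k + 2) p q\<bar>)"
      by (rule summable_comparison_test'[OF summable_mult[OF wsm, of "t\<^sup>2" p]]) (use le in auto)
    then show ?thesis
      by (intro order_trans[OF summable_rabs] suminf_le le summable_mult wsm)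
  qed
  also have "\<dots> = t\<^sup>2 * B p"
    unfolding B_def by (rule suminf_mult[OF wsm])
  finally show "\<bar>expm t p q - (if p = q then 1 else 0) - t * a p q\<bar> \<le> t\<^sup>2 * B p" .
qed

end

section \<open>The unitary group of an antisymmetric band matrix\<close>

lemma has_sum_finite_sum:
  fixes f :: "'k \<Rightarrow> 'i \<Rightarrow> 'a::{topological_comm_monoid_add, t2_space}"
  assumes "\<And>k. k \<in> I \<Longrightarrow> (f k has_sum s k) A"
  shows "((\<lambda>x. \<Sum>k\<in>I. f k x) has_sum (\<Sum>k\<in>I. s k)) A"
  using assms by (induction I rule: infinite_finite_induct) (auto intro: has_sum_add)

lemma unitary_op_id: "unitary_op id"
  by (simp add: unitary_op_def)

lemma unitary_op_fock: "unitary_op U \<Longrightarrow> \<phi> \<in> fock_space \<Longrightarrow> U \<phi> \<in> fock_space"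
  by (auto simp: unitary_op_def bij_betw_def)

lemma unitary_op_lin:
  "unitary_op U \<Longrightarrow> \<phi> \<in> fock_space \<Longrightarrow> \<xi> \<in> fock_space \<Longrightarrow>
    U (\<lambda>m. c * \<phi> m + \<xi> m) = (\<lambda>m. c * U \<phi> m + U \<xi> m)"
  by (simp add: unitary_op_def)

lemma unitary_op_inner:
  "unitary_op U \<Longrightarrow> \<phi> \<in> fock_space \<Longrightarrow> \<xi> \<in> fock_space \<Longrightarrow> fock_inner (U \<phi>) (U \<xi>) = fock_inner \<phi> \<xi>"
  by (simp add: unitary_op_def)

lemma unitary_op_norm:
  assumes "unitary_op U" "\<phi> \<in> fock_space"
  shows "fock_norm (U \<phi>) = fock_norm \<phi>"
proof -
  have "complex_of_real ((fock_norm (U \<phi>))\<^sup>2) = of_real ((fock_norm \<phi>)\<^sup>2)"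
    using unitary_op_inner[OF assms assms(2)] fock_inner_self unitary_op_fock[OF assms] assms(2) by metis
  then show ?thesis
    unfolding of_real_eq_iff by (simp add: power2_eq_iff_nonneg)
qed

lemma unitary_op_comp:
  assumes "unitary_op U" "unitary_op V"
  shows "unitary_op (U \<circ> V)"
proof -
  have "bij_betw (U \<circ> V) fock_space fock_space"
    using assms by (auto simp: unitary_op_def intro: bij_betw_trans)
  then show ?thesis
    using assms unitary_op_fock[OF assms(2)]
    unfolding unitary_op_def[of "U \<circ> V"] o_apply
    by (auto simp: unitary_op_lin unitary_op_inner)
qed

lemma unitary_op_funpow: "unitary_op U \<Longrightarrow> unitary_op (U ^^ n)"
  by (induction n) (auto intro: unitary_op_comp unitary_op_id simp del: id_apply simp flip: id_def)

lemma funpow_comp_commute: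
  assumes "f \<circ> g = g \<circ> f"
  shows "(f \<circ> g) ^^ n = f ^^ n \<circ> g ^^ n"
proof (induction n)
  case (Suc n)
  have fg: "g (f x) = f (g x)" for x
    using assms by (simp add: fun_eq_iff)
  have c: "g ((f ^^ n) x) = (f ^^ n) (g x)" for x
    by (induction n) (simp_all add: fg)
  have "((f \<circ> g) ^^ Suc n) x = (f ^^ Suc n \<circ> g ^^ Suc n) x" for x
  proof -
    have "((f \<circ> g) ^^ Suc n) x = f (g (((f \<circ> g) ^^ n) x))"
      by simp
    also have "\<dots> = (f ^^ Suc n \<circ> g ^^ Suc n) x"
      unfolding Suc.IH by (simp add: c)
    finally show ?thesis .
  qed
  then show ?case by blast
qed simp

locale fock_skew = skew_matrix a N K rho
  for a :: "('n \<Rightarrow> nat) \<Rightarrow> ('n \<Rightarrow> nat) \<Rightarrow> real" and N K rho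
begin

lemma small_mono: "y * rho < 1 \<Longrightarrow> x \<le> y \<Longrightarrow> x * rho < 1"
  using mult_right_mono[of x y rho] rho_pos by linarith

definition gen_op :: "'n fock \<Rightarrow> 'n fock" where
  "gen_op \<phi> = (\<lambda>p. \<Sum>q\<in>N p. of_real (a p q) * \<phi> q)"

definition exp_op :: "real \<Rightarrow> 'n fock \<Rightarrow> 'n fock" where
  "exp_op t \<phi> = (\<lambda>p. \<Sum>\<^sub>\<infinity>q. of_real (expm t p q) * \<phi> q)"

lemma row_fock: "\<bar>t\<bar> * rho < 1 \<Longrightarrow> (\<lambda>q. complex_of_real (expm t p q)) \<in> fock_space"
  using expm_row_summable[of t p] by (intro l1_imp_fock) simp

lemma exp_op_has_sum:
  assumes "\<bar>t\<bar> * rho < 1" "\<phi> \<in> fock_space"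
  shows "((\<lambda>q. of_real (expm t p q) * \<phi> q) has_sum exp_op t \<phi> p) UNIV"
  unfolding exp_op_def
  by (intro has_sum_infsum Infinite_Sum.abs_summable_summable[OF fock_Cauchy_Schwarz(1)] row_fock assms)

lemma exp_op_lin:
  assumes "\<bar>t\<bar> * rho < 1" "\<phi> \<in> fock_space" "\<xi> \<in> fock_space"
  shows "exp_op t (\<lambda>m. c * \<phi> m + \<xi> m) = (\<lambda>m. c * exp_op t \<phi> m + exp_op t \<xi> m)"
proof
  fix p
  have "((\<lambda>q. c * (of_real (expm t p q) * \<phi> q) + of_real (expm t p q) * \<xi> q) has_sum
      c * exp_op t \<phi> p + exp_op t \<xi> p) UNIV"
    by (intro has_sum_add has_sum_cmult_right exp_op_has_sum assms)
  then show "exp_op t (\<lambda>m. c * \<phi> m + \<xi> m) p = c * exp_op t \<phi> p + exp_op t \<xi> p"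
    unfolding exp_op_def[of t "\<lambda>m. c * \<phi> m + \<xi> m"] by (intro infsumI) (simp add: algebra_simps)
qed

lemma exp_op_finite:
  assumes "finite Q" "\<And>q. q \<notin> Q \<Longrightarrow> \<phi> q = 0"
  shows "exp_op t \<phi> p = (\<Sum>q\<in>Q. of_real (expm t p q) * \<phi> q)"
  unfolding exp_op_def by (rule infsumI, rule has_sum_finite_neutralI[of Q]) (use assms in auto)

lemma exp_op_basis: "exp_op t (basis q) p = of_real (expm t p q)"
  by (subst exp_op_finite[of "{q}"]) (auto simp: basis_def)

lemma exp_op_0: "exp_op 0 \<phi> = \<phi>"
  unfolding exp_op_def by (rule ext, rule infsumI, rule has_sum_finite_neutralI[of "{p}" for p]) (auto simp: expm_0)

text \<open>
  By duality: a finite piece \<open>y\<close> of the conjugated output is paired with \<open>\<phi>\<close> through the vector \<open>v\<close>,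
  whose norm equals that of \<open>y\<close> because the rows are orthonormal.
\<close>

lemma exp_op_contraction:
  assumes t: "2 * \<bar>t\<bar> * rho < 1" and \<phi>: "\<phi> \<in> fock_space"
  shows "exp_op t \<phi> \<in> fock_space" "fock_norm (exp_op t \<phi>) \<le> fock_norm \<phi>"
proof -
  have t': "\<bar>t\<bar> * rho < 1"
    using t rho_pos mult_nonneg_nonneg[of "\<bar>t\<bar>" rho] by linarith
  have "L2_set (\<lambda>p. cmod (exp_op t \<phi> p)) P \<le> fock_norm \<phi>" if P: "finite P" for P
  proof -
    define S where "S = (\<Sum>p\<in>P. (cmod (exp_op t \<phi> p))\<^sup>2)"
    have S0: "0 \<le> S" by (auto simp: S_def intro: sum_nonneg)
    define y where "y p = cnj (exp_op t \<phi> p)" for p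
    define v where "v q = (\<Sum>p\<in>P. y p * of_real (expm t p q))" for q
    have v: "v \<in> fock_space"
      unfolding v_def by (intro fock_sum fock_scale row_fock t')
    have "((\<lambda>q. \<Sum>p\<in>P. y p * (of_real (expm t p q) * \<phi> q)) has_sum (\<Sum>p\<in>P. y p * exp_op t \<phi> p)) UNIV"
      by (intro has_sum_finite_sum has_sum_cmult_right exp_op_has_sum t' \<phi>)
    moreover have "(\<Sum>p\<in>P. y p * exp_op t \<phi> p) = of_real S"
      unfolding S_def of_real_sum
      by (intro sum.cong refl) (metis y_def complex_norm_square mult.commute)
    ultimately have "((\<lambda>q. v q * \<phi> q) has_sum of_real S) UNIV"
      by (simp add: v_def sum_distrib_right mult.assoc)
    then have le: "S \<le> fock_norm v * fock_norm \<phi>"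
      using fock_Cauchy_Schwarz(2)[OF v \<phi>] S0 by (simp add: infsumI)
    have "((\<lambda>q. \<Sum>p'\<in>P. \<Sum>p\<in>P. cnj (y p') * y p * of_real (expm t p' q * expm t p q)) has_sum
        (\<Sum>p'\<in>P. \<Sum>p\<in>P. cnj (y p') * y p * of_real (if p' = p then 1 else 0))) UNIV"
      by (intro has_sum_finite_sum has_sum_cmult_right has_sum_of_real expm_rows_orthonormal t)
    moreover have "(\<Sum>p'\<in>P. \<Sum>p\<in>P. cnj (y p') * y p * of_real (expm t p' q * expm t p q)) = cnj (v q) * v q" for q
      unfolding v_def cnj_sum sum_product by (simp add: mult_ac)
    moreover have "(\<Sum>p'\<in>P. \<Sum>p\<in>P. cnj (y p') * y p * of_real (if p' = p then 1 else 0)) = of_real S"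
    proof -
      have "(\<Sum>p'\<in>P. \<Sum>p\<in>P. cnj (y p') * y p * of_real (if p' = p then 1 else 0)) =
          (\<Sum>p\<in>P. cnj (y p) * y p)"
        using P by (intro sum.cong refl) (simp add: if_distrib sum.delta cong: if_cong)
      also have "\<dots> = of_real S"
        unfolding S_def of_real_sum
        by (intro sum.cong refl) (simp add: y_def complex_norm_square del: of_real_power)
      finally show ?thesis .
    qed
    ultimately have "fock_inner v v = of_real S"
      unfolding fock_inner_def by (simp add: infsumI)
    then have "(fock_norm v)\<^sup>2 = S"
      using fock_inner_self[OF v] of_real_eq_iff by metis
    then have "fock_norm v = sqrt S"
      by (simp add: real_sqrt_unique)
    then have "sqrt S * sqrt S \<le> sqrt S * fock_norm \<phi>"
      using le S0 by simp
    then have "sqrt S \<le> fock_norm \<phi>"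
    proof (cases "S = 0")
      case False
      then have "0 < sqrt S"
        using S0 by simp
      then show ?thesis
        using \<open>sqrt S * sqrt S \<le> sqrt S * fock_norm \<phi>\<close> by (rule mult_le_cancel_left_pos[THEN iffD1])
    qed simp
    then show ?thesis
      by (simp add: L2_set_def S_def)
  qed
  then show "exp_op t \<phi> \<in> fock_space" "fock_norm (exp_op t \<phi>) \<le> fock_norm \<phi>"
    by (fact fock_space_leI)+
qed

text \<open>At a fixed entry \<open>p\<close> the difference of both sides is a linear functional
  with bound 2, as all operators involved are contractions, and it vanishes on number states by
  \<open>expm_group\<close>.\<close>

lemma exp_op_group:
  assumes st: "2 * (\<bar>s\<bar> + \<bar>t\<bar>) * rho < 1" and \<phi>: "\<phi> \<in> fock_space"
  shows "exp_op s (exp_op t \<phi>) = exp_op (s + t) \<phi>"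
proof
  fix p
  have abs_st: "\<bar>s + t\<bar> \<le> \<bar>s\<bar> + \<bar>t\<bar>"
    by (rule abs_triangle_ineq)
  have le: "2 * \<bar>s\<bar> * rho < 1" "2 * \<bar>t\<bar> * rho < 1" "2 * \<bar>s + t\<bar> * rho < 1"
    and le': "\<bar>s\<bar> * rho < 1" "\<bar>t\<bar> * rho < 1" "\<bar>s + t\<bar> * rho < 1" "(\<bar>s\<bar> + \<bar>t\<bar>) * rho < 1"
    using abs_st by (auto intro!: small_mono[OF st])
  define f where "f \<psi> = exp_op s (exp_op t \<psi>) p - exp_op (s + t) \<psi> p" for \<psi>
  have "f \<phi> = 0"
  proof (rule linear_functional_zero[where f = f and C = 2])
    fix c and \<psi> \<xi> :: "'n fock" assume fs: "\<psi> \<in> fock_space" "\<xi> \<in> fock_space"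
    show "f (\<lambda>m. c * \<psi> m + \<xi> m) = c * f \<psi> + f \<xi>"
      unfolding f_def by (simp add: exp_op_lin exp_op_contraction fs le le') (simp add: algebra_simps)
  next
    fix \<psi> :: "'n fock" assume fs: "\<psi> \<in> fock_space"
    have "cmod (f \<psi>) \<le> cmod (exp_op s (exp_op t \<psi>) p) + cmod (exp_op (s + t) \<psi> p)"
      unfolding f_def by (rule norm_triangle_ineq4)
    also have "\<dots> \<le> fock_norm (exp_op s (exp_op t \<psi>)) + fock_norm (exp_op (s + t) \<psi>)"
      by (intro add_mono cmod_le_fock_norm exp_op_contraction fs le)
    also have "\<dots> \<le> fock_norm \<psi> + fock_norm \<psi>"
      by (intro add_mono order_trans[OF exp_op_contraction(2) exp_op_contraction(2)] exp_op_contraction fs le)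
    finally show "cmod (f \<psi>) \<le> 2 * fock_norm \<psi>" by simp
  next
    fix q
    have "((\<lambda>l. complex_of_real (expm s p l * expm t l q)) has_sum of_real (expm (s + t) p q)) UNIV"
      by (intro has_sum_of_real expm_group le')
    then have "exp_op s (exp_op t (basis q)) p = of_real (expm (s + t) p q)"
      unfolding exp_op_def[of s] exp_op_basis by (intro infsumI) simp
    then show "f (basis q) = 0"
      by (simp add: f_def exp_op_basis)
  qed (rule \<phi>)
  then show "exp_op s (exp_op t \<phi>) p = exp_op (s + t) \<phi> p"
    by (simp add: f_def)
qed

text \<open>A contraction whose inverse \<open>exp_op (- t)\<close> is also a contraction is an
  isometry. The group law for \<open>t\<close> and \<open>- t\<close> doubles the bound of the
  contraction lemma, whence the factor 4.\<close>

lemma unitary_exp_op: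
  assumes t: "4 * \<bar>t\<bar> * rho < 1"
  shows "unitary_op (exp_op t)"
proof -
  have t2: "2 * \<bar>t\<bar> * rho < 1" and t1: "\<bar>t\<bar> * rho < 1"
    using t rho_pos mult_nonneg_nonneg[of "\<bar>t\<bar>" rho] by linarith+
  have mt2: "2 * \<bar>- t\<bar> * rho < 1"
    using t2 by simp
  have inv: "exp_op (- t) (exp_op t \<phi>) = \<phi>" "exp_op t (exp_op (- t) \<phi>) = \<phi>" if "\<phi> \<in> fock_space" for \<phi>
    using exp_op_group[of "-t" t \<phi>] exp_op_group[of t "-t" \<phi>] that t by (simp_all add: exp_op_0)
  have iso: "exp_op t \<phi> \<in> fock_space \<and> fock_norm (exp_op t \<phi>) = fock_norm \<phi>" if \<phi>: "\<phi> \<in> fock_space" for \<phi>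
    using exp_op_contraction[OF t2 \<phi>] exp_op_contraction(2)[OF mt2, of "exp_op t \<phi>"] inv(1)[OF \<phi>] by auto
  have "bij_betw (exp_op t) fock_space fock_space"
    by (rule bij_betw_byWitness[where f' = "exp_op (- t)"])
       (use inv exp_op_contraction(1)[OF t2] exp_op_contraction(1)[OF mt2] in auto)
  then show ?thesis
    unfolding unitary_op_def
    using exp_op_lin[OF t1] isometry_imp_inner_preserving[OF _ _ exp_op_lin[OF t1] iso] by blast
qed

section \<open>Extension of the flow to all times\<close>

text \<open>The identity outside the Fock space, so that the group law is an equation between
  functions and can be used with \<open>\<circ>\<close> and \<open>^^\<close>.\<close>

definition local_flow :: "real \<Rightarrow> 'n fock \<Rightarrow> 'n fock" where
  "local_flow t \<phi> = (if \<phi> \<in> fock_space then exp_op t \<phi> else \<phi>)"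

lemma unitary_local_flow:
  assumes "4 * \<bar>t\<bar> * rho < 1"
  shows "unitary_op (local_flow t)"
proof -
  have "bij_betw (local_flow t) fock_space fock_space \<longleftrightarrow> bij_betw (exp_op t) fock_space fock_space"
    by (rule bij_betw_cong) (simp add: local_flow_def)
  then show ?thesis
    using unitary_exp_op[OF assms] unfolding unitary_op_def by (auto simp: local_flow_def fock_lin)
qed

lemma local_flow_group:
  assumes "4 * (\<bar>s\<bar> + \<bar>t\<bar>) * rho < 1"
  shows "local_flow s \<circ> local_flow t = local_flow (s + t)"
proof -
  have "2 * (\<bar>s\<bar> + \<bar>t\<bar>) * rho < 1" "2 * \<bar>t\<bar> * rho < 1"
    by (rule small_mono[OF assms], simp)+
  then show ?thesis
    by (auto simp: fun_eq_iff local_flow_def exp_op_group exp_op_contraction)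
qed

text \<open>The dyadic fraction only has to be small enough; the result does not depend on it (\<open>flow_eq\<close>).\<close>

definition flow :: "real \<Rightarrow> 'n fock \<Rightarrow> 'n fock" where
  "flow t = (let k = (LEAST k. 4 * \<bar>t / 2 ^ k\<bar> * rho < 1) in local_flow (t / 2 ^ k) ^^ 2 ^ k)"

lemma ex_dyadic: "\<exists>k. x / 2 ^ k < (1 :: real)"
  using real_arch_pow[of 2 x] by (auto simp: field_simps)

text \<open>Raising the exponent by one halves the time and doubles the number of factors; the local
  group law merges them again in pairs.\<close>

lemma flow_eq:
  assumes k: "4 * \<bar>t / 2 ^ k\<bar> * rho < 1"
  shows "flow t = local_flow (t / 2 ^ k) ^^ 2 ^ k"
proof -
  define k0 where "k0 = (LEAST k. 4 * \<bar>t / 2 ^ k\<bar> * rho < 1)"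
  have k0: "4 * \<bar>t / 2 ^ k0\<bar> * rho < 1" "k0 \<le> k"
    unfolding k0_def using k by (rule LeastI, rule Least_le)
  have "4 * \<bar>t / 2 ^ (k0 + d)\<bar> * rho < 1 \<and> local_flow (t / 2 ^ (k0 + d)) ^^ 2 ^ (k0 + d) = local_flow (t / 2 ^ k0) ^^ 2 ^ k0" for d
  proof (induction d)
    case (Suc d)
    let ?x = "t / 2 ^ (k0 + Suc d)"
    have x: "\<bar>t / 2 ^ (k0 + d)\<bar> = \<bar>?x\<bar> + \<bar>?x\<bar>" "t / 2 ^ (k0 + d) = ?x + ?x"
      by (simp_all add: abs_divide)
    have s: "4 * (\<bar>?x\<bar> + \<bar>?x\<bar>) * rho < 1"
      using Suc.IH unfolding x(1) by blast
    have "local_flow ?x ^^ 2 ^ (k0 + Suc d) = (local_flow ?x ^^ 2) ^^ 2 ^ (k0 + d)"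
      by (simp add: funpow_mult)
    also have "local_flow ?x ^^ 2 = local_flow (t / 2 ^ (k0 + d))"
      unfolding x(2) local_flow_group[OF s, symmetric] by (simp add: numeral_2_eq_2)
    finally have "local_flow ?x ^^ 2 ^ (k0 + Suc d) = local_flow (t / 2 ^ k0) ^^ 2 ^ k0"
      using Suc.IH by simp
    moreover have "4 * \<bar>?x\<bar> * rho < 1"
    proof (rule small_mono[OF s])
      show "4 * \<bar>?x\<bar> \<le> 4 * (\<bar>?x\<bar> + \<bar>?x\<bar>)"
        by (intro mult_left_mono, rule le_add_same_cancel1[THEN iffD2], rule abs_ge_zero) simp
    qed
    ultimately show ?case by blast
  qed (use k0 in auto)
  from this[of "k - k0"] k0(2) show ?thesis
    unfolding flow_def Let_def k0_def[symmetric] by simp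
qed

lemma flow_small: "4 * \<bar>t\<bar> * rho < 1 \<Longrightarrow> flow t = local_flow t"
  using flow_eq[of t 0] by simp

lemma flow_group: "flow (s + t) = flow s \<circ> flow t"
proof -
  obtain k where k: "(4 * (\<bar>s\<bar> + \<bar>t\<bar>) * rho) / 2 ^ k < 1"
    using ex_dyadic by blast
  have sum: "4 * (\<bar>s / 2 ^ k\<bar> + \<bar>t / 2 ^ k\<bar>) * rho < 1"
    using k by (simp add: field_simps)
  have s: "4 * \<bar>s / 2 ^ k\<bar> * rho < 1" and t: "4 * \<bar>t / 2 ^ k\<bar> * rho < 1"
    by (rule small_mono[OF sum], simp)+
  have st: "4 * \<bar>(s + t) / 2 ^ k\<bar> * rho < 1"
    unfolding add_divide_distrib by (rule small_mono[OF sum], intro mult_left_mono abs_triangle_ineq) simp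
  have c1: "local_flow (s / 2 ^ k) \<circ> local_flow (t / 2 ^ k) = local_flow ((s + t) / 2 ^ k)"
    using local_flow_group[OF sum] by (simp add: add_divide_distrib)
  have c2: "local_flow (t / 2 ^ k) \<circ> local_flow (s / 2 ^ k) = local_flow ((s + t) / 2 ^ k)"
    using local_flow_group[of "t / 2 ^ k" "s / 2 ^ k"] sum by (simp add: add_divide_distrib add.commute)
  show ?thesis
    unfolding flow_eq[OF s] flow_eq[OF t] flow_eq[OF st] c1[symmetric]
    by (rule funpow_comp_commute) (simp only: c1 c2)
qed

lemma unitary_flow: "unitary_op (flow t)"
proof -
  obtain k where "(4 * \<bar>t\<bar> * rho) / 2 ^ k < 1"
    using ex_dyadic by blast
  then have k: "4 * \<bar>t / 2 ^ k\<bar> * rho < 1"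
    by (simp add: field_simps)
  show ?thesis
    unfolding flow_eq[OF k] by (intro unitary_op_funpow unitary_local_flow k)
qed

lemma gen_op_basis: "gen_op (basis q) p = of_real (a p q)"
  using supp[of q p] finite_N[of p]
  by (cases "q \<in> N p") (auto simp: gen_op_def basis_def if_distrib sum.delta cong: if_cong)

lemma gen_op_finite:
  assumes "finite Q" "\<And>q. q \<notin> Q \<Longrightarrow> \<phi> q = 0"
  shows "gen_op \<phi> p = (\<Sum>q\<in>Q. of_real (a p q) * \<phi> q)"
proof -
  have "gen_op \<phi> p = (\<Sum>q\<in>N p \<union> Q. of_real (a p q) * \<phi> q)"
    unfolding gen_op_def by (rule sum.mono_neutral_left) (use assms finite_N supp in auto)
  also have "\<dots> = (\<Sum>q\<in>Q. of_real (a p q) * \<phi> q)"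
    by (rule sum.mono_neutral_right) (use assms finite_N in auto)
  finally show ?thesis .
qed

lemma gen_op_finite_particle:
  assumes "\<phi> \<in> finite_particle"
  shows "gen_op \<phi> \<in> finite_particle"
proof -
  have "p \<in> (\<Union>q\<in>{q. \<phi> q \<noteq> 0}. N q)" if "gen_op \<phi> p \<noteq> 0" for p
  proof -
    have "\<exists>q\<in>N p. of_real (a p q) * \<phi> q \<noteq> 0"
      using that unfolding gen_op_def by (meson sum.neutral)
    then obtain q where q: "a p q \<noteq> 0" "\<phi> q \<noteq> 0"
      by auto
    \<comment> \<open>Antisymmetry makes the pattern of nonzero entries symmetric, so columns too
      are supported in the finite sets \<open>N q\<close>.\<close>
    then have "p \<in> N q"
      using supp[of p q] skew[of p q] by (cases "p \<in> N q") auto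
    then show ?thesis
      using q(2) by blast
  qed
  then have "{p. gen_op \<phi> p \<noteq> 0} \<subseteq> (\<Union>q\<in>{q. \<phi> q \<noteq> 0}. N q)" by blast
  then show ?thesis
    using assms finite_N unfolding finite_particle_def by (simp add: finite_subset)
qed

definition quot :: "real \<Rightarrow> 'n fock \<Rightarrow> 'n fock" where
  "quot t \<phi> = (\<lambda>m. (exp_op t \<phi> m - \<phi> m) / of_real t - gen_op \<phi> m)"

text \<open>Membership is recorded along with the limit because \<open>fock_norm\<close> takes the
  value 0 on functions that are not square-summable; the triangle inequality needs genuine Fock
  vectors.\<close>

lemma quot_basis_tendsto: "((\<lambda>t. fock_norm (quot t (basis q))) \<longlongrightarrow> 0) (at 0)"
  and quot_basis_fock: "eventually (\<lambda>t. quot t (basis q) \<in> fock_space) (at 0)"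
proof -
  obtain t0 B where t0: "0 < t0" and B: "(\<lambda>p. \<bar>B p\<bar>) summable_on UNIV"
    and le: "\<And>t p. \<bar>t\<bar> \<le> t0 \<Longrightarrow> \<bar>expm t p q - (if p = q then 1 else 0) - t * a p q\<bar> \<le> t\<^sup>2 * B p"
    using expm_first_order[of q] by metis
  have ev: "eventually (\<lambda>t. t \<noteq> 0 \<and> \<bar>t\<bar> \<le> t0) (at (0::real))"
    unfolding eventually_at using t0 by (intro exI[of _ t0]) (auto simp: dist_real_def)
  have pt: "cmod (quot t (basis q) p) \<le> \<bar>t\<bar> * \<bar>B p\<bar>" if t: "t \<noteq> 0 \<and> \<bar>t\<bar> \<le> t0" for t p
  proof -
    have "quot t (basis q) p = of_real ((expm t p q - (if p = q then 1 else 0) - t * a p q) / t)"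
      unfolding quot_def exp_op_basis gen_op_basis using t by (simp add: basis_def field_simps)
    then have "cmod (quot t (basis q) p) = \<bar>expm t p q - (if p = q then 1 else 0) - t * a p q\<bar> / \<bar>t\<bar>"
      by (simp only: norm_of_real abs_divide)
    also have "\<dots> \<le> (\<bar>t\<bar> * (\<bar>t\<bar> * \<bar>B p\<bar>)) / \<bar>t\<bar>"
    proof (rule divide_right_mono)
      have "t\<^sup>2 * B p \<le> t\<^sup>2 * \<bar>B p\<bar>"
        by (intro mult_left_mono) auto
      then show "\<bar>expm t p q - (if p = q then 1 else 0) - t * a p q\<bar> \<le> \<bar>t\<bar> * (\<bar>t\<bar> * \<bar>B p\<bar>)"
        using le[of t p] t by (simp add: power2_eq_square flip: mult.assoc)
    qed auto
    finally show ?thesis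
      using t by simp
  qed
  have sm: "(\<lambda>p. cmod (quot t (basis q) p)) summable_on UNIV" if t: "t \<noteq> 0 \<and> \<bar>t\<bar> \<le> t0" for t
    by (rule summable_on_comparison_test[OF summable_on_cmult_right[OF B, of "\<bar>t\<bar>"] pt[OF t]]) auto
  have n: "fock_norm (quot t (basis q)) \<le> \<bar>t\<bar> * (\<Sum>\<^sub>\<infinity>p. \<bar>B p\<bar>)" if t: "t \<noteq> 0 \<and> \<bar>t\<bar> \<le> t0" for t
  proof -
    have "fock_norm (quot t (basis q)) \<le> (\<Sum>\<^sub>\<infinity>p. cmod (quot t (basis q) p))"
      by (rule l1_imp_fock[OF sm[OF t]])
    also have "\<dots> \<le> (\<Sum>\<^sub>\<infinity>p. \<bar>t\<bar> * \<bar>B p\<bar>)"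
      by (intro infsum_mono sm pt t summable_on_cmult_right B)
    also have "\<dots> = \<bar>t\<bar> * (\<Sum>\<^sub>\<infinity>p. \<bar>B p\<bar>)"
      by (rule infsum_cmult_right'[of "\<bar>t\<bar>"])
    finally show ?thesis .
  qed
  have lim: "((\<lambda>t. \<bar>t\<bar> * (\<Sum>\<^sub>\<infinity>p. \<bar>B p\<bar>)) \<longlongrightarrow> 0) (at (0::real))"
    by (auto intro!: tendsto_eq_intros)
  show "((\<lambda>t. fock_norm (quot t (basis q))) \<longlongrightarrow> 0) (at 0)"
    by (rule Lim_null_comparison[OF _ lim]) (use ev n in \<open>auto elim: eventually_mono\<close>)
  show "eventually (\<lambda>t. quot t (basis q) \<in> fock_space) (at 0)"
    using ev by eventually_elim (rule l1_imp_fock[OF sm])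
qed

lemma quot_tendsto:
  assumes "\<phi> \<in> finite_particle"
  shows "((\<lambda>t. fock_norm (quot t \<phi>)) \<longlongrightarrow> 0) (at 0)"
    and "eventually (\<lambda>t. quot t \<phi> \<in> fock_space) (at 0)"
proof -
  define Q where "Q = {q. \<phi> q \<noteq> 0}"
  have Q: "finite Q" "\<And>q. q \<notin> Q \<Longrightarrow> \<phi> q = 0"
    using assms by (auto simp: Q_def finite_particle_def)
  have eq: "quot t \<phi> = (\<lambda>m. \<Sum>q\<in>Q. \<phi> q * quot t (basis q) m)" for t
  proof
    fix m
    have "\<phi> m = (\<Sum>q\<in>Q. \<phi> q * basis q m)"
      using Q by (auto simp: basis_def if_distrib sum.delta cong: if_cong)
    then show "quot t \<phi> m = (\<Sum>q\<in>Q. \<phi> q * quot t (basis q) m)"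
      by (simp add: quot_def exp_op_finite[OF Q] gen_op_finite[OF Q] exp_op_basis gen_op_basis
          sum_subtractf sum_divide_distrib right_diff_distrib diff_divide_distrib mult.commute)
  qed
  have ev: "eventually (\<lambda>t. \<forall>q\<in>Q. quot t (basis q) \<in> fock_space) (at 0)"
    by (intro eventually_ball_finite Q ballI quot_basis_fock)
  have lim: "((\<lambda>t. \<Sum>q\<in>Q. cmod (\<phi> q) * fock_norm (quot t (basis q))) \<longlongrightarrow> 0) (at 0)"
    by (rule tendsto_null_sum, rule tendsto_mult_right_zero, rule quot_basis_tendsto)
  have le: "fock_norm (quot t \<phi>) \<le> (\<Sum>q\<in>Q. cmod (\<phi> q) * fock_norm (quot t (basis q)))"
    if "\<forall>q\<in>Q. quot t (basis q) \<in> fock_space" for t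
    unfolding eq fock_norm_scale[symmetric] by (intro fock_sum fock_scale) (use that in auto)
  show "((\<lambda>t. fock_norm (quot t \<phi>)) \<longlongrightarrow> 0) (at 0)"
    by (rule Lim_null_comparison[OF _ lim]) (use ev le in \<open>auto elim: eventually_mono\<close>)
  show "eventually (\<lambda>t. quot t \<phi> \<in> fock_space) (at 0)"
    using ev by eventually_elim (auto simp: eq intro!: fock_sum fock_scale)
qed

lemma eventually_small: "eventually (\<lambda>t. 4 * \<bar>t\<bar> * rho < 1) (at 0)"
proof -
  have "((\<lambda>t. 4 * \<bar>t\<bar> * rho) \<longlongrightarrow> 4 * \<bar>0\<bar> * rho) (at 0)"
    by (intro tendsto_intros)
  then show ?thesis
    by (rule order_tendstoD) simp
qed

lemma flow_continuous_finite:
  assumes \<phi>: "\<phi> \<in> finite_particle"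
  shows "((\<lambda>t. fock_norm (\<lambda>m. exp_op t \<phi> m - \<phi> m)) \<longlongrightarrow> 0) (at 0)"
proof (rule Lim_null_comparison)
  show "((\<lambda>t. \<bar>t\<bar> * (fock_norm (quot t \<phi>) + fock_norm (gen_op \<phi>))) \<longlongrightarrow> 0) (at 0)"
    by (rule tendsto_eq_intros tendsto_rabs_zero tendsto_ident_at quot_tendsto[OF \<phi>] refl)+ simp
  show "eventually (\<lambda>t. norm (fock_norm (\<lambda>m. exp_op t \<phi> m - \<phi> m)) \<le>
      \<bar>t\<bar> * (fock_norm (quot t \<phi>) + fock_norm (gen_op \<phi>))) (at 0)"
    using quot_tendsto(2)[OF \<phi>] eventually_neq_at_within[of 0 0 UNIV]
  proof eventually_elim
    case (elim t)
    have "(\<lambda>m. exp_op t \<phi> m - \<phi> m) = (\<lambda>m. of_real t * (quot t \<phi> m + gen_op \<phi> m))"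
      using elim(2) by (simp add: quot_def fun_eq_iff)
    moreover have "fock_norm (\<lambda>m. of_real t * (quot t \<phi> m + gen_op \<phi> m)) =
        \<bar>t\<bar> * fock_norm (\<lambda>m. quot t \<phi> m + gen_op \<phi> m)"
      by (simp add: fock_norm_scale)
    moreover have "\<dots> \<le> \<bar>t\<bar> * (fock_norm (quot t \<phi>) + fock_norm (gen_op \<phi>))"
      by (intro mult_left_mono fock_add elim finite_particle_imp_fock gen_op_finite_particle \<phi>) auto
    ultimately show ?case by simp
  qed
qed

lemma flow_continuous:
  assumes \<phi>: "\<phi> \<in> fock_space"
  shows "((\<lambda>t. fock_norm (\<lambda>m. flow t \<phi> m - \<phi> m)) \<longlongrightarrow> 0) (at 0)"
proof (rule tendstoI)
  fix e :: real assume e: "0 < e"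
  obtain Q where Q: "finite Q" "fock_norm (\<lambda>m. \<phi> m - truncate Q \<phi> m) \<le> e / 3"
    using truncate_approx[OF \<phi>, of "e / 3"] e by auto
  define \<xi> where "\<xi> = truncate Q \<phi>"
  have fp: "\<xi> \<in> finite_particle" and fs: "\<xi> \<in> fock_space"
    using truncate_finite_particle[OF Q(1)] by (auto simp: \<xi>_def intro: finite_particle_imp_fock)
  define d where "d = (\<lambda>m. \<phi> m - \<xi> m)"
  have d: "d \<in> fock_space" "fock_norm d \<le> e / 3"
    using Q(2) by (simp_all add: d_def \<xi>_def) (use fock_diff[OF \<phi> fs] in \<open>simp add: \<xi>_def\<close>)
  have "eventually (\<lambda>t. dist (fock_norm (\<lambda>m. exp_op t \<xi> m - \<xi> m)) 0 < e / 3) (at 0)"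
    using e by (intro tendstoD[OF flow_continuous_finite[OF fp]]) simp
  then show "eventually (\<lambda>t. dist (fock_norm (\<lambda>m. flow t \<phi> m - \<phi> m)) 0 < e) (at 0)"
    using eventually_small
  proof eventually_elim
    case (elim t)
    note un = unitary_exp_op[OF elim(2)]
    have t1: "\<bar>t\<bar> * rho < 1"
      using elim(2) rho_pos mult_nonneg_nonneg[of "\<bar>t\<bar>" rho] by linarith
    have "exp_op t \<phi> = (\<lambda>m. 1 * exp_op t d m + exp_op t \<xi> m)"
      using exp_op_lin[OF t1 d(1) fs, of 1] by (simp add: d_def)
    then have eq: "(\<lambda>m. flow t \<phi> m - \<phi> m) = (\<lambda>m. (exp_op t d m + (exp_op t \<xi> m - \<xi> m)) + - 1 * d m)"
      using \<phi> by (auto simp: flow_small[OF elim(2)] local_flow_def d_def algebra_simps)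
    have f1: "exp_op t d \<in> fock_space" "(\<lambda>m. exp_op t \<xi> m - \<xi> m) \<in> fock_space"
      by (intro fock_diff unitary_op_fock[OF un] d fs)+
    have "fock_norm (\<lambda>m. flow t \<phi> m - \<phi> m) \<le>
        fock_norm (\<lambda>m. exp_op t d m + (exp_op t \<xi> m - \<xi> m)) + fock_norm (\<lambda>m. - 1 * d m)"
      unfolding eq by (intro fock_add fock_scale d f1)
    also have "\<dots> \<le> (fock_norm (exp_op t d) + fock_norm (\<lambda>m. exp_op t \<xi> m - \<xi> m)) + fock_norm d"
      unfolding fock_norm_scale by (intro add_mono fock_add f1) simp
    also have "\<dots> < e"
      using elim(1) d(2) unitary_op_norm[OF un d(1)] by (simp add: dist_real_def)
    finally show ?case
      by (simp add: dist_real_def)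
  qed
qed

lemma generates_flow: "generates gen_op flow"
  unfolding generates_def unitary_group_def
proof (intro conjI allI ballI)
  show "flow 0 \<psi> = \<psi>" if "\<psi> \<in> fock_space" for \<psi>
    using that by (simp add: flow_small local_flow_def exp_op_0)
  show "flow (s + t) \<psi> = flow s (flow t \<psi>)" for s t \<psi>
    by (simp add: flow_group)
  show "((\<lambda>t. fock_norm (\<lambda>m. (flow t \<psi> m - \<psi> m) / complex_of_real t - gen_op \<psi> m)) \<longlongrightarrow> 0) (at 0)"
    if "\<psi> \<in> finite_particle" for \<psi>
  proof (rule Lim_transform_eventually[OF quot_tendsto(1)[OF that]])
    show "eventually (\<lambda>t. fock_norm (quot t \<psi>) =
        fock_norm (\<lambda>m. (flow t \<psi> m - \<psi> m) / complex_of_real t - gen_op \<psi> m)) (at 0)"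
      using eventually_small
      by eventually_elim (simp add: flow_small local_flow_def quot_def finite_particle_imp_fock that)
  qed
qed (simp_all add: unitary_flow flow_continuous)

end

section \<open>Uniqueness of the exponential and intertwining relations\<close>

lemma unitary_op_zero:
  assumes "unitary_op U"
  shows "U (\<lambda>m. 0) = (\<lambda>m. 0)"
  using unitary_op_lin[OF assms fock_zero(1) fock_zero(1), of "-1"] by simp

lemma unitary_op_scale:
  assumes "unitary_op U" "\<phi> \<in> fock_space"
  shows "U (\<lambda>m. c * \<phi> m) = (\<lambda>m. c * U \<phi> m)"
  using unitary_op_lin[OF assms fock_zero(1), of c] by (simp add: unitary_op_zero assms)

lemma unitary_op_diff:
  assumes "unitary_op U" "\<phi> \<in> fock_space" "\<xi> \<in> fock_space"
  shows "U (\<lambda>m. \<phi> m - \<xi> m) = (\<lambda>m. U \<phi> m - U \<xi> m)"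
  using unitary_op_lin[OF assms(1,3,2), of "-1"] by simp

text \<open>Row-finite matrices act on every amplitude function, so an unbounded operator such as a
  quadrature can be applied before anything is known about domains.\<close>

definition band_op :: "(('n \<Rightarrow> nat) \<Rightarrow> ('n \<Rightarrow> nat) \<Rightarrow> complex) \<Rightarrow> (('n \<Rightarrow> nat) \<Rightarrow> ('n \<Rightarrow> nat) set) \<Rightarrow>
    'n fock \<Rightarrow> 'n fock" where
  "band_op x M \<phi> = (\<lambda>p. \<Sum>l\<in>M p. x p l * \<phi> l)"

context fock_skew
begin

lemma gen_op_funpow_finite:
  assumes "finite Q" "\<And>q. q \<notin> Q \<Longrightarrow> \<phi> q = 0"
  shows "(gen_op ^^ k) \<phi> p = (\<Sum>q\<in>Q. of_real (apow k p q) * \<phi> q)"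
proof (induction k arbitrary: p)
  case 0
  have "\<phi> p = (\<Sum>q\<in>Q. if p = q then \<phi> q else 0)"
    using assms by (simp add: sum.delta)
  also have "\<dots> = (\<Sum>q\<in>Q. of_real (apow 0 p q) * \<phi> q)"
    by (intro sum.cong) auto
  finally show ?case by simp
next
  case (Suc k)
  have "(gen_op ^^ Suc k) \<phi> p = (\<Sum>l\<in>N p. of_real (a p l) * (gen_op ^^ k) \<phi> l)"
    by (simp add: gen_op_def[of "(gen_op ^^ k) \<phi>"])
  also have "\<dots> = (\<Sum>q\<in>Q. of_real (apow (Suc k) p q) * \<phi> q)"
    unfolding Suc.IH by (simp add: sum_distrib_left sum_distrib_right sum.swap[of _ Q] mult.assoc)
  finally show ?case .
qed

lemma gen_op_funpow_basis: "(gen_op ^^ k) (basis q) p = of_real (apow k p q)"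
  by (subst gen_op_funpow_finite[of "{q}"]) (auto simp: basis_def)

lemma gen_op_funpow_finite_particle: "\<phi> \<in> finite_particle \<Longrightarrow> (gen_op ^^ k) \<phi> \<in> finite_particle"
  by (induction k) (auto intro: gen_op_finite_particle)

text \<open>Number states are analytic vectors of the generator: the vector is a column of the
  power, and its absolute sum, bounded by \<open>growth\<close> after transposition, dominates its
  norm.\<close>

lemma gen_op_funpow_basis_norm: "fock_norm ((gen_op ^^ k) (basis q)) \<le> K q * rho ^ k * fact k"
proof (rule fock_space_leI)
  fix P :: "('n \<Rightarrow> nat) set" assume P: "finite P"
  have "L2_set (\<lambda>m. cmod ((gen_op ^^ k) (basis q) m)) P \<le> (\<Sum>m\<in>P. cmod ((gen_op ^^ k) (basis q) m))"
    by (rule L2_set_le_sum) simp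
  also have "\<dots> \<le> (\<Sum>m\<in>P. abspow k q m)"
    using abs_mpow_le[of a N k _ q] by (intro sum_mono) (simp add: gen_op_funpow_basis abspow_transpose)
  also have "\<dots> \<le> K q * rho ^ k * fact k"
    by (rule growth[OF P])
  finally show "L2_set (\<lambda>m. cmod ((gen_op ^^ k) (basis q) m)) P \<le> K q * rho ^ k * fact k" .
qed

lemma generates_group: "generates gen_op W \<Longrightarrow> \<psi> \<in> fock_space \<Longrightarrow> W (s + t) \<psi> = W s (W t \<psi>)"
  and generates_unitary: "generates gen_op W \<Longrightarrow> unitary_op (W t)"
  and generates_0: "generates gen_op W \<Longrightarrow> \<psi> \<in> fock_space \<Longrightarrow> W 0 \<psi> = \<psi>"
  by (simp_all add: generates_def unitary_group_def)

text \<open>\<open>generates\<close> gives the derivative at time 0 only; the group law and the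
  isometry \<open>W t\<close> carry it to time \<open>t\<close>.\<close>

lemma generates_deriv:
  assumes W: "generates gen_op W" and \<psi>: "\<psi> \<in> finite_particle"
  shows "((\<lambda>h. (W (t + h) \<psi> m - W t \<psi> m) / of_real h) \<longlongrightarrow> W t (gen_op \<psi>) m) (at 0)"
proof -
  note un = generates_unitary[OF W]
  have fs: "\<psi> \<in> fock_space" "gen_op \<psi> \<in> fock_space"
    using \<psi> by (auto intro: finite_particle_imp_fock gen_op_finite_particle)
  define d where "d h = (\<lambda>m. (W h \<psi> m - \<psi> m) / of_real h - gen_op \<psi> m)" for h
  have lim: "((\<lambda>h. fock_norm (d h)) \<longlongrightarrow> 0) (at 0)"
    using W \<psi> by (simp add: generates_def d_def)
  have "((\<lambda>h. (W (t + h) \<psi> m - W t \<psi> m) / of_real h - W t (gen_op \<psi>) m) \<longlongrightarrow> 0) (at 0)"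
  proof (rule Lim_null_comparison[OF always_eventually lim], rule allI)
    fix h
    \<comment> \<open>Writing the quotient with \<open>inverse\<close> covers \<open>h = 0\<close>
      too, since both quotients are then 0.\<close>
    define d1 where "d1 = (\<lambda>m. inverse (of_real h) * (W h \<psi> m - \<psi> m))"
    have d1: "d1 \<in> fock_space" "(\<lambda>m. W h \<psi> m - \<psi> m) \<in> fock_space"
      unfolding d1_def by (intro fock_scale fock_diff unitary_op_fock[OF un] fs)+
    have dh: "d h = (\<lambda>m. d1 m - gen_op \<psi> m)"
      by (simp add: d_def d1_def divide_inverse mult.commute)
    have "W t (d h) m = inverse (of_real h) * (W t (W h \<psi>) m - W t \<psi> m) - W t (gen_op \<psi>) m"
      unfolding dh unitary_op_diff[OF un d1(1) fs(2)] unfolding d1_def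
      by (simp add: unitary_op_scale[OF un d1(2)] unitary_op_diff[OF un unitary_op_fock[OF un] fs(1)] fs)
    then have "(W (t + h) \<psi> m - W t \<psi> m) / of_real h - W t (gen_op \<psi>) m = W t (d h) m"
      by (simp add: generates_group[OF W fs(1)] divide_inverse mult.commute)
    also have "cmod \<dots> \<le> fock_norm (W t (d h))"
      by (intro cmod_le_fock_norm unitary_op_fock[OF un]) (simp add: dh fock_diff d1 fs)
    also have "\<dots> = fock_norm (d h)"
      by (intro unitary_op_norm[OF un]) (simp add: dh fock_diff d1 fs)
    finally show "norm ((W (t + h) \<psi> m - W t \<psi> m) / of_real h - W t (gen_op \<psi>) m) \<le> fock_norm (d h)" .
  qed
  then show ?thesis
    by (rule Lim_null[THEN iffD2])
qed

text \<open>In any group with this generator the \<open>k\<close>-th time derivative is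
  \<open>W t\<close> applied to the \<open>k\<close>-th power of the generator. Taylor's formula
  therefore fixes the entries within the radius given by the analytic-vector bound.\<close>

lemma generates_basis:
  assumes W: "generates gen_op W" and t: "\<bar>t\<bar> * rho < 1"
  shows "W t (basis q) m = of_real (expm t m q)"
proof -
  \<comment> \<open>Taylor's formula with remainder is used for real functions, so a real part is
    taken; \<open>c = 1\<close> and \<open>c = - \<i>\<close> recover both components.\<close>
  have *: "Re (c * W t (basis q) m) = Re c * expm t m q" for c
  proof -
    define D where "D k t = Re (c * W t ((gen_op ^^ k) (basis q)) m)" for k t
    have fp: "(gen_op ^^ k) (basis q) \<in> finite_particle" for k
      by (intro gen_op_funpow_finite_particle basis_finite_particle)
    have deriv: "DERIV (D k) t :> D (Suc k) t" for k t
    proof -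
      have "((\<lambda>h. Re (c * ((W (t + h) ((gen_op ^^ k) (basis q)) m - W t ((gen_op ^^ k) (basis q)) m) / of_real h)))
          \<longlongrightarrow> Re (c * W t (gen_op ((gen_op ^^ k) (basis q))) m)) (at 0)"
        by (intro tendsto_Re tendsto_mult tendsto_const generates_deriv[OF W fp])
      moreover have eq: "(Re (c * x) - Re (c * y)) / h = Re (c * ((x - y) / of_real h))" for x y h
        by (cases "h = 0") (simp_all add: field_simps)
      ultimately show ?thesis
        unfolding DERIV_def D_def eq by simp
    qed
    have D0: "D k 0 = Re c * apow k m q" for k
      using generates_0[OF W finite_particle_imp_fock[OF fp]] by (simp add: D_def gen_op_funpow_basis)
    have bound: "\<bar>D k s\<bar> \<le> cmod c * (K q * rho ^ k * fact k)" for k s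
    proof -
      have "\<bar>D k s\<bar> \<le> cmod c * cmod (W s ((gen_op ^^ k) (basis q)) m)"
        unfolding D_def by (metis abs_Re_le_cmod norm_mult)
      also have "\<dots> \<le> cmod c * (K q * rho ^ k * fact k)"
      proof (rule mult_left_mono)
        have "cmod (W s ((gen_op ^^ k) (basis q)) m) \<le> fock_norm (W s ((gen_op ^^ k) (basis q)))"
          by (rule cmod_le_fock_norm[OF unitary_op_fock[OF generates_unitary[OF W] finite_particle_imp_fock[OF fp]]])
        also have "\<dots> = fock_norm ((gen_op ^^ k) (basis q))"
          by (rule unitary_op_norm[OF generates_unitary[OF W] finite_particle_imp_fock[OF fp]])
        also have "\<dots> \<le> K q * rho ^ k * fact k"
          by (rule gen_op_funpow_basis_norm)
        finally show "cmod (W s ((gen_op ^^ k) (basis q)) m) \<le> K q * rho ^ k * fact k" .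
      qed simp
      finally show ?thesis .
    qed
    \<comment> \<open>The derivative \<open>D n s\<close> is bounded uniformly in the unknown
      \<open>s\<close> because \<open>W s\<close> preserves norms; the factorial cancels and a
      geometric term is left.\<close>
    have rem: "\<bar>D 0 t - (\<Sum>k<n. Re c * (t ^ k / fact k * apow k m q))\<bar> \<le> cmod c * K q * (\<bar>t\<bar> * rho) ^ n" for n
    proof -
      obtain s where "D 0 t = (\<Sum>k<n. D k 0 / fact k * t ^ k) + D n s / fact n * t ^ n"
        using Maclaurin_all_le[of D "D 0" t n] deriv by blast
      then have "\<bar>D 0 t - (\<Sum>k<n. Re c * (t ^ k / fact k * apow k m q))\<bar> = \<bar>D n s\<bar> * (\<bar>t\<bar> ^ n / fact n)"
        by (simp add: D0 abs_mult power_abs mult_ac)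
      also have "\<dots> \<le> (cmod c * (K q * rho ^ n * fact n)) * (\<bar>t\<bar> ^ n / fact n)"
        by (intro mult_right_mono bound) auto
      also have "\<dots> = cmod c * K q * (\<bar>t\<bar> * rho) ^ n"
        by (simp add: power_mult_distrib)
      finally show ?thesis .
    qed
    have "(\<lambda>n. cmod c * K q * (\<bar>t\<bar> * rho) ^ n) \<longlonglongrightarrow> cmod c * K q * 0"
      using t rho_pos by (intro tendsto_mult tendsto_const LIMSEQ_power_zero) (simp add: abs_mult)
    then have lim: "(\<lambda>n. cmod c * K q * (\<bar>t\<bar> * rho) ^ n) \<longlonglongrightarrow> 0"
      by simp
    have "(\<lambda>n. D 0 t - (\<Sum>k<n. Re c * (t ^ k / fact k * apow k m q))) \<longlonglongrightarrow> 0"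
      by (rule Lim_null_comparison[OF always_eventually lim]) (simp only: real_norm_def rem simp_thms)
    moreover have "(\<lambda>k. Re c * (t ^ k / fact k * apow k m q)) sums (Re c * expm t m q)"
      unfolding expm_def by (intro sums_mult summable_sums exp_series_summable t)
    then have "(\<lambda>n. D 0 t - (\<Sum>k<n. Re c * (t ^ k / fact k * apow k m q))) \<longlonglongrightarrow> D 0 t - Re c * expm t m q"
      unfolding sums_def by (intro tendsto_diff tendsto_const)
    ultimately have "D 0 t - Re c * expm t m q = 0"
      using LIMSEQ_unique by blast
    then show ?thesis
      by (simp add: D_def)
  qed
  from *[of 1] *[of "-\<i>"] show ?thesis
    by (simp add: complex_eq_iff)
qed

text \<open>Unitarity reduces an arbitrary \<open>\<phi>\<close> to number states: an amplitude is
  an inner product with \<open>basis m\<close>, and \<open>W (- t)\<close> moves the evolution onto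
  \<open>basis m\<close>.\<close>

lemma generates_eq_exp_op:
  assumes W: "generates gen_op W" and t: "\<bar>t\<bar> * rho < 1" and \<phi>: "\<phi> \<in> fock_space"
  shows "W t \<phi> = exp_op t \<phi>"
proof
  fix m
  note un = generates_unitary[OF W]
  have "W t \<phi> m = fock_inner (W t (W (- t) (basis m))) (W t \<phi>)"
    using generates_group[OF W basis_fock, of t "-t"] generates_0[OF W basis_fock] by simp
  also have "\<dots> = fock_inner (W (- t) (basis m)) \<phi>"
    by (intro unitary_op_inner[OF un] unitary_op_fock[OF un] \<phi> basis_fock)
  also have "\<dots> = exp_op t \<phi> m"
    using t by (simp add: fock_inner_def exp_op_def generates_basis[OF W] expm_transpose[of "-t" _ m])
  finally show "W t \<phi> m = exp_op t \<phi> m" .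
qed

text \<open>All groups with this generator agree with \<open>exp_op\<close> for short times, hence
  by the group law with its iterates; \<open>flow\<close> shows that one exists. This settles the
  definite description in \<open>op_exp\<close>.\<close>

lemma op_exp_gen_op:
  assumes n: "4 * \<bar>1 / real n\<bar> * rho < 1" "0 < n" and \<phi>: "\<phi> \<in> fock_space"
  shows "op_exp gen_op \<phi> = (exp_op (1 / real n) ^^ n) \<phi>"
proof -
  have n1: "\<bar>1 / real n\<bar> * rho < 1"
    by (rule small_mono[OF n(1)]) (simp add: divide_right_mono)
  have mult: "W (real k * (1 / real n)) \<phi> = (exp_op (1 / real n) ^^ k) \<phi> \<and>
      (exp_op (1 / real n) ^^ k) \<phi> \<in> fock_space" if W: "generates gen_op W" for W k
  proof (induction k)
    case 0
    then show ?case
      using generates_0[OF W \<phi>] \<phi> by simp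
  next
    case (Suc k)
    have "W (real (Suc k) * (1 / real n)) \<phi> = W (1 / real n + real k * (1 / real n)) \<phi>"
      by (simp add: add_divide_distrib)
    also have "\<dots> = (exp_op (1 / real n) ^^ Suc k) \<phi>"
      using Suc.IH by (simp add: generates_group[OF W \<phi>] generates_eq_exp_op[OF W n1])
    finally show ?case
      using Suc.IH unitary_op_fock[OF unitary_exp_op[OF n(1)]] by simp
  qed
  show ?thesis
    unfolding op_exp_def
  proof (rule the_equality)
    show "\<exists>W. generates gen_op W \<and> (exp_op (1 / real n) ^^ n) \<phi> = W 1 \<phi>"
      using generates_flow mult[OF generates_flow, of n] n(2) by (intro exI[of _ flow]) simp
  next
    fix \<psi> assume "\<exists>W. generates gen_op W \<and> \<psi> = W 1 \<phi>"
    then show "\<psi> = (exp_op (1 / real n) ^^ n) \<phi>"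
      using mult[of _ n] n(2) by auto
  qed
qed

text \<open>With \<open>X\<close> for \<open>band_op x M\<close> and \<open>A\<close> for
  \<open>gen_op\<close>, the hypothesis reads \<open>X A = (A + lam) X\<close>. Hence
  \<open>X A^k = (A + lam)^k X\<close>, expanded by the binomial theorem.\<close>

lemma band_op_funpow:
  assumes comm: "\<And>\<phi> m. band_op x M (gen_op \<phi>) m = gen_op (band_op x M \<phi>) m + of_real lam * band_op x M \<phi> m"
  shows "band_op x M ((gen_op ^^ k) \<phi>) m =
    (\<Sum>i\<le>k. of_nat (k choose i) * of_real (lam ^ (k - i)) * (gen_op ^^ i) (band_op x M \<phi>) m)"
proof (induction k arbitrary: m)
  case (Suc k)
  define c where "c i = (of_nat (k choose i) * of_real (lam ^ (k - i)) :: complex)" for i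
  define b where "b i = (gen_op ^^ i) (band_op x M \<phi>)" for i
  have IH: "band_op x M ((gen_op ^^ k) \<phi>) = (\<lambda>m. \<Sum>i\<le>k. c i * b i m)"
    using Suc.IH by (auto simp: c_def b_def)
  have "gen_op (\<lambda>m. \<Sum>i\<le>k. c i * b i m) m = (\<Sum>i\<le>k. c i * b (Suc i) m)"
    by (simp add: gen_op_def b_def sum_distrib_left sum.swap[of _ "N m"] mult_ac)
  then have "band_op x M ((gen_op ^^ Suc k) \<phi>) m =
      (\<Sum>i\<le>k. c i * b (Suc i) m) + of_real lam * (\<Sum>i\<le>k. c i * b i m)"
    by (simp add: comm IH)
  also have "of_real lam * (\<Sum>i\<le>k. c i * b i m) =
      (\<Sum>i\<le>Suc k. of_nat (k choose i) * of_real (lam ^ (Suc k - i)) * b i m)"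
    by (simp add: c_def sum_distrib_left Suc_diff_le mult_ac)
  also have "\<dots> = of_real (lam ^ Suc k) * b 0 m +
      (\<Sum>i\<le>k. of_nat (k choose Suc i) * of_real (lam ^ (k - i)) * b (Suc i) m)"
    by (subst sum.atMost_Suc_shift) simp
  also have "(\<Sum>i\<le>k. c i * b (Suc i) m) + \<dots> = of_real (lam ^ Suc k) * b 0 m +
      (\<Sum>i\<le>k. of_nat (Suc k choose Suc i) * of_real (lam ^ (k - i)) * b (Suc i) m)"
    by (simp add: c_def algebra_simps sum.distrib)
  also have "\<dots> = (\<Sum>i\<le>Suc k. of_nat (Suc k choose i) * of_real (lam ^ (Suc k - i)) * b i m)"
    by (subst sum.atMost_Suc_shift) simp
  finally show ?case
    by (simp add: b_def)
qed simp

text \<open>Exponentiating the binomial identity of \<open>band_op_funpow\<close> yields the scalar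
  exponential as one factor of a Cauchy product. Finite rows let the band operator pass through the
  series, and the finite support of its value on \<open>basis q\<close> keeps the other factor a
  finite combination of columns.\<close>

lemma band_op_exp_op_basis:
  assumes comm: "\<And>\<phi> m. band_op x M (gen_op \<phi>) m = gen_op (band_op x M \<phi>) m + of_real lam * band_op x M \<phi> m"
    and fin: "band_op x M (basis q) \<in> finite_particle"
    and t: "\<bar>t\<bar> * rho < 1"
  shows "band_op x M (exp_op t (basis q)) m = exp (of_real (t * lam)) * exp_op t (band_op x M (basis q)) m"
proof -
  define \<xi> where "\<xi> = band_op x M (basis q)"
  define Q where "Q = {l. \<xi> l \<noteq> 0}"
  have Q: "finite Q" "\<And>l. l \<notin> Q \<Longrightarrow> \<xi> l = 0"
    using fin by (auto simp: Q_def finite_particle_def \<xi>_def)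
  define A where "A i = (\<Sum>l\<in>Q. of_real (t ^ i / fact i * apow i m l) * \<xi> l)" for i
  define B where "B i = (complex_of_real (t * lam) ^ i /\<^sub>R fact i)" for i
  have A_norm: "summable (\<lambda>i. norm (A i))"
  proof (rule summable_comparison_test')
    show "summable (\<lambda>i. \<Sum>l\<in>Q. \<bar>t ^ i / fact i * apow i m l\<bar> * cmod (\<xi> l))"
      by (intro summable_sum summable_mult2 exp_series_summable t)
    show "norm (norm (A i)) \<le> (\<Sum>l\<in>Q. \<bar>t ^ i / fact i * apow i m l\<bar> * cmod (\<xi> l))" for i
      unfolding A_def real_norm_def abs_norm_cancel
      by (rule order_trans[OF norm_sum]) (simp only: norm_mult norm_of_real order_refl)
  qed
  have "exp_op t \<xi> m = (\<Sum>l\<in>Q. of_real (expm t m l) * \<xi> l)"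
    by (rule exp_op_finite) (use Q in auto)
  then have A_sums: "A sums exp_op t \<xi> m"
    unfolding A_def expm_def
    by (simp only:) (intro sums_sum sums_mult2 sums_of_real summable_sums exp_series_summable t)
  have B_norm: "summable (\<lambda>i. norm (B i))"
    unfolding B_def by (rule summable_norm_exp)
  have B_sums: "B sums exp (of_real (t * lam))"
    unfolding B_def by (rule exp_converges)
  have prod: "(\<lambda>k. \<Sum>i\<le>k. A i * B (k - i)) sums (exp_op t \<xi> m * exp (of_real (t * lam)))"
    using Cauchy_product_sums[OF A_norm B_norm] A_sums B_sums by (simp add: sums_iff)
  have "(\<lambda>k. \<Sum>l\<in>M m. x m l * of_real (t ^ k / fact k * apow k l q)) sums band_op x M (exp_op t (basis q)) m"
    unfolding band_op_def exp_op_basis expm_def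
    by (intro sums_sum sums_mult sums_of_real summable_sums exp_series_summable t)
  moreover have "(\<Sum>l\<in>M m. x m l * of_real (t ^ k / fact k * apow k l q)) = (\<Sum>i\<le>k. A i * B (k - i))" for k
  proof -
    have "(\<Sum>l\<in>M m. x m l * of_real (t ^ k / fact k * apow k l q)) =
        of_real (t ^ k / fact k) * band_op x M ((gen_op ^^ k) (basis q)) m"
      by (simp add: band_op_def gen_op_funpow_basis sum_distrib_left mult_ac)
    also have "\<dots> = (\<Sum>i\<le>k. of_real (t ^ k / fact k) *
        (of_nat (k choose i) * of_real (lam ^ (k - i)) * (gen_op ^^ i) \<xi> m))"
      unfolding band_op_funpow[OF comm] \<xi>_def sum_distrib_left ..
    also have "\<dots> = (\<Sum>i\<le>k. A i * B (k - i))"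
    proof (rule sum.cong[OF refl])
      fix i assume "i \<in> {..k}"
      then have i: "i \<le> k" by simp
      have "(gen_op ^^ i) \<xi> m = (\<Sum>l\<in>Q. of_real (apow i m l) * \<xi> l)"
        by (rule gen_op_funpow_finite) (use Q in auto)
      then have 1: "A i = of_real (t ^ i / fact i) * (gen_op ^^ i) \<xi> m"
        by (simp add: A_def sum_distrib_left mult_ac)
      have 2: "B (k - i) = of_real ((t * lam) ^ (k - i) / fact (k - i))"
        by (simp add: B_def scaleR_conv_of_real field_simps)
      have 3: "t ^ k / fact k * (real (k choose i) * lam ^ (k - i)) =
          t ^ i / fact i * ((t * lam) ^ (k - i) / fact (k - i))"
        using i by (simp add: binomial_fact power_mult_distrib field_simps flip: power_add)
      show "of_real (t ^ k / fact k) * (of_nat (k choose i) * of_real (lam ^ (k - i)) * (gen_op ^^ i) \<xi> m) =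
          A i * B (k - i)"
        using arg_cong[OF 3, of "\<lambda>z. complex_of_real z * (gen_op ^^ i) \<xi> m"]
        unfolding 1 2 of_real_mult of_real_of_nat_eq by (simp only: mult_ac)
    qed
    finally show ?thesis .
  qed
  ultimately show ?thesis
    using sums_unique2[OF prod] by (simp add: \<xi>_def mult.commute)
qed

text \<open>
  \<open>band_op x M\<close> is moved onto the row of the exponential matrix, where it acts on a basis vector,
  and back; no density argument is needed for the unbounded operator.
\<close>

lemma band_op_exp_op:
  assumes comm: "\<And>\<phi> m. band_op x M (gen_op \<phi>) m = gen_op (band_op x M \<phi>) m + of_real lam * band_op x M \<phi> m"
    and finM: "\<And>p. finite (M p)"
    and supp: "\<And>p q. q \<notin> M p \<Longrightarrow> x p q = 0"
    and sym: "\<And>p q. x q p = sg * x p q" and sg: "sg * sg = 1"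
    and t: "\<bar>t\<bar> * rho < 1" and \<phi>: "\<phi> \<in> fock_space"
    and adj: "\<And>v. v \<in> fock_space \<Longrightarrow>
      (\<Sum>\<^sub>\<infinity>q. v q * band_op x M \<phi> q) = sg * (\<Sum>\<^sub>\<infinity>q. band_op x M v q * \<phi> q)"
  shows "band_op x M (exp_op t \<phi>) m = exp (of_real (t * lam)) * exp_op t (band_op x M \<phi>) m"
proof -
  have sg0: "sg \<noteq> 0"
    using sg by auto
  have Xb: "band_op x M (basis q) l = x l q" for q l
    using supp[of q l] finM[of l]
    by (cases "q \<in> M l") (auto simp: band_op_def basis_def if_distrib sum.delta cong: if_cong)
  have Xb0: "band_op x M (basis q) l = 0" if "l \<notin> M q" for q l
    using supp[of l q] sym[of l q] that by (simp add: Xb)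
  have fin: "band_op x M (basis q) \<in> finite_particle" for q
    unfolding finite_particle_def mem_Collect_eq
    by (rule finite_subset[OF _ finM[of q]]) (use Xb0 in auto)
  have row: "(\<lambda>q. complex_of_real (expm t m q)) = exp_op (- t) (basis m)"
    by (simp add: fun_eq_iff exp_op_basis expm_transpose[of "-t" _ m])
  have R: "band_op x M (exp_op (- t) (basis m)) q = exp (- of_real (t * lam)) * (sg * (\<Sum>l\<in>M m. x m l * of_real (expm t l q)))" for q
  proof -
    have "band_op x M (exp_op (- t) (basis m)) q = exp (of_real (- t * lam)) * exp_op (- t) (band_op x M (basis m)) q"
      by (rule band_op_exp_op_basis[OF comm fin]) (use t in simp)
    also have "exp_op (- t) (band_op x M (basis m)) q = (\<Sum>l\<in>M m. of_real (expm (- t) q l) * band_op x M (basis m) l)"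
      by (rule exp_op_finite[OF finM Xb0])
    also have "\<dots> = sg * (\<Sum>l\<in>M m. x m l * of_real (expm t l q))"
      unfolding sum_distrib_left
      by (intro sum.cong refl) (simp add: Xb sym[of _ m] expm_transpose[of t _ q] mult_ac)
    finally show ?thesis by simp
  qed
  have "((\<lambda>q. exp (- of_real (t * lam)) * (sg * (\<Sum>l\<in>M m. x m l * (of_real (expm t l q) * \<phi> q)))) has_sum
      exp (- of_real (t * lam)) * (sg * band_op x M (exp_op t \<phi>) m)) UNIV"
    unfolding band_op_def[of x M "exp_op t \<phi>"]
    by (intro has_sum_cmult_right has_sum_finite_sum exp_op_has_sum t \<phi>)
  then have "(\<Sum>\<^sub>\<infinity>q. band_op x M (exp_op (- t) (basis m)) q * \<phi> q) =
      exp (- of_real (t * lam)) * (sg * band_op x M (exp_op t \<phi>) m)"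
    unfolding R by (intro infsumI) (simp add: sum_distrib_left sum_distrib_right mult_ac)
  moreover have "exp_op t (band_op x M \<phi>) m = sg * (\<Sum>\<^sub>\<infinity>q. band_op x M (exp_op (- t) (basis m)) q * \<phi> q)"
    unfolding exp_op_def[of t] row[symmetric] by (rule adj[OF row_fock[OF t]])
  ultimately have "exp_op t (band_op x M \<phi>) m = (sg * sg) * (exp (- of_real (t * lam)) * band_op x M (exp_op t \<phi>) m)"
    by simp
  then show ?thesis
    unfolding sg by (simp add: mult.assoc[symmetric] flip: exp_add)
qed

end

section \<open>Squeezed states\<close>

text \<open>Substituting \<open>q(k := q k + 1)\<close> for \<open>q\<close> turns one family into
  the other; occupations outside the range of this shift have \<open>q k = 0\<close>, where
  \<open>creat\<close> contributes a zero factor.\<close>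

lemma annih_has_sum_iff:
  "((\<lambda>q. v q * annih k \<phi> q) has_sum S) UNIV \<longleftrightarrow> ((\<lambda>q. creat k v q * \<phi> q) has_sum S) UNIV"
proof -
  define h where "h q = q(k := q k + 1)" for q :: "'a \<Rightarrow> nat"
  have inj: "inj h"
    by (rule inj_on_inverseI[where g = "\<lambda>q. q(k := q k - 1)"]) (simp add: h_def)
  have "((\<lambda>q. creat k v q * \<phi> q) has_sum S) UNIV \<longleftrightarrow> ((\<lambda>q. creat k v q * \<phi> q) has_sum S) (range h)"
  proof (rule has_sum_cong_neutral)
    fix q assume "q \<in> UNIV - range h"
    moreover have "q = h (q(k := q k - 1))" if "q k \<noteq> 0"
      using that by (simp add: h_def)
    ultimately have "q k = 0"
      by (metis DiffE rangeI)
    then show "creat k v q * \<phi> q = 0"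
      by (simp add: creat_def)
  qed auto
  also have "\<dots> \<longleftrightarrow> ((\<lambda>q. v q * annih k \<phi> q) has_sum S) UNIV"
    unfolding has_sum_reindex[OF inj]
    by (rule has_sum_cong) (simp add: creat_def annih_def h_def)
  finally show ?thesis by simp
qed

text \<open>Valid without summability: either both sums exist, or both are the default 0.\<close>

lemma infsum_annih: "(\<Sum>\<^sub>\<infinity>q. v q * annih k \<phi> q) = (\<Sum>\<^sub>\<infinity>q. creat k v q * \<phi> q)"
proof (cases "(\<lambda>q. v q * annih k \<phi> q) summable_on UNIV")
  case True
  then obtain S where S: "((\<lambda>q. v q * annih k \<phi> q) has_sum S) UNIV"
    by (auto simp: summable_on_def)
  then have "((\<lambda>q. creat k v q * \<phi> q) has_sum S) UNIV"
    by (simp add: annih_has_sum_iff)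
  then show ?thesis
    using S by (simp add: infsumI)
next
  case False
  moreover from False have "\<not> (\<lambda>q. creat k v q * \<phi> q) summable_on UNIV"
    using annih_has_sum_iff[of v k \<phi>] by (simp add: summable_on_def)
  ultimately show ?thesis
    by (simp add: infsum_not_exists)
qed

lemma infsum_creat: "(\<Sum>\<^sub>\<infinity>q. v q * creat k \<phi> q) = (\<Sum>\<^sub>\<infinity>q. annih k v q * \<phi> q)"
  using infsum_annih[of \<phi> k v] by (simp add: mult.commute)

lemma summable_annih_iff:
  "(\<lambda>q. v q * annih k \<phi> q) summable_on UNIV \<longleftrightarrow> (\<lambda>q. creat k v q * \<phi> q) summable_on UNIV"
  using annih_has_sum_iff[of v k \<phi>] by (simp add: summable_on_def)

section \<open>Exponentially decaying amplitudes\<close>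

text \<open>A common domain for polynomials in the ladder operators. Finite-particle vectors would
  not do: a squeezed state in general has infinitely many nonzero amplitudes.\<close>

definition exp_decay :: "'n::finite fock \<Rightarrow> bool" where
  "exp_decay \<phi> \<longleftrightarrow> (\<exists>C x. 0 < x \<and> x < 1 \<and> (\<forall>m. cmod (\<phi> m) \<le> C * x ^ (\<Sum>k\<in>UNIV. m k)))"

lemma geometric_summable_on:
  assumes "0 < x" "x < (1 :: real)"
  shows "(\<lambda>m :: 'n::finite \<Rightarrow> nat. x ^ (\<Sum>k\<in>UNIV. m k)) summable_on UNIV"
proof -
  have geo: "((\<lambda>n. x ^ n) has_sum (1 / (1 - x))) UNIV"
    by (rule sums_nonneg_imp_has_sum[OF geometric_sums]) (use assms in auto)
  have "infsum (\<lambda>g. \<Prod>k\<in>(UNIV :: 'n set). x ^ g k) (PiE UNIV (\<lambda>_. UNIV)) =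
      (\<Prod>k\<in>(UNIV :: 'n set). infsum (\<lambda>n. x ^ n) UNIV)"
  proof (rule infsum_prod_PiE_abs)
    show "(\<lambda>n. norm (x ^ n)) summable_on UNIV"
      using geo assms by (auto simp: summable_on_def)
  qed simp
  then have "infsum (\<lambda>m :: 'n \<Rightarrow> nat. x ^ (\<Sum>k\<in>UNIV. m k)) UNIV = (1 / (1 - x)) ^ CARD('n)"
    by (simp add: infsumI[OF geo] power_sum PiE_UNIV_domain)
  \<comment> \<open>A family that is not summable has \<open>infsum\<close> 0, while the product of
    geometric series is nonzero; this yields summability.\<close>
  then show ?thesis
    using assms infsum_not_exists by fastforce
qed

lemma exp_decay_fock:
  assumes "exp_decay \<phi>"
  shows "\<phi> \<in> fock_space"
proof -
  obtain C x where x: "0 < x" "x < 1" and le: "\<And>m. cmod (\<phi> m) \<le> C * x ^ (\<Sum>k\<in>UNIV. m k)"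
    using assms unfolding exp_decay_def by blast
  have "(\<lambda>m. cmod (\<phi> m)) summable_on UNIV"
    by (rule summable_on_comparison_test[OF summable_on_cmult_right[OF geometric_summable_on[OF x], of C] le]) simp
  then show ?thesis
    by (rule l1_imp_fock)
qed

lemma exp_decay_scale: "exp_decay \<phi> \<Longrightarrow> exp_decay (\<lambda>m. c * \<phi> m)"
proof -
  assume "exp_decay \<phi>"
  then obtain C x where x: "0 < x" "x < 1" and le: "\<And>m. cmod (\<phi> m) \<le> C * x ^ (\<Sum>k\<in>UNIV. m k)"
    unfolding exp_decay_def by blast
  have "cmod (c * \<phi> m) \<le> (cmod c * C) * x ^ (\<Sum>k\<in>UNIV. m k)" for m
    using mult_left_mono[OF le[of m], of "cmod c"] by (simp add: norm_mult mult.assoc)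
  then show ?thesis
    using x unfolding exp_decay_def by blast
qed

lemma exp_decay_add: "exp_decay \<phi> \<Longrightarrow> exp_decay \<xi> \<Longrightarrow> exp_decay (\<lambda>m. \<phi> m + \<xi> m)"
proof -
  assume "exp_decay \<phi>" "exp_decay \<xi>"
  then obtain C x D y where x: "0 < x" "x < 1" and C: "\<And>m. cmod (\<phi> m) \<le> C * x ^ (\<Sum>k\<in>UNIV. m k)"
    and y: "0 < y" "y < 1" and D: "\<And>m. cmod (\<xi> m) \<le> D * y ^ (\<Sum>k\<in>UNIV. m k)"
    unfolding exp_decay_def by blast
  have "cmod (\<phi> m + \<xi> m) \<le> (\<bar>C\<bar> + \<bar>D\<bar>) * max x y ^ (\<Sum>k\<in>UNIV. m k)" for m
  proof -
    let ?d = "\<Sum>k\<in>UNIV. m k"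
    have "cmod (\<phi> m) \<le> \<bar>C\<bar> * x ^ ?d" "cmod (\<xi> m) \<le> \<bar>D\<bar> * y ^ ?d"
      using x y by (auto intro!: order_trans[OF C] order_trans[OF D] mult_right_mono)
    moreover have "\<bar>C\<bar> * x ^ ?d \<le> \<bar>C\<bar> * max x y ^ ?d" "\<bar>D\<bar> * y ^ ?d \<le> \<bar>D\<bar> * max x y ^ ?d"
      using x y by (auto intro!: mult_left_mono power_mono)
    ultimately have "cmod (\<phi> m) + cmod (\<xi> m) \<le> (\<bar>C\<bar> + \<bar>D\<bar>) * max x y ^ ?d"
      by (simp add: distrib_right)
    then show ?thesis
      by (rule order_trans[OF norm_triangle_ineq])
  qed
  moreover have "0 < max x y" "max x y < 1"
    using x y by auto
  ultimately show ?thesis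
    unfolding exp_decay_def by blast
qed

text \<open>With \<open>y = sqrt x\<close> the decay splits into two powers of \<open>y\<close>: one
  absorbs the linear factor, since \<open>n * y ^ n\<close> is bounded, and the other
  remains.\<close>

lemma exp_decay_weighted:
  assumes x: "0 < x" "x < 1" and C: "0 \<le> C"
    and le: "\<And>m. cmod (\<phi> m) \<le> C * (real (\<Sum>k\<in>UNIV. m k) + 1) * x ^ (\<Sum>k\<in>UNIV. m k)"
  shows "exp_decay \<phi>"
proof -
  define y where "y = sqrt x"
  have y: "0 < y" "y < 1" "x = y * y"
    using x by (auto simp: y_def)
  have lim: "(\<lambda>n. real n * y ^ n) \<longlonglongrightarrow> 0"
    using y by (intro powser_times_n_limit_0) auto
  obtain B where B: "\<And>n. norm (real n * y ^ n) \<le> B"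
    by (rule BseqE[OF convergent_imp_Bseq[OF convergentI[OF lim]]]) blast
  have "cmod (\<phi> m) \<le> (C * (B + 1)) * y ^ (\<Sum>k\<in>UNIV. m k)" for m
  proof -
    let ?d = "\<Sum>k\<in>UNIV. m k"
    have "(real ?d + 1) * y ^ ?d \<le> B + 1"
      using B[of ?d] power_le_one[of y ?d] y by (simp add: distrib_right)
    then have "C * ((real ?d + 1) * y ^ ?d) * y ^ ?d \<le> C * (B + 1) * y ^ ?d"
      using y C by (intro mult_right_mono mult_left_mono) auto
    then show ?thesis
      using le[of m] by (simp add: y(3) power_mult_distrib mult_ac)
  qed
  then show ?thesis
    using y unfolding exp_decay_def by blast
qed

lemma sum_upd:
  fixes m :: "'n::finite \<Rightarrow> nat"
  shows "(\<Sum>i\<in>UNIV. (m(k := n)) i) + m k = (\<Sum>i\<in>UNIV. m i) + n"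
proof -
  have "(\<Sum>i\<in>UNIV. (m(k := n)) i) = n + (\<Sum>i\<in>UNIV - {k}. m i)"
    by (subst sum.remove[of _ k]) (auto intro: sum.cong)
  moreover have "(\<Sum>i\<in>UNIV. m i) = m k + (\<Sum>i\<in>UNIV - {k}. m i)"
    by (rule sum.remove) auto
  ultimately show ?thesis by simp
qed

lemma sqrt_le_sum:
  fixes m :: "'n::finite \<Rightarrow> nat"
  shows "sqrt (real (m k + 1)) \<le> real (\<Sum>i\<in>UNIV. m i) + 1"
proof -
  have "m k \<le> (\<Sum>i\<in>UNIV. m i)"
    by (rule member_le_sum) auto
  moreover have "sqrt (real (m k + 1)) \<le> real (m k + 1)"
    by (rule real_le_lsqrt) (auto simp: power2_eq_square)
  ultimately show ?thesis
    unfolding of_nat_add of_nat_1 by linarith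
qed

lemma exp_decay_annih:
  assumes "exp_decay \<phi>"
  shows "exp_decay (annih k \<phi>)"
proof -
  obtain C x where x: "0 < x" "x < 1" and le: "\<And>m. cmod (\<phi> m) \<le> C * x ^ (\<Sum>k\<in>UNIV. m k)"
    using assms unfolding exp_decay_def by blast
  have C: "0 \<le> C"
    using order_trans[OF norm_ge_zero le[of "\<lambda>_. 0"]] by simp
  show ?thesis
  proof (rule exp_decay_weighted[OF x, of "C * x"])
    fix m :: "'a \<Rightarrow> nat"
    let ?d = "\<Sum>k\<in>UNIV. m k"
    have d: "(\<Sum>i\<in>UNIV. (m(k := m k + 1)) i) = Suc ?d"
      using sum_upd[of m k "m k + 1"] by simp
    have "cmod (annih k \<phi> m) = sqrt (real (m k + 1)) * cmod (\<phi> (m(k := m k + 1)))"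
      by (simp add: annih_def norm_mult)
    also have "\<dots> \<le> (real ?d + 1) * (C * x ^ Suc ?d)"
      using le[of "m(k := m k + 1)"] unfolding d by (intro mult_mono sqrt_le_sum) (auto simp del: of_nat_sum)
    finally show "cmod (annih k \<phi> m) \<le> C * x * (real ?d + 1) * x ^ ?d"
      by (simp add: mult_ac)
  qed (use x C in auto)
qed

lemma exp_decay_creat:
  assumes "exp_decay \<phi>"
  shows "exp_decay (creat k \<phi>)"
proof -
  obtain C x where x: "0 < x" "x < 1" and le: "\<And>m. cmod (\<phi> m) \<le> C * x ^ (\<Sum>k\<in>UNIV. m k)"
    using assms unfolding exp_decay_def by blast
  have C: "0 \<le> C"
    using order_trans[OF norm_ge_zero le[of "\<lambda>_. 0"]] by simp
  show ?thesis
  proof (rule exp_decay_weighted[OF x, of "C / x"])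
    fix m :: "'a \<Rightarrow> nat"
    let ?d = "\<Sum>k\<in>UNIV. m k"
    show "cmod (creat k \<phi> m) \<le> C / x * (real ?d + 1) * x ^ ?d"
    proof (cases "m k")
      case 0
      then show ?thesis
        using x C by (simp add: creat_def del: of_nat_sum)
    next
      case (Suc n)
      let ?m = "m(k := n)"
      have d: "?d = Suc (\<Sum>i\<in>UNIV. ?m i)"
        using sum_upd[of m k n] Suc by simp
      have "cmod (creat k \<phi> m) = sqrt (real (?m k + 1)) * cmod (\<phi> ?m)"
        by (simp add: creat_def norm_mult Suc)
      also have "\<dots> \<le> (real (\<Sum>i\<in>UNIV. ?m i) + 1) * (C * x ^ (\<Sum>i\<in>UNIV. ?m i))"
        by (intro mult_mono sqrt_le_sum le) (auto simp del: of_nat_sum)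
      also have "\<dots> \<le> (real ?d + 1) * (C * x ^ (\<Sum>i\<in>UNIV. ?m i))"
        unfolding d using x C by (intro mult_right_mono) auto
      also have "\<dots> = C / x * (real ?d + 1) * x ^ ?d"
        unfolding d using x by (simp add: mult_ac)
      finally show ?thesis .
    qed
  qed (use x C in auto)
qed

section \<open>Ladder matrices and the growth of the squeezing generator\<close>

text \<open>Matrix of the \<open>d\<close>-th power of annihilation: row \<open>p\<close> reads the
  amplitude with \<open>d\<close> quanta more, and \<open>pochhammer\<close> is the product of
  \<open>p k + 1\<close> up to \<open>p k + d\<close>. The squeezing generator uses
  \<open>d = 2\<close>, the quadratures \<open>d = 1\<close>.\<close>

definition ladder_up :: "'n \<Rightarrow> nat \<Rightarrow> ('n \<Rightarrow> nat) \<Rightarrow> ('n \<Rightarrow> nat) \<Rightarrow> real" where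
  "ladder_up k d p q = (if q = p(k := p k + d) then sqrt (pochhammer (real (p k + 1)) d) else 0)"

definition ladder_down :: "'n \<Rightarrow> nat \<Rightarrow> ('n \<Rightarrow> nat) \<Rightarrow> ('n \<Rightarrow> nat) \<Rightarrow> real" where
  "ladder_down k d p q = (if d \<le> p k \<and> q = p(k := p k - d) then sqrt (pochhammer (real (p k - d + 1)) d) else 0)"

lemma ladder_transpose: "ladder_down k d q p = ladder_up k d p q"
proof -
  have "d \<le> q k \<and> p = q(k := q k - d) \<longleftrightarrow> q = p(k := p k + d)"
    by (auto simp: fun_eq_iff)
  then show ?thesis
    by (auto simp: ladder_down_def ladder_up_def)
qed

text \<open>For \<open>p k < d\<close> the truncated difference yields an index where the matrices
  built from these ladders have entry zero; the two members are distinct whenever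
  \<open>0 < d\<close>.\<close>

definition neighbours :: "'n \<Rightarrow> nat \<Rightarrow> ('n \<Rightarrow> nat) \<Rightarrow> ('n \<Rightarrow> nat) set" where
  "neighbours k d p = {p(k := p k + d), p(k := p k - d)}"

lemma upd_add_neq_upd_diff:
  fixes p :: "'n \<Rightarrow> nat"
  assumes "0 < d"
  shows "p(k := p k + d) \<noteq> p(k := p k - d)"
proof
  assume "p(k := p k + d) = p(k := p k - d)"
  from fun_cong[OF this, of k] show False
    using assms by simp
qed

lemma sum_neighbours:
  "0 < d \<Longrightarrow> (\<Sum>q\<in>neighbours k d p. f q) = f (p(k := p k + d)) + f (p(k := p k - d))"
  using upd_add_neq_upd_diff[of d p k] by (simp add: neighbours_def)

definition squeeze_matrix :: "'n \<Rightarrow> real \<Rightarrow> ('n \<Rightarrow> nat) \<Rightarrow> ('n \<Rightarrow> nat) \<Rightarrow> real" where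
  "squeeze_matrix j s p q = s / 2 * (ladder_up j 2 p q - ladder_down j 2 p q)"

lemma pochhammer_2: "pochhammer x 2 = x * (x + 1)"
  by (simp add: numeral_2_eq_2 pochhammer_Suc)

lemma squeeze_matrix_values:
  "squeeze_matrix j s p (p(j := p j + 2)) = s / 2 * (sqrt (real (p j + 1)) * sqrt (real (p j + 2)))"
  "squeeze_matrix j s p (p(j := p j - 2)) = - (s / 2) * (sqrt (real (p j)) * sqrt (real (p j - 1)))"
proof -
  note ne = upd_add_neq_upd_diff[of 2 p j, OF zero_less_numeral] not_sym[OF upd_add_neq_upd_diff[of 2 p j, OF zero_less_numeral]]
  show "squeeze_matrix j s p (p(j := p j + 2)) = s / 2 * (sqrt (real (p j + 1)) * sqrt (real (p j + 2)))"
    using ne by (simp add: squeeze_matrix_def ladder_up_def ladder_down_def pochhammer_2 real_sqrt_mult add_ac)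
  show "squeeze_matrix j s p (p(j := p j - 2)) = - (s / 2) * (sqrt (real (p j)) * sqrt (real (p j - 1)))"
  proof (cases "2 \<le> p j")
    case True
    then have "real (p j - 2 + 1) = real (p j - 1)" "real (p j - 1) + 1 = real (p j)"
      by (auto simp: of_nat_diff)
    then show ?thesis
      using ne True unfolding squeeze_matrix_def ladder_up_def ladder_down_def pochhammer_2
      by (simp add: real_sqrt_mult mult_ac)
  next
    \<comment> \<open>With fewer than two quanta the right-hand side vanishes by itself: through
      \<open>sqrt 0\<close> at occupation 0 and through \<open>real (1 - 1)\<close> at occupation
      1.\<close>
    case False
    then have "p j = 0 \<or> p j = 1" by auto
    then show ?thesis
      using ne by (auto simp: squeeze_matrix_def ladder_up_def ladder_down_def)
  qed
qed

lemma abs_squeeze_matrix_sum: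
  "(\<Sum>l\<in>neighbours j 2 p. \<bar>squeeze_matrix j s p l\<bar>) \<le> \<bar>s\<bar> * (real (p j) + 1)"
proof -
  have up: "sqrt (real (p j + 1)) * sqrt (real (p j + 2)) \<le> real (p j) + 2"
    unfolding real_sqrt_mult[symmetric] by (rule real_le_lsqrt) (auto simp: power2_eq_square algebra_simps)
  have "real (p j - 1) \<le> real (p j)"
    by simp
  then have down: "sqrt (real (p j)) * sqrt (real (p j - 1)) \<le> real (p j)"
    unfolding real_sqrt_mult[symmetric] by (intro real_le_lsqrt) (auto simp: power2_eq_square intro: mult_left_mono)
  have "(\<Sum>l\<in>neighbours j 2 p. \<bar>squeeze_matrix j s p l\<bar>) =
      \<bar>s\<bar> / 2 * (sqrt (real (p j + 1)) * sqrt (real (p j + 2))) + \<bar>s\<bar> / 2 * (sqrt (real (p j)) * sqrt (real (p j - 1)))"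
    unfolding sum_neighbours[OF zero_less_numeral] squeeze_matrix_values by (simp add: abs_mult)
  also have "\<dots> \<le> \<bar>s\<bar> / 2 * (real (p j) + 2) + \<bar>s\<bar> / 2 * real (p j)"
    by (intro add_mono mult_left_mono up down) auto
  also have "\<dots> = \<bar>s\<bar> * (real (p j) + 1)"
    by (simp add: algebra_simps)
  finally show ?thesis .
qed

text \<open>Each factor raises the occupation of mode \<open>j\<close> by at most 2, so factor
  number \<open>i\<close> meets a row with absolute sum at most
  \<open>\<bar>s\<bar> * (p j + 2 * i + 1)\<close>.\<close>

lemma squeeze_row_sum:
  assumes "finite Q"
  shows "(\<Sum>q\<in>Q. mpow (\<lambda>p q. \<bar>squeeze_matrix j s p q\<bar>) (neighbours j 2) k p q) \<le>
    \<bar>s\<bar> ^ k * (\<Prod>i<k. real (p j + 2 * i + 1))"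
proof (induction k arbitrary: p)
  case 0
  have "(\<Sum>q\<in>Q. if p = q then 1 else 0 :: real) \<le> 1"
    using assms by (simp add: sum.delta)
  then show ?case by simp
next
  case (Suc k)
  let ?a = "\<lambda>p q. \<bar>squeeze_matrix j s p q\<bar>"
  have "(\<Sum>q\<in>Q. mpow ?a (neighbours j 2) (Suc k) p q) =
      (\<Sum>l\<in>neighbours j 2 p. ?a p l * (\<Sum>q\<in>Q. mpow ?a (neighbours j 2) k l q))"
    by (simp add: sum_distrib_left sum.swap[of _ Q])
  also have "\<dots> \<le> (\<Sum>l\<in>neighbours j 2 p. ?a p l * (\<bar>s\<bar> ^ k * (\<Prod>i<k. real (p j + 2 + 2 * i + 1))))"
  proof (intro sum_mono mult_left_mono order_trans[OF Suc.IH] prod_mono)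
    fix l i assume "l \<in> neighbours j 2 p"
    then have "l j \<le> p j + 2"
      by (auto simp: neighbours_def)
    then show "0 \<le> real (l j + 2 * i + 1) \<and> real (l j + 2 * i + 1) \<le> real (p j + 2 + 2 * i + 1)"
      by simp
  qed auto
  also have "\<dots> = (\<Sum>l\<in>neighbours j 2 p. ?a p l) * (\<bar>s\<bar> ^ k * (\<Prod>i<k. real (p j + 2 + 2 * i + 1)))"
    by (simp only: sum_distrib_right)
  also have "\<dots> \<le> (\<bar>s\<bar> * (real (p j) + 1)) * (\<bar>s\<bar> ^ k * (\<Prod>i<k. real (p j + 2 + 2 * i + 1)))"
    by (intro mult_right_mono abs_squeeze_matrix_sum mult_nonneg_nonneg prod_nonneg) auto
  also have "\<dots> = \<bar>s\<bar> ^ Suc k * (\<Prod>i<Suc k. real (p j + 2 * i + 1))"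
    unfolding prod.lessThan_Suc_shift by (simp add: add_ac)
  finally show ?case .
qed

text \<open>Source of the constants \<open>2 ^ p j\<close> and 4 in the growth bound. The product is
  compared with \<open>2 ^ k * fact (n + k) / fact n\<close>, and the binomial coefficient left
  after splitting off \<open>fact k\<close> is at most \<open>2 ^ (n + k)\<close>.\<close>

lemma double_step_prod_le: "(\<Prod>i<k. real (n + 2 * i + 1)) \<le> 2 ^ n * 4 ^ k * fact k"
proof -
  have "(\<Prod>i<k. real (n + 2 * i + 1)) * fact n \<le> 2 ^ k * fact (n + k)"
  proof (induction k)
    case (Suc k)
    have "(\<Prod>i<Suc k. real (n + 2 * i + 1)) * fact n =
        ((\<Prod>i<k. real (n + 2 * i + 1)) * fact n) * real (n + 2 * k + 1)"
      by simp
    also have "\<dots> \<le> (2 ^ k * fact (n + k)) * (2 * real (n + k + 1))"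
      by (intro mult_mono Suc.IH) auto
    also have "\<dots> = 2 ^ Suc k * fact (n + Suc k)"
      by (simp add: algebra_simps)
    finally show ?case .
  qed simp
  also have "fact (n + k) = real ((n + k) choose k) * fact k * fact n"
    using binomial_fact[of k "n + k", where ?'a = real] by (simp add: field_simps)
  also have "2 ^ k * (real ((n + k) choose k) * fact k * fact n) \<le> 2 ^ k * (2 ^ (n + k) * fact k * fact n)"
  proof (intro mult_left_mono mult_right_mono)
    have "real ((n + k) choose k) \<le> real (2 ^ (n + k))"
      unfolding of_nat_le_iff by (rule binomial_le_pow2)
    then show "real ((n + k) choose k) \<le> 2 ^ (n + k)" by simp
  qed auto
  also have "\<dots> = (2 ^ n * 4 ^ k * fact k) * fact n"
    by (simp add: power_add power_mult_distrib[symmetric] mult_ac)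
  finally show ?thesis
    by simp
qed

text \<open>The added 1 keeps the growth rate positive for \<open>s = 0\<close>.\<close>

lemma fock_skew_squeeze:
  "fock_skew (squeeze_matrix j s) (neighbours j 2) (\<lambda>p. 2 ^ p j) (4 * (\<bar>s\<bar> + 1))"
proof unfold_locales
  show "finite (neighbours j 2 p)" for p
    by (simp add: neighbours_def)
  show "q \<notin> neighbours j 2 p \<Longrightarrow> squeeze_matrix j s p q = 0" for p q
    by (auto simp: neighbours_def squeeze_matrix_def ladder_up_def ladder_down_def)
  show "squeeze_matrix j s q p = - squeeze_matrix j s p q" for p q
    unfolding squeeze_matrix_def ladder_transpose[of j 2 q p] ladder_transpose[of j 2 p q, symmetric]
    by (simp add: algebra_simps)
  fix Q :: "('a \<Rightarrow> nat) set" and k p assume Q: "finite Q"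
  have "(\<Sum>q\<in>Q. mpow (\<lambda>p q. \<bar>squeeze_matrix j s p q\<bar>) (neighbours j 2) k p q) \<le>
      \<bar>s\<bar> ^ k * (2 ^ p j * 4 ^ k * fact k)"
    by (rule order_trans[OF squeeze_row_sum[OF Q]]) (intro mult_left_mono double_step_prod_le, simp)
  also have "\<dots> = 2 ^ p j * (4 * \<bar>s\<bar>) ^ k * fact k"
    by (simp add: power_mult_distrib)
  also have "\<dots> \<le> 2 ^ p j * (4 * (\<bar>s\<bar> + 1)) ^ k * fact k"
    by (intro mult_right_mono mult_left_mono power_mono) auto
  finally show "(\<Sum>q\<in>Q. mpow (\<lambda>p q. \<bar>squeeze_matrix j s p q\<bar>) (neighbours j 2) k p q) \<le>
      2 ^ p j * (4 * (\<bar>s\<bar> + 1)) ^ k * fact k" .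
qed auto

section \<open>Quadratures and squeezed states\<close>

text \<open>Up to scalar factors, position for \<open>sg = 1\<close> and momentum for
  \<open>sg = -1\<close>. These combinations diagonalise the commutator with the squeezing
  generator.\<close>

definition quadrature :: "'n \<Rightarrow> complex \<Rightarrow> 'n fock \<Rightarrow> 'n fock" where
  "quadrature k sg \<phi> = (\<lambda>m. annih k \<phi> m + sg * creat k \<phi> m)"

definition quadrature_matrix :: "'n \<Rightarrow> complex \<Rightarrow> ('n \<Rightarrow> nat) \<Rightarrow> ('n \<Rightarrow> nat) \<Rightarrow> complex" where
  "quadrature_matrix k sg p q = of_real (ladder_up k 1 p q) + sg * of_real (ladder_down k 1 p q)"

lemma band_op_quadrature: "band_op (quadrature_matrix k sg) (neighbours k 1) = quadrature k sg"
proof (intro ext)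
  fix \<phi> :: "'a fock" and p :: "'a \<Rightarrow> nat"
  note ne = upd_add_neq_upd_diff[of 1 p k, OF zero_less_one] not_sym[OF upd_add_neq_upd_diff[of 1 p k, OF zero_less_one]]
  have "quadrature_matrix k sg p (p(k := p k + 1)) = of_real (sqrt (real (p k + 1)))"
    using ne by (simp add: quadrature_matrix_def ladder_up_def ladder_down_def)
  moreover have "quadrature_matrix k sg p (p(k := p k - 1)) = sg * of_real (sqrt (real (p k)))"
    using ne by (cases "p k") (simp_all add: quadrature_matrix_def ladder_up_def ladder_down_def)
  ultimately show "band_op (quadrature_matrix k sg) (neighbours k 1) \<phi> p = quadrature k sg \<phi> p"
    by (simp add: band_op_def sum_neighbours quadrature_def annih_def creat_def del: One_nat_def)
qed

lemma quadrature_squeeze_comm_same: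
  assumes "sg * sg = 1"
  shows "quadrature k sg (squeeze_generator k s \<phi>) m =
    squeeze_generator k s (quadrature k sg \<phi>) m - sg * of_real s * quadrature k sg \<phi> m"
proof -
  define R where "R n = complex_of_real (sqrt (real n))" for n
  define f where "f n = \<phi> (m(k := n))" for n
  have RR: "R n * (R n * x) = of_nat n * x" for n x
    unfolding R_def mult.assoc[symmetric] of_real_mult[symmetric] by simp
  have q: "quadrature k sg \<xi> p = R (Suc (p k)) * \<xi> (p(k := Suc (p k))) + sg * (R (p k) * \<xi> (p(k := p k - 1)))" for \<xi> p
    by (simp add: quadrature_def annih_def creat_def R_def del: of_nat_Suc)
  define c where "c = complex_of_real (s / 2)"
  have s2: "complex_of_real s = c + c"
    by (simp add: c_def)
  have g: "squeeze_generator k s \<xi> p = c *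
     (R (Suc (p k)) * (R (Suc (Suc (p k))) * \<xi> (p(k := Suc (Suc (p k))))) -
      R (p k) * (R (p k - 1) * \<xi> (p(k := p k - 1 - 1))))" for \<xi> p
    by (simp add: squeeze_generator_def annih_def creat_def R_def c_def del: of_nat_Suc)
  have sg2: "sg * (sg * x) = x" for x
    using assms by (simp flip: mult.assoc)
  have [simp]: "R 0 = 0" by (simp add: R_def)
  show ?thesis
  \<comment> \<open>Occupations 0 and 1 are treated separately because of the truncated subtraction
    in \<open>creat\<close>.\<close>
  proof (cases "m k")
    case 0
    show ?thesis
      by (simp add: q g s2 0 RR sg2 algebra_simps)
  next
    case (Suc n)
    show ?thesis
      by (cases n) (simp_all add: q g s2 Suc RR sg2 algebra_simps)
  qed
qed

lemma quadrature_squeeze_comm_other: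
  assumes "k \<noteq> j"
  shows "quadrature k sg (squeeze_generator j s \<phi>) m = squeeze_generator j s (quadrature k sg \<phi>) m"
  using assms by (simp add: quadrature_def squeeze_generator_def annih_def creat_def
      fun_upd_twist[OF assms] algebra_simps)

text \<open>The decay of \<open>\<phi>\<close> makes the annihilation and creation parts summable
  separately against any Fock vector, so they may be transposed one by one. This exchanges them, and
  \<open>sg * sg = 1\<close> restores the same combination up to \<open>sg\<close>.\<close>

lemma quadrature_adjoint:
  fixes \<phi> :: "'n::finite fock"
  assumes sg: "sg * sg = 1" and \<phi>: "exp_decay \<phi>" and v: "v \<in> fock_space"
  shows "(\<Sum>\<^sub>\<infinity>q. v q * quadrature k sg \<phi> q) = sg * (\<Sum>\<^sub>\<infinity>q. quadrature k sg v q * \<phi> q)"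
proof -
  have sm: "(\<lambda>q. v q * annih k \<phi> q) summable_on UNIV" "(\<lambda>q. v q * creat k \<phi> q) summable_on UNIV"
    by (rule Infinite_Sum.abs_summable_summable, rule fock_Cauchy_Schwarz(1)[OF v];
        intro exp_decay_fock exp_decay_annih exp_decay_creat \<phi>)+
  have sm': "(\<lambda>q. creat k v q * \<phi> q) summable_on UNIV" "(\<lambda>q. annih k v q * \<phi> q) summable_on UNIV"
    using sm summable_annih_iff[of v k \<phi>] summable_annih_iff[of \<phi> k v] by (simp_all add: mult.commute)
  have "(\<Sum>\<^sub>\<infinity>q. v q * quadrature k sg \<phi> q) = (\<Sum>\<^sub>\<infinity>q. v q * annih k \<phi> q + sg * (v q * creat k \<phi> q))"
    by (simp add: quadrature_def algebra_simps)
  also have "\<dots> = (\<Sum>\<^sub>\<infinity>q. v q * annih k \<phi> q) + sg * (\<Sum>\<^sub>\<infinity>q. v q * creat k \<phi> q)"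
    using sm by (simp add: infsum_add infsum_cmult_right summable_on_cmult_right)
  also have "\<dots> = sg * ((\<Sum>\<^sub>\<infinity>q. annih k v q * \<phi> q) + sg * (\<Sum>\<^sub>\<infinity>q. creat k v q * \<phi> q))"
    using sg by (simp add: infsum_annih infsum_creat distrib_left flip: mult.assoc)
  also have "(\<Sum>\<^sub>\<infinity>q. annih k v q * \<phi> q) + sg * (\<Sum>\<^sub>\<infinity>q. creat k v q * \<phi> q) =
      (\<Sum>\<^sub>\<infinity>q. annih k v q * \<phi> q + sg * (creat k v q * \<phi> q))"
    using sm' by (simp add: infsum_add infsum_cmult_right summable_on_cmult_right)
  also have "\<dots> = (\<Sum>\<^sub>\<infinity>q. quadrature k sg v q * \<phi> q)"
    by (simp add: quadrature_def algebra_simps)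
  finally show ?thesis .
qed

text \<open>
  Equivalently, \<open>cosh (\<rho> k) a\<^sub>k + sinh (\<rho> k) a\<^sub>k\<^sup>\<dagger>\<close> annihilates \<open>\<phi>\<close> for every mode \<open>k\<close>.
\<close>

definition squeezed :: "('n \<Rightarrow> real) \<Rightarrow> 'n fock \<Rightarrow> bool" where
  "squeezed \<rho> \<phi> \<longleftrightarrow> (\<forall>k m. quadrature k (-1) \<phi> m = - exp (of_real (2 * \<rho> k)) * quadrature k 1 \<phi> m)"

text \<open>Solving the quadrature relation for \<open>annih\<close> gives, up to sign, the factor
  \<open>(E - 1) / (E + 1)\<close> with \<open>E = exp (2 * \<rho> k)\<close>.\<close>

lemma squeezed_annih:
  assumes "squeezed \<rho> \<phi>"
  shows "annih k \<phi> m = - of_real (tanh (\<rho> k)) * creat k \<phi> m"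
proof -
  define E where "E = exp (2 * \<rho> k)"
  have E: "0 < E" by (simp add: E_def)
  have t: "tanh (\<rho> k) = (E - 1) / (E + 1)"
  proof -
    have "tanh (\<rho> k) = (1 - inverse E) / (1 + inverse E)"
      unfolding tanh_real_altdef E_def by (simp add: exp_minus)
    also have "\<dots> = (E * (1 - inverse E)) / (E * (1 + inverse E))"
      using E by simp
    also have "\<dots> = (E - 1) / (E + 1)"
      using E by (simp only: right_diff_distrib distrib_left) simp
    finally show ?thesis .
  qed
  have e: "exp (of_real (2 * \<rho> k)) = complex_of_real E"
    by (simp only: E_def exp_of_real)
  have "annih k \<phi> m - creat k \<phi> m = - of_real E * (annih k \<phi> m + creat k \<phi> m)"
    using assms[unfolded squeezed_def, rule_format, of k m] unfolding e by (simp add: quadrature_def)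
  then have "of_real (E + 1) * annih k \<phi> m = - of_real (E - 1) * creat k \<phi> m"
    by (simp add: algebra_simps)
  moreover have "complex_of_real (E + 1) \<noteq> 0"
    unfolding of_real_eq_0_iff using E by simp
  ultimately show ?thesis
    unfolding t of_real_divide by (simp add: field_simps del: of_real_add of_real_diff)
qed

lemma squeezed_step:
  assumes "squeezed \<rho> \<phi>"
  shows "of_real (sqrt (real (n + 1))) * \<phi> (m(k := n + 1)) =
    - of_real (tanh (\<rho> k)) * (of_real (sqrt (real n)) * \<phi> (m(k := n - 1)))"
  using squeezed_annih[OF assms, of k "m(k := n)"] by (simp add: annih_def creat_def)

text \<open>Two quanta in one mode cost a factor below 1: both
  \<open>\<bar>tanh (\<rho> k)\<bar>\<close> and the quotient of the square roots are below 1. The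
  descent ends at the vacuum amplitude. As a factor \<open>y\<close> pays for two quanta, the base
  is \<open>sqrt y\<close>.\<close>

lemma squeezed_bound:
  fixes \<phi> :: "'n::finite fock"
  assumes "squeezed \<rho> \<phi>"
  shows "\<exists>x. 0 < x \<and> x < 1 \<and> (\<forall>m. cmod (\<phi> m) \<le> cmod (\<phi> (\<lambda>_. 0)) * x ^ (\<Sum>k\<in>UNIV. m k))"
proof -
  \<comment> \<open>The element 1/2 keeps \<open>y\<close>, hence the base \<open>x\<close>,
    positive when all modes are unsqueezed.\<close>
  define y where "y = Max (insert (1 / 2) (range (\<lambda>k. \<bar>tanh (\<rho> k)\<bar>)))"
  have y: "1 / 2 \<le> y" "\<bar>tanh (\<rho> k)\<bar> \<le> y" for k
    unfolding y_def by (rule Max_ge; simp)+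
  have y1: "y < 1"
    unfolding y_def by (subst Max_less_iff) (auto simp: abs_less_iff tanh_real_lt_1 tanh_real_gt_neg1 minus_less_iff[of _ 1])
  define x where "x = sqrt y"
  have x: "0 < x" "x < 1" "x * x = y"
    using y(1) y1 by (auto simp: x_def)
  have "cmod (\<phi> m) \<le> cmod (\<phi> (\<lambda>_. 0)) * x ^ (\<Sum>k\<in>UNIV. m k)" for m
  proof (induction "\<Sum>k\<in>UNIV. m k" arbitrary: m rule: less_induct)
    case less
    show ?case
    proof (cases "m = (\<lambda>_. 0)")
      case False
      then obtain k where k: "m k \<noteq> 0"
        by auto
      show ?thesis
      proof (cases "m k = 1")
        case True
        \<comment> \<open>At \<open>n = 0\<close> the recursion has zero on the right, so a single
          quantum carries no amplitude.\<close>
        then have "\<phi> m = 0"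
          using squeezed_step[OF assms, of 0 m k] fun_upd_triv[of m k] by simp
        then show ?thesis
          using x by simp
      next
        case False
        then obtain n where n: "m k = n + 2"
          using k by (metis Suc_1 add_2_eq_Suc' not0_implies_Suc One_nat_def)
        let ?m = "m(k := n)"
        have sum: "(\<Sum>i\<in>UNIV. m i) = (\<Sum>i\<in>UNIV. ?m i) + 2"
          using sum_upd[of m k n] n by simp
        have mk: "m(k := n + 1 + 1) = m"
          using n fun_upd_triv[of m k] by simp
        have "sqrt (real (n + 2)) * cmod (\<phi> m) = \<bar>tanh (\<rho> k)\<bar> * (sqrt (real (n + 1)) * cmod (\<phi> ?m))"
          using arg_cong[OF squeezed_step[OF assms, of "n + 1" m k], of cmod] unfolding mk
          by (simp add: norm_mult add_ac)
        also have "\<dots> \<le> y * (sqrt (real (n + 2)) * cmod (\<phi> ?m))"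
          using y(1) by (intro mult_mono y(2) mult_right_mono) auto
        finally have "cmod (\<phi> m) \<le> y * cmod (\<phi> ?m)"
          by (simp add: mult.left_commute)
        also have "\<dots> \<le> y * (cmod (\<phi> (\<lambda>_. 0)) * x ^ (\<Sum>i\<in>UNIV. ?m i))"
          using y(1) sum by (intro mult_left_mono less) auto
        also have "\<dots> = cmod (\<phi> (\<lambda>_. 0)) * x ^ (\<Sum>i\<in>UNIV. m i)"
          unfolding sum x(3)[symmetric] by (simp add: power_add power2_eq_square)
        finally show ?thesis .
      qed
    qed simp
  qed
  then show ?thesis
    using x by blast
qed

lemma squeezed_exp_decay: "squeezed \<rho> \<phi> \<Longrightarrow> exp_decay \<phi>"
  unfolding exp_decay_def using squeezed_bound by blast

text \<open>A short step multiplies the two quadratures of mode \<open>j\<close> by inverse factors,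
  so their ratio changes by \<open>exp (2 * s / n)\<close>. Every intermediate state is squeezed
  again, which supplies the decay needed to transport the quadratures in the next step.\<close>

lemma squeeze_op_exp:
  fixes \<phi> :: "'n::finite fock"
  assumes \<phi>: "squeezed \<rho> \<phi>"
  shows "squeezed (\<rho>(j := \<rho> j + s)) (op_exp (squeeze_generator j s) \<phi>)"
    and "fock_norm (op_exp (squeeze_generator j s) \<phi>) = fock_norm \<phi>"
proof -
  interpret fock_skew "squeeze_matrix j s" "neighbours j 2" "\<lambda>p. 2 ^ p j" "4 * (\<bar>s\<bar> + 1)"
    by (rule fock_skew_squeeze)
  have gen: "squeeze_generator j s = gen_op"
    unfolding gen_op_def sum_neighbours[OF zero_less_numeral] squeeze_matrix_values
    by (simp add: fun_eq_iff squeeze_generator_def annih_def creat_def algebra_simps numeral_2_eq_2)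
  \<comment> \<open>With growth rate \<open>4 * (\<bar>s\<bar> + 1)\<close> this is the smallness
    condition for unitarity of the step \<open>1 / n\<close>.\<close>
  obtain n where n: "16 * (\<bar>s\<bar> + 1) < real n"
    using reals_Archimedean2 by blast
  then have n0: "0 < n"
    by (cases n) auto
  have small: "4 * \<bar>1 / real n\<bar> * (4 * (\<bar>s\<bar> + 1)) < 1"
    using n n0 by (simp add: field_simps)
  have small1: "\<bar>1 / real n\<bar> * (4 * (\<bar>s\<bar> + 1)) < 1"
    by (rule small_mono[OF small]) (simp add: divide_right_mono)
  have step: "quadrature k sg (exp_op (1 / real n) \<psi>) m =
      exp (- (if k = j then sg * of_real (s / real n) else 0)) * exp_op (1 / real n) (quadrature k sg \<psi>) m"
    if \<psi>: "squeezed \<rho>' \<psi>" and sg: "sg \<in> {1, - 1}" for \<rho>' \<psi> k m and sg :: complex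
  proof -
    define lam where "lam = (if k = j then - Re sg * s else 0)"
    have sg': "sg * sg = 1" "sg = of_real (Re sg)"
      using sg by auto
    have ed: "exp_decay \<psi>"
      by (rule squeezed_exp_decay[OF \<psi>])
    have "band_op (quadrature_matrix k sg) (neighbours k 1) (exp_op (1 / real n) \<psi>) m =
      exp (of_real (1 / real n * lam)) * exp_op (1 / real n) (band_op (quadrature_matrix k sg) (neighbours k 1) \<psi>) m"
    proof (rule band_op_exp_op[OF _ _ _ _ sg'(1) small1 exp_decay_fock[OF ed]])
      show "band_op (quadrature_matrix k sg) (neighbours k 1) (gen_op \<xi>) p =
          gen_op (band_op (quadrature_matrix k sg) (neighbours k 1) \<xi>) p +
          of_real lam * band_op (quadrature_matrix k sg) (neighbours k 1) \<xi> p" for \<xi> p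
        unfolding band_op_quadrature gen[symmetric] lam_def
        using quadrature_squeeze_comm_same[OF sg'(1), of j s \<xi> p] quadrature_squeeze_comm_other[of k j sg s \<xi> p] sg'(2)
        by (auto simp del: One_nat_def)
      show "finite (neighbours k 1 p)" for p
        by (simp add: neighbours_def)
      show "q \<notin> neighbours k 1 p \<Longrightarrow> quadrature_matrix k sg p q = 0" for p q
        by (auto simp: neighbours_def quadrature_matrix_def ladder_up_def ladder_down_def)
      show "quadrature_matrix k sg q p = sg * quadrature_matrix k sg p q" for p q
        unfolding quadrature_matrix_def ladder_transpose[of k 1 q p] ladder_transpose[of k 1 p q, symmetric]
        using sg' by (simp add: distrib_left flip: mult.assoc)
      show "(\<Sum>\<^sub>\<infinity>q. v q * band_op (quadrature_matrix k sg) (neighbours k 1) \<psi> q) =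
          sg * (\<Sum>\<^sub>\<infinity>q. band_op (quadrature_matrix k sg) (neighbours k 1) v q * \<psi> q)" if "v \<in> fock_space" for v
        unfolding band_op_quadrature by (rule quadrature_adjoint[OF sg'(1) ed that])
    qed
    moreover have "complex_of_real (1 / real n * lam) = - (if k = j then sg * of_real (s / real n) else 0)"
      using sg by (auto simp: lam_def)
    ultimately show ?thesis
      unfolding band_op_quadrature by simp
  qed
  have iter: "squeezed (\<rho>(j := \<rho> j + real i * (s / real n))) ((exp_op (1 / real n) ^^ i) \<phi>) \<and>
      fock_norm ((exp_op (1 / real n) ^^ i) \<phi>) = fock_norm \<phi>" for i
  proof (induction i)
    case 0
    then show ?case
      using \<phi> by simp
  next
    case (Suc i)
    define \<psi> where "\<psi> = (exp_op (1 / real n) ^^ i) \<phi>"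
    define \<sigma> where "\<sigma> = \<rho>(j := \<rho> j + real i * (s / real n))"
    have \<psi>: "squeezed \<sigma> \<psi>" and nrm: "fock_norm \<psi> = fock_norm \<phi>"
      using Suc.IH unfolding \<psi>_def \<sigma>_def by blast+
    have fs: "\<psi> \<in> fock_space"
      by (rule exp_decay_fock[OF squeezed_exp_decay[OF \<psi>]])
    have "squeezed (\<sigma>(j := \<sigma> j + s / real n)) (exp_op (1 / real n) \<psi>)"
      unfolding squeezed_def
    proof (intro allI)
      fix k m
      define \<delta> where "\<delta> = complex_of_real (if k = j then s / real n else 0)"
      have "quadrature k (- 1) \<psi> = (\<lambda>m. - exp (of_real (2 * \<sigma> k)) * quadrature k 1 \<psi> m)"
        using \<psi> by (auto simp: squeezed_def)
      then have "exp_op (1 / real n) (quadrature k (- 1) \<psi>) m =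
          - exp (of_real (2 * \<sigma> k)) * exp_op (1 / real n) (quadrature k 1 \<psi>) m"
        by (simp only: exp_op_def infsum_cmult_right' mult.left_commute[of "complex_of_real _" "- exp _"])
      moreover have "quadrature k (- 1) (exp_op (1 / real n) \<psi>) m = exp \<delta> * exp_op (1 / real n) (quadrature k (- 1) \<psi>) m"
        using step[OF \<psi>, of "-1" k m] by (simp add: \<delta>_def)
      moreover have "exp_op (1 / real n) (quadrature k 1 \<psi>) m = exp \<delta> * quadrature k 1 (exp_op (1 / real n) \<psi>) m"
        using step[OF \<psi>, of 1 k m] by (simp add: \<delta>_def flip: mult.assoc exp_add)
      moreover have "exp \<delta> * (exp (of_real (2 * \<sigma> k)) * exp \<delta>) =
          exp (of_real (2 * (\<sigma>(j := \<sigma> j + s / real n)) k))"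
        by (simp add: \<delta>_def algebra_simps flip: exp_add)
      ultimately show "quadrature k (- 1) (exp_op (1 / real n) \<psi>) m =
          - exp (of_real (2 * (\<sigma>(j := \<sigma> j + s / real n)) k)) * quadrature k 1 (exp_op (1 / real n) \<psi>) m"
        by (metis (no_types, lifting) mult.assoc mult_minus_left mult_minus_right)
    qed
    moreover have "\<sigma>(j := \<sigma> j + s / real n) = \<rho>(j := \<rho> j + real (Suc i) * (s / real n))"
      by (simp add: \<sigma>_def algebra_simps add_divide_distrib)
    moreover have "fock_norm (exp_op (1 / real n) \<psi>) = fock_norm \<phi>"
      using unitary_op_norm[OF unitary_exp_op[OF small] fs] nrm by simp
    ultimately show ?case
      by (simp only: funpow.simps o_apply \<psi>_def[symmetric] simp_thms)
  qed
  have eq: "op_exp (squeeze_generator j s) \<phi> = (exp_op (1 / real n) ^^ n) \<phi>"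
    unfolding gen by (rule op_exp_gen_op[OF small n0 exp_decay_fock[OF squeezed_exp_decay[OF \<phi>]]])
  show "squeezed (\<rho>(j := \<rho> j + s)) (op_exp (squeeze_generator j s) \<phi>)"
    "fock_norm (op_exp (squeeze_generator j s) \<phi>) = fock_norm \<phi>"
    unfolding eq using iter[of n] n0 by simp_all
qed

lemma vacuum_basis: "vacuum = basis (\<lambda>_. 0)"
  by (simp add: vacuum_def basis_def)

lemma vacuum_squeezed: "squeezed (\<lambda>_. 0) vacuum"
proof -
  have "annih k vacuum m = 0" for k :: 'a and m
    by (auto simp: annih_def vacuum_def fun_eq_iff)
  then show ?thesis
    by (simp add: squeezed_def quadrature_def)
qed

text \<open>Induction over the factors: each mode occurs once in the list, so its parameter passes
  from 0 to \<open>r $ k\<close> in a single factor.\<close>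

lemma probe_squeezed:
  fixes r :: "real ^ 'n::{finite,linorder}"
  shows "squeezed (\<lambda>k. r $ k) (probe r)" "fock_norm (probe r) = 1"
proof -
  define f where "f xs = foldr (\<lambda>j S. op_exp (squeeze_generator j (r $ j)) \<circ> S) xs id vacuum" for xs
  have f: "squeezed (\<lambda>k. if k \<in> set xs then r $ k else 0) (f xs) \<and> fock_norm (f xs) = 1"
    if "distinct xs" for xs
    using that
  proof (induction xs)
    case Nil
    then show ?case
      using vacuum_squeezed by (simp add: f_def vacuum_basis)
  next
    case (Cons j xs)
    let ?\<rho> = "\<lambda>k. if k \<in> set xs then r $ k else 0"
    have "f (j # xs) = op_exp (squeeze_generator j (r $ j)) (f xs)"
      by (simp add: f_def)
    moreover have "?\<rho>(j := ?\<rho> j + r $ j) = (\<lambda>k. if k \<in> set (j # xs) then r $ k else 0)"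
      using Cons.prems by auto
    ultimately show ?case
      using Cons squeeze_op_exp[of ?\<rho> "f xs" j "r $ j"] by simp
  qed
  have "probe r = f (sorted_list_of_set UNIV)"
    by (simp add: probe_def squeezer_def f_def)
  then show "squeezed (\<lambda>k. r $ k) (probe r)" "fock_norm (probe r) = 1"
    using f[of "sorted_list_of_set UNIV"] by simp_all
qed

section \<open>The passive Fisher matrix\<close>

lemma fock_inner_cnj: "fock_inner \<phi> \<xi> = cnj (fock_inner \<xi> \<phi>)"
  unfolding fock_inner_def infsum_cnj[symmetric] by (simp add: mult.commute)

lemma fock_inner_lin_right:
  assumes "\<phi> \<in> fock_space" "\<xi> \<in> fock_space" "\<eta> \<in> fock_space"
  shows "fock_inner \<phi> (\<lambda>m. c * \<xi> m + \<eta> m) = c * fock_inner \<phi> \<xi> + fock_inner \<phi> \<eta>"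
proof -
  have "((\<lambda>m. c * (cnj (\<phi> m) * \<xi> m) + cnj (\<phi> m) * \<eta> m) has_sum
      (c * fock_inner \<phi> \<xi> + fock_inner \<phi> \<eta>)) UNIV"
    unfolding fock_inner_def
    by (intro has_sum_add has_sum_cmult_right has_sum_infsum fock_inner_summable assms)
  then show ?thesis
    unfolding fock_inner_def[of \<phi> "\<lambda>m. c * \<xi> m + \<eta> m"] by (intro infsumI) (simp add: algebra_simps)
qed

lemma fock_inner_scale_right: "fock_inner \<phi> (\<lambda>m. c * \<xi> m) = c * fock_inner \<phi> \<xi>"
  unfolding fock_inner_def by (simp add: mult.left_commute[of _ c] infsum_cmult_right')

lemma fock_inner_scale_left: "fock_inner (\<lambda>m. c * \<phi> m) \<xi> = cnj c * fock_inner \<phi> \<xi>"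
  by (subst (1 2) fock_inner_cnj) (simp add: fock_inner_scale_right)

lemma fock_inner_lin_left:
  assumes "\<phi> \<in> fock_space" "\<xi> \<in> fock_space" "\<eta> \<in> fock_space"
  shows "fock_inner (\<lambda>m. c * \<xi> m + \<eta> m) \<phi> = cnj c * fock_inner \<xi> \<phi> + fock_inner \<eta> \<phi>"
  unfolding fock_inner_cnj[of _ \<phi>] fock_inner_lin_right[OF assms] by simp

lemma fock_inner_creat: "fock_inner \<phi> (creat j \<xi>) = fock_inner (annih j \<phi>) \<xi>"
  unfolding fock_inner_def infsum_creat by (simp add: annih_def)

lemma fock_inner_annih: "fock_inner \<phi> (annih j \<xi>) = fock_inner (creat j \<phi>) \<xi>"
  unfolding fock_inner_def infsum_annih by (simp add: creat_def)

lemma fock_norm_eq_0: "\<phi> \<in> fock_space \<Longrightarrow> fock_norm \<phi> = 0 \<Longrightarrow> \<phi> m = 0"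
  using cmod_le_fock_norm[of \<phi> m] by simp

text \<open>Symmetry on the decaying vectors together with stability of that domain, so that
  products of two such operators may be applied to the probe.\<close>

definition symmetric_op :: "('n::finite fock \<Rightarrow> 'n fock) \<Rightarrow> bool" where
  "symmetric_op G \<longleftrightarrow> (\<forall>\<phi>. exp_decay \<phi> \<longrightarrow> exp_decay (G \<phi>)) \<and>
    (\<forall>\<phi> \<xi>. exp_decay \<phi> \<longrightarrow> exp_decay \<xi> \<longrightarrow> fock_inner \<phi> (G \<xi>) = fock_inner (G \<phi>) \<xi>)"

lemma exp_decay_hop: "exp_decay \<phi> \<Longrightarrow> exp_decay (creat j (annih k \<phi>))"
  by (intro exp_decay_creat exp_decay_annih)

lemma fock_inner_hop: "fock_inner \<phi> (creat j (annih k \<xi>)) = fock_inner (creat k (annih j \<phi>)) \<xi>"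
  by (simp add: fock_inner_creat fock_inner_annih)

text \<open>One shape for all passive generators: coefficients 1 for X, \<open>- \<i>\<close> and
  \<open>\<i>\<close> for Y, and 1/2 twice for a rotation.\<close>

lemma symmetric_hop_sum:
  assumes "d = cnj c"
  shows "symmetric_op (\<lambda>\<phi> m. c * creat j (annih k \<phi>) m + d * creat k (annih j \<phi>) m)"
  unfolding symmetric_op_def
proof (intro conjI allI impI)
  fix \<phi> :: "'a::finite fock" assume \<phi>: "exp_decay \<phi>"
  show "exp_decay (\<lambda>m. c * creat j (annih k \<phi>) m + d * creat k (annih j \<phi>) m)"
    by (intro exp_decay_add exp_decay_scale exp_decay_hop \<phi>)
  fix \<xi> :: "'a::finite fock" assume \<xi>: "exp_decay \<xi>"
  have fs: "\<phi> \<in> fock_space" "\<xi> \<in> fock_space" "creat j (annih k \<phi>) \<in> fock_space" "creat k (annih j \<phi>) \<in> fock_space"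
    "creat j (annih k \<xi>) \<in> fock_space" "creat k (annih j \<xi>) \<in> fock_space"
    using \<phi> \<xi> by (auto intro: exp_decay_fock exp_decay_hop)
  show "fock_inner \<phi> (\<lambda>m. c * creat j (annih k \<xi>) m + d * creat k (annih j \<xi>) m) =
      fock_inner (\<lambda>m. c * creat j (annih k \<phi>) m + d * creat k (annih j \<phi>) m) \<xi>"
    by (simp add: fock_inner_lin_right fock_inner_lin_left fs fock_scale fock_inner_scale_right
        fock_inner_scale_left fock_inner_hop[of \<phi>] assms)
qed

lemma symmetric_passive: "symmetric_op (passive_generator \<mu>)"
proof -
  obtain j k where \<mu>: "\<mu> = (j, k)" by fastforce
  consider "j = k" | "j < k" | "k < j" by (rule linorder_cases)
  then show ?thesis
  proof cases
    case 1
    have "passive_generator \<mu> = (\<lambda>\<phi> m. (1/2) * creat j (annih j \<phi>) m + (1/2) * creat j (annih j \<phi>) m)"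
      using 1 by (auto simp: \<mu> passive_generator_def g_rot_def fun_eq_iff)
    then show ?thesis
      using symmetric_hop_sum[of "1/2" "1/2" j j] by simp
  next
    case 2
    then have "passive_generator \<mu> = (\<lambda>\<phi> m. 1 * creat j (annih k \<phi>) m + 1 * creat k (annih j \<phi>) m)"
      by (auto simp: \<mu> passive_generator_def g_bsX_def fun_eq_iff)
    then show ?thesis
      using symmetric_hop_sum[of 1 1 j k] by simp
  next
    case 3
    then have "passive_generator \<mu> = (\<lambda>\<phi> m. (- \<i>) * creat k (annih j \<phi>) m + \<i> * creat j (annih k \<phi>) m)"
      by (auto simp: \<mu> passive_generator_def g_bsY_def fun_eq_iff algebra_simps)
    then show ?thesis
      using symmetric_hop_sum[of \<i> "- \<i>" k j] by simp
  qed
qed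

lemma symmetric_expectation_real:
  assumes "symmetric_op G" "exp_decay \<psi>"
  shows "cnj (expectation \<psi> G) = expectation \<psi> G"
  using assms fock_inner_cnj[of \<psi> "G \<psi>"] by (simp add: symmetric_op_def expectation_def)

lemma symmetric_centred:
  assumes G: "symmetric_op G" and \<psi>: "exp_decay \<psi>"
  shows "symmetric_op (centred \<psi> G)"
  unfolding symmetric_op_def
proof (intro conjI allI impI)
  have eq: "centred \<psi> G \<phi> = (\<lambda>m. (- expectation \<psi> G) * \<phi> m + G \<phi> m)" for \<phi>
    by (simp add: centred_def)
  fix \<phi> :: "'a::finite fock" assume \<phi>: "exp_decay \<phi>"
  have G\<phi>: "exp_decay (G \<phi>)"
    using G \<phi> by (simp add: symmetric_op_def)
  show "exp_decay (centred \<psi> G \<phi>)"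
    unfolding eq by (intro exp_decay_add exp_decay_scale G\<phi> \<phi>)
  fix \<xi> :: "'a::finite fock" assume \<xi>: "exp_decay \<xi>"
  have G\<xi>: "exp_decay (G \<xi>)" "fock_inner \<phi> (G \<xi>) = fock_inner (G \<phi>) \<xi>"
    using G \<phi> \<xi> by (auto simp: symmetric_op_def)
  have fs: "\<phi> \<in> fock_space" "\<xi> \<in> fock_space" "G \<phi> \<in> fock_space" "G \<xi> \<in> fock_space"
    by (intro exp_decay_fock \<phi> \<xi> G\<phi> G\<xi>)+
  show "fock_inner \<phi> (centred \<psi> G \<xi>) = fock_inner (centred \<psi> G \<phi>) \<xi>"
    unfolding eq fock_inner_lin_right[OF fs(1,2,4)] fock_inner_lin_left[OF fs(2,1,3)]
    using symmetric_expectation_real[OF G \<psi>] G\<xi>(2) by simp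
qed

text \<open>Symmetry moves one operator to the left, leaving the real part of a Gram matrix; the
  anticommutator contributes a number and its conjugate, which doubles the prefactor.\<close>

lemma F_passive_eq:
  "F_passive r $ \<mu> $ \<nu> = 4 * Re (fock_inner (centred (probe r) (passive_generator \<mu>) (probe r))
    (centred (probe r) (passive_generator \<nu>) (probe r)))"
proof -
  let ?\<psi> = "probe r"
  let ?A = "centred ?\<psi> (passive_generator \<mu>)" and ?B = "centred ?\<psi> (passive_generator \<nu>)"
  have \<psi>: "exp_decay ?\<psi>"
    by (rule squeezed_exp_decay[OF probe_squeezed(1)])
  have A: "symmetric_op ?A" and B: "symmetric_op ?B"
    by (intro symmetric_centred symmetric_passive \<psi>)+
  have ed: "exp_decay (?A ?\<psi>)" "exp_decay (?B ?\<psi>)" "exp_decay (?A (?B ?\<psi>))" "exp_decay (?B (?A ?\<psi>))"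
    using A B \<psi> by (auto simp: symmetric_op_def)
  have "expectation ?\<psi> (anticommutator ?A ?B) = fock_inner ?\<psi> (?A (?B ?\<psi>)) + fock_inner ?\<psi> (?B (?A ?\<psi>))"
    using fock_inner_lin_right[of ?\<psi> "?A (?B ?\<psi>)" "?B (?A ?\<psi>)" 1] \<psi> ed
    by (simp add: expectation_def anticommutator_def exp_decay_fock)
  also have "\<dots> = fock_inner (?A ?\<psi>) (?B ?\<psi>) + cnj (fock_inner (?A ?\<psi>) (?B ?\<psi>))"
    using A B \<psi> ed fock_inner_cnj[of "?B ?\<psi>" "?A ?\<psi>"] by (simp add: symmetric_op_def)
  finally show ?thesis
    by (simp add: F_passive_def)
qed

definition pair_creat :: "'n \<times> 'n \<Rightarrow> 'n fock \<Rightarrow> 'n fock" where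
  "pair_creat \<mu> \<phi> = creat (fst \<mu>) (creat (snd \<mu>) \<phi>)"

lemma creat_creat_commute: "creat j (creat k \<phi>) = creat k (creat j \<phi>)"
  by (cases "j = k") (auto simp: creat_def fun_upd_twist fun_eq_iff)

lemma pair_creat_swap: "pair_creat (k, j) \<phi> = pair_creat (j, k) \<phi>"
  using creat_creat_commute by (simp add: pair_creat_def)

text \<open>Factor in front of \<open>pair_creat\<close> once \<open>annih k\<close> is replaced by
  \<open>- \<tau> k\<close> times \<open>creat k\<close>. A label \<open>(j, k)\<close> with
  \<open>k < j\<close> stands for \<open>g_bsY k j\<close>, hence the order
  \<open>\<tau> j - \<tau> k\<close>.\<close>

definition passive_coeff :: "('n::linorder \<Rightarrow> real) \<Rightarrow> 'n \<times> 'n \<Rightarrow> complex" where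
  "passive_coeff \<tau> \<mu> = (case \<mu> of (j, k) \<Rightarrow>
     if j = k then - of_real (\<tau> j) else if j < k then - of_real (\<tau> j + \<tau> k) else \<i> * of_real (\<tau> j - \<tau> k))"

lemma passive_generator_pair_creat:
  assumes "\<And>k m. annih k \<phi> m = - of_real (\<tau> k) * creat k \<phi> m"
  shows "passive_generator \<mu> \<phi> m = passive_coeff \<tau> \<mu> * pair_creat \<mu> \<phi> m"
proof -
  obtain j k where \<mu>: "\<mu> = (j, k)" by fastforce
  have an: "annih k \<phi> = (\<lambda>m. - of_real (\<tau> k) * creat k \<phi> m)" for k
    using assms by blast
  have hop: "creat j (annih k \<phi>) m = - of_real (\<tau> k) * creat j (creat k \<phi>) m" for j k
    unfolding an by (simp add: creat_def)
  show ?thesis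
    using creat_creat_commute[of j k \<phi>]
    by (cases j k rule: linorder_cases)
       (auto simp: \<mu> passive_generator_def passive_coeff_def pair_creat_def g_rot_def g_bsX_def g_bsY_def hop algebra_simps)
qed

section \<open>Parity of occupations and number covariance\<close>

definition odd_modes :: "('n \<Rightarrow> nat) \<Rightarrow> 'n set" where
  "odd_modes m = {k. odd (m k)}"

lemma squeezed_odd:
  assumes "squeezed \<rho> \<phi>" "odd (m k)"
  shows "\<phi> m = 0"
proof -
  define g where "g n = \<phi> (m(k := n))" for n
  have step: "complex_of_real (sqrt (real (n + 1))) * g (n + 1) =
      - of_real (tanh (\<rho> k)) * (of_real (sqrt (real n)) * g (n - 1))" for n
    unfolding g_def by (rule squeezed_step[OF assms(1)])
  have "g (2 * n + 1) = 0" for n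
  proof (induction n)
    case 0
    then show ?case
      using step[of 0] by simp
  next
    case (Suc n)
    have "complex_of_real (sqrt (real (2 * n + 2 + 1))) * g (2 * n + 2 + 1) = 0"
      unfolding step[of "2 * n + 2"] using Suc.IH by simp
    moreover have "complex_of_real (sqrt (real (2 * n + 2 + 1))) \<noteq> 0"
      by (simp only: of_real_eq_0_iff real_sqrt_eq_0_iff of_nat_eq_0_iff)
    ultimately have "g (2 * n + 2 + 1) = 0"
      using mult_eq_0_iff by blast
    then show ?case by simp
  qed
  moreover obtain n where "m k = 2 * n + 1"
    using assms(2) by (elim oddE)
  ultimately show ?thesis
    unfolding g_def by (metis fun_upd_triv)
qed

lemma odd_modes_creat:
  assumes "\<And>m. \<phi> m \<noteq> 0 \<Longrightarrow> odd_modes m = S" "creat k \<phi> m \<noteq> 0"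
  shows "odd_modes m = (if k \<in> S then S - {k} else insert k S)"
proof -
  have nz: "m k \<noteq> 0" "\<phi> (m(k := m k - 1)) \<noteq> 0"
    using assms(2) by (auto simp: creat_def)
  have S: "odd_modes (m(k := m k - 1)) = S"
    by (rule assms(1)[OF nz(2)])
  have "odd (m k - 1) \<longleftrightarrow> even (m k)"
    using nz(1) by (cases "m k") auto
  then show ?thesis
    unfolding S[symmetric] by (auto simp: odd_modes_def)
qed

text \<open>The modes whose parity \<open>pair_creat \<mu>\<close> changes; for a diagonal label the
  two flips cancel.\<close>

definition offdiag :: "'n \<times> 'n \<Rightarrow> 'n set" where
  "offdiag \<mu> = (if fst \<mu> = snd \<mu> then {} else {fst \<mu>, snd \<mu>})"

lemma odd_modes_pair:
  assumes "squeezed \<rho> \<phi>" "pair_creat \<mu> \<phi> m \<noteq> 0"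
  shows "odd_modes m = offdiag \<mu>"
proof -
  have 0: "odd_modes m = {}" if "\<phi> m \<noteq> 0" for m
    using squeezed_odd[OF assms(1)] that by (auto simp: odd_modes_def)
  have 1: "odd_modes m = {snd \<mu>}" if "creat (snd \<mu>) \<phi> m \<noteq> 0" for m
    using odd_modes_creat[OF 0 that] by simp
  show ?thesis
    using odd_modes_creat[OF 1 assms(2)[unfolded pair_creat_def]] by (auto simp: offdiag_def)
qed

lemma fock_inner_disjoint: "(\<And>m. \<phi> m = 0 \<or> \<xi> m = 0) \<Longrightarrow> fock_inner \<phi> \<xi> = 0"
  unfolding fock_inner_def by (rule infsum_0) (metis complex_cnj_zero mult_eq_0_iff)

lemma number_op: "creat j (annih j \<phi>) m = of_nat (m j) * \<phi> m"
proof (cases "m j")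
  case (Suc n)
  have "complex_of_real (sqrt (real (Suc n))) * (complex_of_real (sqrt (real (Suc n))) * x) = of_nat (Suc n) * x" for x
    unfolding mult.assoc[symmetric] of_real_mult[symmetric] by simp
  then show ?thesis
    using Suc fun_upd_triv[of m j] by (simp add: creat_def annih_def del: of_nat_Suc)
qed (simp add: creat_def)

lemma annih_creat: "annih j (creat j \<phi>) m = of_nat (m j) * \<phi> m + \<phi> m"
proof -
  have sq: "complex_of_real (sqrt (real (Suc n))) * (complex_of_real (sqrt (real (Suc n))) * x) = of_nat (Suc n) * x" for x n
    unfolding mult.assoc[symmetric] of_real_mult[symmetric] by simp
  show ?thesis
    by (simp add: creat_def annih_def sq del: of_nat_Suc) (simp add: distrib_right)
qed

text \<open>Let \<open>X\<close> be the inner product with the number operator and \<open>P\<close>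
  the one without. Moving a ladder operator across, using the relation on both sides and moving back
  gives \<open>X = t\<^sup>2 * (X + P)\<close>, where \<open>P\<close> comes from the
  commutator.\<close>

lemma squeezed_number_inner:
  fixes \<phi> :: "'n::finite fock"
  assumes ed: "exp_decay \<phi>" "exp_decay \<xi>"
    and \<phi>: "\<And>m. annih j \<phi> m = - of_real t * creat j \<phi> m"
    and \<xi>: "\<And>m. annih j \<xi> m = - of_real t * creat j \<xi> m"
  shows "of_real (1 - t\<^sup>2) * fock_inner \<phi> (creat j (annih j \<xi>)) = of_real (t\<^sup>2) * fock_inner \<phi> \<xi>"
proof -
  have eq: "annih j \<phi> = (\<lambda>m. - of_real t * creat j \<phi> m)" "annih j \<xi> = (\<lambda>m. - of_real t * creat j \<xi> m)"
    using \<phi> \<xi> by blast+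
  have "annih j (creat j \<xi>) = (\<lambda>m. 1 * creat j (annih j \<xi>) m + \<xi> m)"
    by (simp add: fun_eq_iff annih_creat number_op)
  then have 1: "fock_inner \<phi> (annih j (creat j \<xi>)) = fock_inner \<phi> (creat j (annih j \<xi>)) + fock_inner \<phi> \<xi>"
    using fock_inner_lin_right[of \<phi> "creat j (annih j \<xi>)" \<xi> 1] ed
    by (simp add: exp_decay_fock exp_decay_hop)
  have "fock_inner \<phi> (creat j (annih j \<xi>)) = fock_inner (annih j \<phi>) (annih j \<xi>)"
    by (rule fock_inner_creat)
  also have "\<dots> = of_real (t\<^sup>2) * fock_inner (creat j \<phi>) (creat j \<xi>)"
    unfolding eq fock_inner_scale_left fock_inner_scale_right by (simp add: power2_eq_square)
  also have "fock_inner (creat j \<phi>) (creat j \<xi>) = fock_inner \<phi> (annih j (creat j \<xi>))"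
    by (rule fock_inner_annih[symmetric])
  finally have E: "fock_inner \<phi> (creat j (annih j \<xi>)) =
      of_real (t\<^sup>2) * (fock_inner \<phi> (creat j (annih j \<xi>)) + fock_inner \<phi> \<xi>)"
    unfolding 1 .
  have "(1 - T) * X = T * P" if "X = T * (X + P)" for T X P :: complex
    using that by algebra
  from this[OF E] show ?thesis
    by simp
qed

text \<open>
  \<open>N\<^sub>l \<psi>\<close> obeys the same relation between \<open>a\<^sub>j\<close> and \<open>a\<^sub>j\<^sup>\<dagger>\<close> as \<open>\<psi>\<close>, so \<open>squeezed_number_inner\<close>
  factorises the expectation of \<open>N\<^sub>j N\<^sub>l\<close>.
\<close>

lemma number_covariance:
  fixes \<psi> :: "'n::{finite,linorder} fock"
  assumes sq: "squeezed \<rho> \<psi>" and norm: "fock_norm \<psi> = 1" and jl: "j \<noteq> l"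
  shows "fock_inner (centred \<psi> (g_rot j) \<psi>) (centred \<psi> (g_rot l) \<psi>) = 0"
proof -
  define N where "N i = creat i (annih i \<psi>)" for i
  define e where "e i = fock_inner \<psi> (N i)" for i
  define t where "t = tanh (\<rho> j)"
  have ed: "exp_decay \<psi>" "exp_decay (N i)" for i
    unfolding N_def by (intro exp_decay_hop squeezed_exp_decay[OF sq])+
  have fs: "\<psi> \<in> fock_space" "N i \<in> fock_space" for i
    by (intro exp_decay_fock ed)+
  have an: "annih j \<psi> m = - of_real t * creat j \<psi> m" for m
    unfolding t_def by (rule squeezed_annih[OF sq])
  have anN: "annih j (N l) m = - of_real t * creat j (N l) m" for m
  proof -
    have "N l = (\<lambda>m. of_nat (m l) * \<psi> m)"
      by (simp add: N_def fun_eq_iff number_op)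
    then have "annih j (N l) m = of_nat (m l) * annih j \<psi> m" "creat j (N l) m = of_nat (m l) * creat j \<psi> m"
      using jl by (simp_all add: annih_def creat_def)
    then show ?thesis
      by (simp add: an)
  qed
  have one: "fock_inner \<psi> \<psi> = 1"
    using fock_inner_self[OF fs(1)] norm by simp
  have 1: "of_real (1 - t\<^sup>2) * e j = of_real (t\<^sup>2)"
    using squeezed_number_inner[OF ed(1) ed(1) an an] by (simp add: e_def N_def one)
  have 2: "of_real (1 - t\<^sup>2) * fock_inner \<psi> (creat j (annih j (N l))) = of_real (t\<^sup>2) * e l"
    using squeezed_number_inner[OF ed(1) ed(2) an anN] by (simp add: e_def)
  have "\<bar>t\<bar> < 1"
    using tanh_real_lt_1[of "\<rho> j"] tanh_real_gt_neg1[of "\<rho> j"] by (simp add: t_def abs_less_iff)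
  then have "complex_of_real (1 - t\<^sup>2) \<noteq> 0"
    unfolding of_real_eq_0_iff using abs_square_less_1[of t] by simp
  moreover have "of_real (1 - t\<^sup>2) * fock_inner \<psi> (creat j (annih j (N l))) = of_real (1 - t\<^sup>2) * (e j * e l)"
    unfolding 2 1[symmetric] by simp
  ultimately have "fock_inner \<psi> (creat j (annih j (N l))) = e j * e l"
    by simp
  then have NN: "fock_inner (N j) (N l) = e j * e l"
    by (simp add: N_def fock_inner_hop)
  have cn: "centred \<psi> (g_rot i) \<psi> = (\<lambda>m. (- e i) * \<psi> m + N i m)" for i
    by (simp add: centred_def expectation_def g_rot_def e_def N_def)
  have ereal: "cnj (e i) = e i" "fock_inner (N i) \<psi> = e i" for i
  proof -
    have "fock_inner (N i) \<psi> = e i"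
      by (simp add: e_def N_def fock_inner_hop)
    then show "fock_inner (N i) \<psi> = e i" "cnj (e i) = e i"
      using fock_inner_cnj[of \<psi> "N i"] by (simp_all add: e_def)
  qed
  have fc: "(\<lambda>m. (- e l) * \<psi> m + N l m) \<in> fock_space"
    by (intro fock_lin fs)
  show ?thesis
    unfolding cn fock_inner_lin_left[OF fc fs(1) fs(2)] fock_inner_lin_right[OF fs(1) fs(1) fs(2)]
      fock_inner_lin_right[OF fs(2) fs(1) fs(2)] one NN ereal
    by (simp add: e_def[symmetric] ereal)
qed

text \<open>Every amplitude is bounded by a multiple of the vacuum amplitude, so its vanishing would
  contradict the normalisation.\<close>

lemma squeezed_vacuum_amplitude:
  fixes \<psi> :: "'n::finite fock"
  assumes sq: "squeezed \<rho> \<psi>" and norm: "fock_norm \<psi> = 1"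
  shows "\<psi> (\<lambda>_. 0) \<noteq> 0"
proof
  assume 0: "\<psi> (\<lambda>_. 0) = 0"
  obtain x where "\<And>m. cmod (\<psi> m) \<le> cmod (\<psi> (\<lambda>_. 0)) * x ^ (\<Sum>k\<in>UNIV. m k)"
    using squeezed_bound[OF sq] by blast
  then have "\<psi> = (\<lambda>_. 0)"
    using 0 by auto
  then show False
    using norm by simp
qed

lemma centred_offdiag:
  fixes \<psi> :: "'n::{finite,linorder} fock"
  assumes sq: "squeezed \<rho> \<psi>" and \<mu>: "fst \<mu> \<noteq> snd \<mu>"
  shows "centred \<psi> (passive_generator \<mu>) \<psi> = (\<lambda>m. passive_coeff (\<lambda>k. tanh (\<rho> k)) \<mu> * pair_creat \<mu> \<psi> m)"
proof -
  note G = passive_generator_pair_creat[OF squeezed_annih[OF sq]]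
  have "fock_inner \<psi> (passive_generator \<mu> \<psi>) = 0"
  proof (rule fock_inner_disjoint)
    fix m
    show "\<psi> m = 0 \<or> passive_generator \<mu> \<psi> m = 0"
      using squeezed_odd[OF sq, of m "fst \<mu>"] odd_modes_pair[OF sq, of \<mu> m] \<mu>
      unfolding G by (auto simp: odd_modes_def offdiag_def)
  qed
  then show ?thesis
    by (simp add: centred_def expectation_def G)
qed

lemma odd_modes_centred:
  fixes \<psi> :: "'n::{finite,linorder} fock"
  assumes sq: "squeezed \<rho> \<psi>" and nz: "centred \<psi> (passive_generator \<mu>) \<psi> m \<noteq> 0"
  shows "odd_modes m = offdiag \<mu>"
proof (cases "fst \<mu> = snd \<mu>")
  case True
  have "\<psi> m \<noteq> 0 \<or> pair_creat \<mu> \<psi> m \<noteq> 0"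
    using nz by (auto simp: centred_def passive_generator_pair_creat[OF squeezed_annih[OF sq]])
  then show ?thesis
    using squeezed_odd[OF sq, of m] odd_modes_pair[OF sq, of \<mu> m] True by (auto simp: odd_modes_def offdiag_def)
next
  case False
  then show ?thesis
    using nz odd_modes_pair[OF sq, of \<mu> m] by (auto simp: centred_offdiag[OF sq])
qed

lemma F_passive_offdiag:
  fixes r :: "real ^ 'n::{finite,linorder}"
  assumes "\<mu> \<noteq> \<nu>"
  shows "F_passive r $ \<mu> $ \<nu> = 0"
proof -
  note sq = probe_squeezed(1)[of r]
  let ?\<psi> = "probe r"
  let ?c = "\<lambda>\<mu>. centred ?\<psi> (passive_generator \<mu>) ?\<psi>"
  have off: "offdiag (a, b) = (if a = b then {} else {a, b})" for a b :: 'n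
    by (simp add: offdiag_def)
  obtain j k j' k' where jk: "\<mu> = (j, k)" "\<nu> = (j', k')" by fastforce
  \<comment> \<open>Equal parity patterns either determine the unordered pair of modes or say that
    both labels are diagonal; for distinct labels this leaves the last two cases.\<close>
  consider (parity) "offdiag \<mu> \<noteq> offdiag \<nu>"
    | (diag) "fst \<mu> = snd \<mu>" "fst \<nu> = snd \<nu>"
    | (swap) "fst \<mu> \<noteq> snd \<mu>" "\<nu> = (snd \<mu>, fst \<mu>)"
    using assms unfolding jk by (cases "j = k"; cases "j' = k'") (auto simp: off doubleton_eq_iff)
  then have "Re (fock_inner (?c \<mu>) (?c \<nu>)) = 0"
  proof cases
    case parity
    have "fock_inner (?c \<mu>) (?c \<nu>) = 0"
      using odd_modes_centred[OF sq, of \<mu>] odd_modes_centred[OF sq, of \<nu>] parity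
      by (intro fock_inner_disjoint) metis
    then show ?thesis by simp
  next
    case diag
    obtain j l where jl: "\<mu> = (j, j)" "\<nu> = (l, l)"
      using diag by (metis prod.collapse)
    then have "fock_inner (?c \<mu>) (?c \<nu>) = 0"
      using number_covariance[OF probe_squeezed(1,2)[of r], of j l] assms by (simp add: passive_generator_def)
    then show ?thesis by simp
  next
    case swap
    obtain j k where \<mu>: "\<mu> = (j, k)" by fastforce
    have jk: "j \<noteq> k" "\<nu> = (k, j)"
      using swap by (auto simp: \<mu>)
    let ?\<tau> = "\<lambda>k. tanh (r $ k)"
    have "fock_inner (?c \<mu>) (?c \<nu>) = cnj (passive_coeff ?\<tau> (j, k)) * passive_coeff ?\<tau> (k, j) *
        of_real ((fock_norm (pair_creat (j, k) ?\<psi>))\<^sup>2)"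
    proof -
      have "pair_creat (j, k) ?\<psi> \<in> fock_space"
        by (simp add: pair_creat_def exp_decay_fock exp_decay_creat squeezed_exp_decay[OF sq])
      then show ?thesis
        using jk unfolding \<mu> jk(2)
        by (simp add: centred_offdiag[OF sq] fock_inner_scale_left fock_inner_scale_right pair_creat_swap[of k j] fock_inner_self)
    qed
    \<comment> \<open>One of the two labels is an X generator with real coefficient, the other a Y
      generator with imaginary coefficient.\<close>
    moreover have "Re (cnj (passive_coeff ?\<tau> (j, k)) * passive_coeff ?\<tau> (k, j)) = 0"
      using jk(1) by (cases j k rule: linorder_cases) (auto simp: passive_coeff_def)
    ultimately show ?thesis by simp
  qed
  then show ?thesis
    by (simp add: F_passive_eq)
qed

text \<open>The entry is 4 times a squared norm, so it vanishes only together with every amplitude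
  of the centred vector; well-chosen amplitudes then expose the coefficient.\<close>

lemma F_passive_diag:
  "F_passive r $ \<mu> $ \<mu> = 0 \<longleftrightarrow> passive_coeff (\<lambda>k. tanh (r $ k)) \<mu> = 0"
proof -
  note sq = probe_squeezed(1)[of r] and nrm = probe_squeezed(2)[of r]
  let ?\<psi> = "probe r" and ?z = "passive_coeff (\<lambda>k. tanh (r $ k)) \<mu>"
  let ?c = "centred ?\<psi> (passive_generator \<mu>) ?\<psi>"
  obtain j k where \<mu>: "\<mu> = (j, k)" by fastforce
  have ed: "exp_decay ?\<psi>"
    by (rule squeezed_exp_decay[OF sq])
  have "exp_decay ?c"
    using symmetric_centred[OF symmetric_passive ed, of \<mu>] ed by (simp add: symmetric_op_def)
  then have fs: "?c \<in> fock_space"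
    by (rule exp_decay_fock)
  have F: "F_passive r $ \<mu> $ \<mu> = 4 * (fock_norm ?c)\<^sup>2"
    by (simp add: F_passive_eq fock_inner_self[OF fs])
  note G = passive_generator_pair_creat[OF squeezed_annih[OF sq], of \<mu>]
  note v0 = squeezed_vacuum_amplitude[OF sq nrm]
  show ?thesis
  proof
    assume z: "?z = 0"
    then have "passive_generator \<mu> ?\<psi> = (\<lambda>m. 0)"
      using G by (simp add: fun_eq_iff)
    then have "?c = (\<lambda>m. 0)"
      by (simp add: centred_def expectation_def fock_inner_def)
    then show "F_passive r $ \<mu> $ \<mu> = 0"
      unfolding F by simp
  next
    assume "F_passive r $ \<mu> $ \<mu> = 0"
    then have c0: "?c m = 0" for m
      using fock_norm_eq_0[OF fs] unfolding F by simp
    show "?z = 0"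
    proof (cases "j = k")
      case False
      \<comment> \<open>One quantum in each of the modes \<open>j\<close> and \<open>k\<close>: here
        \<open>pair_creat\<close> has exactly the vacuum amplitude of the probe.\<close>
      define m where "m = (\<lambda>i. if i = j \<or> i = k then 1 else 0 :: nat)"
      have "m(j := 0, k := 0) = (\<lambda>_. 0)"
        by (auto simp: m_def)
      then have "pair_creat \<mu> ?\<psi> m = ?\<psi> (\<lambda>_. 0)"
        using False by (simp add: \<mu> pair_creat_def creat_def m_def)
      then show ?thesis
        using c0[of m] v0 False by (simp add: centred_offdiag[OF sq] \<mu>)
    next
      case True
      define e where "e = expectation ?\<psi> (g_rot j)"
      have c: "of_nat (m j) * ?\<psi> m - e * ?\<psi> m = 0" for m
        using c0[of m] True by (simp add: \<mu> passive_generator_def centred_def e_def g_rot_def number_op)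
      \<comment> \<open>The vacuum component forces the mean to vanish. Then the amplitude with two
        quanta in mode \<open>j\<close> vanishes too, and the recursion ties it to
        \<open>tanh (r $ j)\<close> times the vacuum amplitude.\<close>
      have "e = 0"
        using c[of "\<lambda>_. 0"] v0 by simp
      then have "?\<psi> ((\<lambda>_. 0)(j := 1 + 1)) = 0"
        using c[of "(\<lambda>_. 0)(j := 1 + 1)"] by simp
      then have "of_real (tanh (r $ j)) * ?\<psi> ((\<lambda>_. 0)(j := 1 - 1)) = 0"
        using squeezed_step[OF sq, of 1 "\<lambda>_. 0" j] by simp
      then have "tanh (r $ j) = 0"
        using v0 by (simp add: fun_upd_idem)
      then show ?thesis
        using True by (simp add: \<mu> passive_coeff_def)
    qed
  qed
qed

section \<open>Roots as functions of the labels\<close>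

definition root_of :: "'n \<times> 'n \<Rightarrow> real ^ 'n::{finite,linorder} \<Rightarrow> real" where
  "root_of \<mu> = (case \<mu> of (j, k) \<Rightarrow>
     if j = k then (\<lambda>r. 2 * r $ j) else if j < k then (\<lambda>r. r $ j + r $ k) else (\<lambda>r. r $ k - r $ j))"

lemma root_generator_iff: "root_generator \<alpha> \<mu> \<longleftrightarrow> \<alpha> = root_of \<mu>"
proof
  show "root_generator \<alpha> \<mu> \<Longrightarrow> \<alpha> = root_of \<mu>"
    by (induction rule: root_generator.induct) (auto simp: root_of_def)
  show "\<alpha> = root_of \<mu> \<Longrightarrow> root_generator \<alpha> \<mu>"
    by (cases \<mu>; cases "fst \<mu>" "snd \<mu>" rule: linorder_cases)
       (auto simp: root_of_def intro: root_generator.intros)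
qed

lemma root_of_axis:
  "root_of (j, k) (axis i 1) =
    (if j = k then (if i = j then 2 else 0) else if j < k then (if i = j \<or> i = k then 1 else 0)
     else if i = k then 1 else if i = j then - 1 else 0)"
  by (auto simp: root_of_def axis_def)

text \<open>Roots are counted as functions while labels index the matrix; injectivity makes the two
  counts agree. Values on the coordinate axes already separate the roots.\<close>

lemma inj_root_of: "inj (root_of :: 'n::{finite,linorder} \<times> 'n \<Rightarrow> _)"
proof (rule injI)
  fix \<mu> \<nu> :: "'n \<times> 'n" assume eq: "root_of \<mu> = root_of \<nu>"
  obtain j k j' k' where \<mu>: "\<mu> = (j, k)" "\<nu> = (j', k')" by fastforce
  have "root_of (j, k) (axis i 1) = root_of (j', k') (axis i 1)" for i
    using eq \<mu> by simp
  from this[of j] this[of k] this[of j'] this[of k'] show "\<mu> = \<nu>"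
    unfolding root_of_axis \<mu> by (auto split: if_splits)
qed

text \<open>The hyperbolic tangent is odd and injective, so sums and differences of its values
  vanish exactly with those of the arguments.\<close>

lemma passive_coeff_eq_0_iff:
  "passive_coeff (\<lambda>k. tanh (r $ k)) \<mu> = 0 \<longleftrightarrow> root_of \<mu> r = 0"
proof -
  obtain j k where \<mu>: "\<mu> = (j, k)" by fastforce
  have "tanh (r $ j) + tanh (r $ k) = 0 \<longleftrightarrow> tanh (r $ j) = tanh (- (r $ k))"
    by (simp add: eq_neg_iff_add_eq_0)
  also have "\<dots> \<longleftrightarrow> r $ j + r $ k = 0"
    unfolding tanh_real_eq_iff by (simp add: eq_neg_iff_add_eq_0)
  finally have plus: "tanh (r $ j) + tanh (r $ k) = 0 \<longleftrightarrow> r $ j + r $ k = 0" .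
  show ?thesis
    using plus unfolding \<mu> passive_coeff_def root_of_def
    by (auto simp flip: of_real_add of_real_diff)
qed

lemma positive_roots_eq: "positive_roots = range root_of"
  using positive_root_iff_generator by (auto simp: root_generator_iff)

theorem theoremS15:
  fixes r :: "real ^ 'n::{finite,linorder}"
  shows "(det (F_passive r) = 0 \<longleftrightarrow> r \<in> arrangement) \<and>
    (r \<in> arrangement \<longrightarrow>
       dim {v. F_passive r *v v = 0} = card {\<alpha> \<in> positive_roots. \<alpha> r = 0}) \<and>
    (\<forall>\<alpha>\<in>positive_roots. \<forall>\<mu>. root_generator \<alpha> \<mu> \<longrightarrow> \<alpha> r = 0 \<longrightarrow>
       F_passive r *v axis \<mu> 1 = 0)"
proof (intro conjI impI ballI allI)
  define d where "d = {\<mu>. root_of \<mu> r = 0}"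
  have diag: "F_passive r $ \<mu> $ \<mu> = 0 \<longleftrightarrow> \<mu> \<in> d" for \<mu>
    by (simp add: d_def F_passive_diag passive_coeff_eq_0_iff)
  have mult: "(F_passive r *v v) $ \<mu> = F_passive r $ \<mu> $ \<mu> * v $ \<mu>" for v \<mu>
  proof -
    have "(F_passive r *v v) $ \<mu> = (\<Sum>\<nu>\<in>UNIV. F_passive r $ \<mu> $ \<nu> * v $ \<nu>)"
      by (simp add: matrix_vector_mult_def)
    also have "\<dots> = F_passive r $ \<mu> $ \<mu> * v $ \<mu>"
      by (subst sum.remove[of _ \<mu>]) (auto intro!: sum.neutral simp: F_passive_offdiag)
    finally show ?thesis .
  qed
  have "det (F_passive r) = (\<Prod>\<mu>\<in>UNIV. F_passive r $ \<mu> $ \<mu>)"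
    by (rule det_diagonal) (rule F_passive_offdiag)
  then have "det (F_passive r) = 0 \<longleftrightarrow> d \<noteq> {}"
    using diag by auto
  also have "\<dots> \<longleftrightarrow> r \<in> arrangement"
    by (auto simp: arrangement_def positive_roots_eq d_def)
  finally show "det (F_passive r) = 0 \<longleftrightarrow> r \<in> arrangement" .
  \<comment> \<open>The kernel of a diagonal matrix is the coordinate subspace of its zero
    entries.\<close>
  have "{v. F_passive r *v v = 0} = {v. \<forall>\<mu>. \<mu> \<notin> d \<longrightarrow> v $ \<mu> = 0}"
    using diag by (auto simp: vec_eq_iff mult)
  then have "dim {v. F_passive r *v v = 0} = card d"
    using dim_substandard_cart[of d, where ?'a = real] by (simp add: dim_vec_eq)
  also have "card d = card (root_of ` d)"
    by (intro card_image[symmetric] inj_on_subset[OF inj_root_of]) simp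
  also have "root_of ` d = {\<alpha> \<in> positive_roots. \<alpha> r = 0}"
    by (auto simp: positive_roots_eq d_def)
  finally show "dim {v. F_passive r *v v = 0} = card {\<alpha> \<in> positive_roots. \<alpha> r = 0}" .
  show "F_passive r *v axis \<mu> 1 = 0" if "root_generator \<alpha> \<mu>" "\<alpha> r = 0" for \<alpha> \<mu>
    using that diag by (simp add: vec_eq_iff mult root_generator_iff axis_def d_def)
qed

end
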